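(* The following are vector space bases of $Z_n(\mathfrak{sl}_2)$ for $n=2,3,4$ (exponents range over $\mathbb{Z}_{\geq0}$ unless further restricted). (i) For $n=2$: the set of all $P_{11}^{a}P_{12}^{b}P_{22}^{c}$. (ii) For $n=3$: the set of all $P_{11}^{a}P_{12}^{b}P_{13}^{c}P_{22}^{d}P_{23}^{e}P_{33}^{f}F_{123}^{\varepsilon}$ with $\varepsilon\in\{0,1\}$. (iii) For $n=4$: the union of the five sets $\{F_{123}P_{11}^{a}P_{12}^{b}P_{13}^{c}P_{14}^{d}P_{22}^{e}P_{23}^{f}P_{24}^{g}P_{33}^{h}P_{34}^{i}\}$, $\{F_{124}P_{11}^{a}P_{12}^{b}P_{13}^{c}P_{14}^{d}P_{22}^{e}P_{23}^{f}P_{24}^{g}P_{34}^{h}P_{44}^{i}\}$, $\{F_{134}P_{11}^{a}P_{12}^{b}P_{13}^{c}P_{14}^{d}P_{23}^{e}P_{24}^{f}P_{33}^{g}P_{34}^{h}P_{44}^{i}\}$, $\{F_{234}P_{12}^{a}P_{13}^{b}P_{14}^{c}P_{22}^{d}P_{23}^{e}P_{24}^{f}P_{33}^{g}P_{34}^{h}P_{44}^{i}\}$, and $\{P_{11}^{a}P_{12}^{b}P_{13}^{c}P_{14}^{d}P_{22}^{e}P_{23}^{f}P_{24}^{g}P_{33}^{h}P_{34}^{i}P_{44}^{j} : aehj=0\}$.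
   Context: Everything is over $\mathbb{C}$. $\mathfrak{sl}_2$ is spanned by $e_{ij}$, $i,j\in\{1,2\}$, with $[e_{ij},e_{k\ell}]=\delta_{jk}e_{i\ell}-\delta_{\ell i}e_{kj}$ and $e_{11}+e_{22}=0$. In $U(\mathfrak{sl}_2)^{\otimes n}$ write $e_{ij}^{(a)}=1^{\otimes(a-1)}\otimes e_{ij}\otimes 1^{\otimes(n-a)}$. The diagonal embedding is the algebra map $\delta:U(\mathfrak{sl}_2)\to U(\mathfrak{sl}_2)^{\otimes n}$, $e_{ij}\mapsto\sum_{a=1}^n e_{ij}^{(a)}$, and the centralizer is $Z_n(\mathfrak{sl}_2)=\{X\in U(\mathfrak{sl}_2)^{\otimes n} : [\delta(g),X]=0\ \forall g\in U(\mathfrak{sl}_2)\}$. The elements $P_{ab},F_{abc}\in Z_n(\mathfrak{sl}_2)$ are the polarized traces (up to sign) $$P_{ab}=\sum_{i,j\in\{1,2\}}e^{(a)}_{ji}e^{(b)}_{ij},\qquad F_{abc}=-\sum_{i,j,k\in\{1,2\}}e^{(a)}_{ji}e^{(b)}_{kj}e^{(c)}_{ik}\quad(a,b,c\text{ distinct}).$$ *)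

theory Defs
  imports "HOL-Analysis.Determinants" "HOL-Library.Poly_Mapping"
begin

section \<open>Complex vector spaces, algebras and Lie algebras\<close>

class complex_vector = ab_group_add +
  fixes scaleC :: "complex \<Rightarrow> 'a \<Rightarrow> 'a" (infixr "*\<^sub>C" 75)
  assumes scaleC_add_right: "c *\<^sub>C (x + y) = c *\<^sub>C x + c *\<^sub>C y"
    and scaleC_add_left: "(c + d) *\<^sub>C x = c *\<^sub>C x + d *\<^sub>C x"
    and scaleC_scaleC: "c *\<^sub>C (d *\<^sub>C x) = (c * d) *\<^sub>C x"
    and scaleC_one: "1 *\<^sub>C x = x"

class complex_algebra_1 = complex_vector + ring_1 +
  assumes mult_scaleC_left: "(c *\<^sub>C x) * y = c *\<^sub>C (x * y)"
    and mult_scaleC_right: "x * (c *\<^sub>C y) = c *\<^sub>C (x * y)"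

class complex_lie_algebra = complex_vector +
  fixes bracket :: "'a \<Rightarrow> 'a \<Rightarrow> 'a"
  assumes bracket_add_left: "bracket (x + y) z = bracket x z + bracket y z"
    and bracket_add_right: "bracket x (y + z) = bracket x y + bracket x z"
    and bracket_scaleC_left: "bracket (c *\<^sub>C x) y = c *\<^sub>C bracket x y"
    and bracket_scaleC_right: "bracket x (c *\<^sub>C y) = c *\<^sub>C bracket x y"
    and bracket_self: "bracket x x = 0"
    and jacobi: "bracket x (bracket y z) + bracket y (bracket z x) + bracket z (bracket x y) = 0"

global_interpretation cvec: vector_space "scaleC :: complex \<Rightarrow> 'a \<Rightarrow> 'a::complex_vector"
  defines cspan = cvec.span
    and cdependent = cvec.dependent
    and csubspace = cvec.subspace
  by unfold_locales (rule scaleC_add_right scaleC_add_left scaleC_scaleC scaleC_one)+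

text \<open>Injectivity on the index set is part of the notion: different indices give different
  basis vectors.\<close>

definition is_basis_family :: "('i \<Rightarrow> 'v::complex_vector) \<Rightarrow> 'i set \<Rightarrow> 'v set \<Rightarrow> bool"
  where "is_basis_family f I V \<longleftrightarrow>
    inj_on f I \<and> \<not> cdependent (f ` I) \<and> cspan (f ` I) = V"

instantiation complex :: complex_algebra_1
begin
definition scaleC_complex :: "complex \<Rightarrow> complex \<Rightarrow> complex" where "scaleC_complex = (*)"
instance by standard (simp_all add: scaleC_complex_def algebra_simps)
end


section \<open>Two-sided ideals and monoid algebras\<close>

inductive_set ideal_gen :: "'r::ring_1 set \<Rightarrow> 'r set" for G where
  zero: "0 \<in> ideal_gen G"
| gen: "g \<in> G \<Longrightarrow> g \<in> ideal_gen G"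
| add: "p \<in> ideal_gen G \<Longrightarrow> q \<in> ideal_gen G \<Longrightarrow> p + q \<in> ideal_gen G"
| mult: "p \<in> ideal_gen G \<Longrightarrow> x * p * y \<in> ideal_gen G"

lemma ideal_gen_left: "p \<in> ideal_gen G \<Longrightarrow> x * p \<in> ideal_gen G"
  using ideal_gen.mult[of p G x 1] by simp

lemma ideal_gen_right: "p \<in> ideal_gen G \<Longrightarrow> p * y \<in> ideal_gen G"
  using ideal_gen.mult[of p G 1 y] by simp

lemma ideal_gen_uminus: "p \<in> ideal_gen G \<Longrightarrow> - p \<in> ideal_gen G"
  using ideal_gen_left[of p G "-1"] by simp

lemma ideal_gen_diff: "p \<in> ideal_gen G \<Longrightarrow> q \<in> ideal_gen G \<Longrightarrow> p - q \<in> ideal_gen G"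
  using ideal_gen.add[OF _ ideal_gen_uminus] by fastforce

lemma ideal_gen_cong_equivp: "equivp (\<lambda>p q. p - q \<in> ideal_gen G)"
proof (rule equivpI)
  show "reflp (\<lambda>p q. p - q \<in> ideal_gen G)"
    by (rule reflpI) (simp add: ideal_gen.zero)
  show "symp (\<lambda>p q. p - q \<in> ideal_gen G)"
    by (rule sympI) (metis ideal_gen_uminus minus_diff_eq)
  show "transp (\<lambda>p q. p - q \<in> ideal_gen G)"
  proof (rule transpI)
    fix p q r assume "p - q \<in> ideal_gen G" "q - r \<in> ideal_gen G"
    then have "(p - q) + (q - r) \<in> ideal_gen G" by (rule ideal_gen.add)
    then show "p - r \<in> ideal_gen G" by simp
  qed
qed

lemma ideal_gen_cong_add:
  "p - p' \<in> ideal_gen G \<Longrightarrow> q - q' \<in> ideal_gen G \<Longrightarrow> (p + q) - (p' + q') \<in> ideal_gen G"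
  using ideal_gen.add[of "p - p'" G "q - q'"] by (simp add: algebra_simps)

lemma ideal_gen_cong_diff:
  "p - p' \<in> ideal_gen G \<Longrightarrow> q - q' \<in> ideal_gen G \<Longrightarrow> (p - q) - (p' - q') \<in> ideal_gen G"
  using ideal_gen_diff[of "p - p'" G "q - q'"] by (simp add: algebra_simps)

lemma ideal_gen_cong_uminus:
  "p - p' \<in> ideal_gen G \<Longrightarrow> (- p) - (- p') \<in> ideal_gen G"
  using ideal_gen_uminus[of "p - p'" G] by (simp add: algebra_simps)

lemma ideal_gen_cong_mult:
  assumes "p - p' \<in> ideal_gen G" "q - q' \<in> ideal_gen G"
  shows "(p * q) - (p' * q') \<in> ideal_gen G"
proof -
  have "(p - p') * q + p' * (q - q') \<in> ideal_gen G"
    using assms by (intro ideal_gen.add ideal_gen_left ideal_gen_right)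
  then show ?thesis by (simp add: algebra_simps)
qed

text \<open>For a monoid \<open>'m\<close> (written additively, as required by the convolution product of
  \<^theory>\<open>HOL-Library.Poly_Mapping\<close>) the type \<open>'m \<Rightarrow>\<^sub>0 complex\<close> is the monoid algebra of \<open>'m\<close>.
  \<open>cst c\<close> is the scalar \<open>c\<close> in it, \<open>mon m\<close> the basis vector of \<open>m\<close>.\<close>

abbreviation cst :: "complex \<Rightarrow> ('m::monoid_add \<Rightarrow>\<^sub>0 complex)"
  where "cst c \<equiv> Poly_Mapping.single 0 c"

abbreviation mon :: "'m \<Rightarrow> ('m \<Rightarrow>\<^sub>0 complex)"
  where "mon m \<equiv> Poly_Mapping.single m 1"

definition pm_extend :: "('m \<Rightarrow> 'v::complex_vector) \<Rightarrow> ('m \<Rightarrow>\<^sub>0 complex) \<Rightarrow> 'v"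
  where "pm_extend \<phi> p = (\<Sum>m\<in>Poly_Mapping.keys p. Poly_Mapping.lookup p m *\<^sub>C \<phi> m)"

lemma pm_extend_superset:
  assumes "finite S" "Poly_Mapping.keys p \<subseteq> S"
  shows "pm_extend \<phi> p = (\<Sum>m\<in>S. Poly_Mapping.lookup p m *\<^sub>C \<phi> m)"
  unfolding pm_extend_def using assms
  by (intro sum.mono_neutral_left) (auto simp: in_keys_iff)

lemma pm_extend_zero [simp]: "pm_extend \<phi> 0 = 0"
  by (simp add: pm_extend_def)

lemma pm_extend_add: "pm_extend \<phi> (p + q) = pm_extend \<phi> p + pm_extend \<phi> q"
proof -
  let ?S = "Poly_Mapping.keys p \<union> Poly_Mapping.keys q"
  have "Poly_Mapping.keys (p + q) \<subseteq> ?S" by (rule keys_add)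
  then show ?thesis
    by (simp add: pm_extend_superset[of ?S] lookup_add scaleC_add_left sum.distrib)
qed

lemma pm_extend_single [simp]: "pm_extend \<phi> (Poly_Mapping.single m c) = c *\<^sub>C \<phi> m"
  by (cases "c = 0") (simp_all add: pm_extend_def)

lemma pm_extend_one [simp]:
  "pm_extend \<phi> (1 :: 'm::monoid_add \<Rightarrow>\<^sub>0 complex) = \<phi> 0"
  unfolding single_one[symmetric] pm_extend_single by (rule scaleC_one)

lemma pm_extend_uminus: "pm_extend \<phi> (- p) = - pm_extend \<phi> p"
  using pm_extend_add[of \<phi> p "- p"] by (simp add: eq_neg_iff_add_eq_0 add.commute)

lemma pm_extend_diff: "pm_extend \<phi> (p - q) = pm_extend \<phi> p - pm_extend \<phi> q"
  using pm_extend_add[of \<phi> p "- q"] by (simp add: pm_extend_uminus)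

lemma pm_sum_singles:
  "p = (\<Sum>m\<in>Poly_Mapping.keys p. Poly_Mapping.single m (Poly_Mapping.lookup p m))"
  by (rule poly_mapping_eqI)
     (auto simp: lookup_sum lookup_single when_def in_keys_iff)

lemma pm_induct [case_names zero single add]:
  assumes z: "P 0" and s: "\<And>m c. P (Poly_Mapping.single m c)"
    and a: "\<And>p q. P p \<Longrightarrow> P q \<Longrightarrow> P (p + q)"
  shows "P (p :: 'm \<Rightarrow>\<^sub>0 complex)"
proof -
  have "P (\<Sum>m\<in>S. Poly_Mapping.single m (Poly_Mapping.lookup p m))" for S
    by (induction S rule: infinite_finite_induct) (use assms in auto)
  then show ?thesis using pm_sum_singles[of p] by metis
qed

lemma pm_extend_mult:
  fixes \<phi> :: "'m::monoid_add \<Rightarrow> 'a::complex_algebra_1"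
  assumes "\<And>k l. \<phi> (k + l) = \<phi> k * \<phi> l"
  shows "pm_extend \<phi> (p * q) = pm_extend \<phi> p * pm_extend \<phi> q"
proof (induction p rule: pm_induct)
  case (single m c)
  show ?case
  proof (induction q rule: pm_induct)
    case (single n d)
    show ?case
      by (simp add: mult_single assms mult_scaleC_left mult_scaleC_right scaleC_scaleC)
  qed (simp_all add: distrib_left pm_extend_add)
qed (simp_all add: distrib_right pm_extend_add)

lemma pm_extend_ideal:
  fixes \<phi> :: "'m::monoid_add \<Rightarrow> 'a::complex_algebra_1"
  assumes "\<And>k l. \<phi> (k + l) = \<phi> k * \<phi> l" "\<And>g. g \<in> G \<Longrightarrow> pm_extend \<phi> g = 0"
    and "p \<in> ideal_gen G"
  shows "pm_extend \<phi> p = 0"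
  using assms(3) by induction (simp_all add: pm_extend_add pm_extend_mult assms(1,2))

lemma cst_commute: "cst c * p = p * cst c" for p :: "'m::monoid_add \<Rightarrow>\<^sub>0 complex"
  by (induction p rule: pm_induct) (simp_all add: mult_single mult.commute distrib_left distrib_right)

lemma cst_add: "cst (c + d) = cst c + cst d"
  by (rule single_add)

lemma cst_mult: "cst (c * d) = cst c * cst d"
  by (simp add: mult_single)


section \<open>The universal enveloping algebra\<close>

datatype 'g free_monoid = Word (letters: "'g list")

instantiation free_monoid :: (type) monoid_add
begin
definition zero_free_monoid :: "'a free_monoid" where "zero_free_monoid = Word []"
definition plus_free_monoid :: "'a free_monoid \<Rightarrow> 'a free_monoid \<Rightarrow> 'a free_monoid"
  where "plus_free_monoid v w = Word (letters v @ letters w)"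
instance by standard (simp_all add: zero_free_monoid_def plus_free_monoid_def)
end

type_synonym 'g free_algebra = "'g free_monoid \<Rightarrow>\<^sub>0 complex"

abbreviation letter :: "'g \<Rightarrow> 'g free_algebra" where "letter x \<equiv> mon (Word [x])"

text \<open>The first two kinds of relations turn the free algebra on the set \<open>'g\<close> into the tensor
  algebra of the vector space \<open>'g\<close>.\<close>

inductive_set uea_rels :: "'g::complex_lie_algebra free_algebra set" where
  add: "letter (x + y) - (letter x + letter y) \<in> uea_rels"
| scale: "letter (c *\<^sub>C x) - cst c * letter x \<in> uea_rels"
| bracket: "letter (bracket x y) - (letter x * letter y - letter y * letter x) \<in> uea_rels"

definition uea_cong :: "'g::complex_lie_algebra free_algebra \<Rightarrow> 'g free_algebra \<Rightarrow> bool"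
  where "uea_cong p q \<longleftrightarrow> p - q \<in> ideal_gen uea_rels"

lemma uea_cong_equivp: "equivp uea_cong"
  using ideal_gen_cong_equivp[of uea_rels] by (simp add: uea_cong_def[abs_def])

quotient_type (overloaded) 'g uea = "'g::complex_lie_algebra free_algebra" / uea_cong
  by (rule uea_cong_equivp)

lemma pm_extend_word_uea_rels:
  fixes f :: "'g::complex_lie_algebra \<Rightarrow> 'a::complex_algebra_1"
  assumes "\<And>x y. f (x + y) = f x + f y" "\<And>c x. f (c *\<^sub>C x) = c *\<^sub>C f x"
    and "\<And>x y. f (bracket x y) = f x * f y - f y * f x"
    and "p \<in> ideal_gen uea_rels"
  shows "pm_extend (\<lambda>w. prod_list (map f (letters w))) p = 0"
proof (rule pm_extend_ideal[OF _ _ assms(4)])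
  show "prod_list (map f (letters (k + l))) =
      prod_list (map f (letters k)) * prod_list (map f (letters l))" for k l
    by (simp add: plus_free_monoid_def)
  show "pm_extend (\<lambda>w. prod_list (map f (letters w))) g = 0" if "g \<in> uea_rels" for g
    using that
    by cases (simp_all add: pm_extend_add pm_extend_diff mult_single assms
        plus_free_monoid_def zero_free_monoid_def scaleC_one)
qed

lemma uea_nontrivial: "\<not> uea_cong 0 1"
proof
  assume "uea_cong (0 :: 'a free_algebra) 1"
  then have "(0 - 1 :: 'a free_algebra) \<in> ideal_gen uea_rels" by (simp add: uea_cong_def)
  then have "pm_extend (\<lambda>w. prod_list (map (\<lambda>_. 0::complex) (letters w))) (0 - 1 :: 'a free_algebra) = 0"
    by (intro pm_extend_word_uea_rels) (simp_all add: scaleC_complex_def)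
  then show False by (simp add: pm_extend_uminus zero_free_monoid_def)
qed

instantiation uea :: (complex_lie_algebra) complex_algebra_1
begin

lift_definition zero_uea :: "'a uea" is 0 .
lift_definition one_uea :: "'a uea" is 1 .
lift_definition plus_uea :: "'a uea \<Rightarrow> 'a uea \<Rightarrow> 'a uea" is "(+)"
  unfolding uea_cong_def by (rule ideal_gen_cong_add)
lift_definition minus_uea :: "'a uea \<Rightarrow> 'a uea \<Rightarrow> 'a uea" is "(-)"
  unfolding uea_cong_def by (rule ideal_gen_cong_diff)
lift_definition uminus_uea :: "'a uea \<Rightarrow> 'a uea" is uminus
  unfolding uea_cong_def by (rule ideal_gen_cong_uminus)
lift_definition times_uea :: "'a uea \<Rightarrow> 'a uea \<Rightarrow> 'a uea" is "(*)"
  unfolding uea_cong_def by (rule ideal_gen_cong_mult)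
lift_definition scaleC_uea :: "complex \<Rightarrow> 'a uea \<Rightarrow> 'a uea" is "\<lambda>c p. cst c * p"
  unfolding uea_cong_def by (simp add: ideal_gen_left flip: right_diff_distrib)

instance
proof
  show "(0 :: 'a uea) \<noteq> 1" by transfer (rule uea_nontrivial)
  show "x * c *\<^sub>C y = c *\<^sub>C (x * y)" for c and x y :: "'a uea"
  proof transfer
    fix c and x y :: "'a free_algebra"
    have "x * (cst c * y) = cst c * (x * y)"
      by (metis cst_commute mult.assoc)
    then show "uea_cong (x * (cst c * y)) (cst c * (x * y))"
      by (simp add: uea_cong_def ideal_gen.zero)
  qed
qed (transfer, simp add: uea_cong_def ideal_gen.zero algebra_simps cst_add cst_mult)+

end

lift_definition uea_incl :: "'g::complex_lie_algebra \<Rightarrow> 'g uea" is letter .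

lemma uea_incl_add: "uea_incl (x + y) = uea_incl x + uea_incl y"
  by transfer (simp add: uea_cong_def ideal_gen.gen uea_rels.add)

lemma uea_incl_scaleC: "uea_incl (c *\<^sub>C x) = c *\<^sub>C uea_incl x"
  by transfer (simp add: uea_cong_def ideal_gen.gen uea_rels.scale)

lemma uea_incl_bracket:
  "uea_incl (bracket x y) = uea_incl x * uea_incl y - uea_incl y * uea_incl x"
  by transfer (simp add: uea_cong_def ideal_gen.gen uea_rels.bracket)


section \<open>Tensor powers of an algebra\<close>

datatype ('a, 'n) tuple = Tuple (entry: "'n \<Rightarrow> 'a")

instantiation tuple :: (monoid_mult, type) monoid_add
begin
definition zero_tuple :: "('a, 'b) tuple" where "zero_tuple = Tuple (\<lambda>_. 1)"
definition plus_tuple :: "('a, 'b) tuple \<Rightarrow> ('a, 'b) tuple \<Rightarrow> ('a, 'b) tuple"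
  where "plus_tuple s t = Tuple (\<lambda>i. entry s i * entry t i)"
instance by standard (simp_all add: zero_tuple_def plus_tuple_def mult.assoc)
end

text \<open>The free vector space on the set of tuples, with the componentwise product, is the monoid
  algebra of the monoid of tuples. The span of the multilinearity relations is already stable
  under multiplication by tuples, so it coincides with the ideal it generates.\<close>

type_synonym ('a, 'n) pre_tensor = "('a, 'n) tuple \<Rightarrow>\<^sub>0 complex"

inductive_set tensor_rels :: "('a::complex_algebra_1, 'n) pre_tensor set" where
  add: "mon (Tuple (f(i := x + y))) - (mon (Tuple (f(i := x))) + mon (Tuple (f(i := y))))
    \<in> tensor_rels"
| scale: "mon (Tuple (f(i := c *\<^sub>C x))) - cst c * mon (Tuple (f(i := x))) \<in> tensor_rels"

definition tensor_cong ::
    "('a::complex_algebra_1, 'n) pre_tensor \<Rightarrow> ('a, 'n) pre_tensor \<Rightarrow> bool"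
  where "tensor_cong p q \<longleftrightarrow> p - q \<in> ideal_gen tensor_rels"

lemma tensor_cong_equivp: "equivp tensor_cong"
  using ideal_gen_cong_equivp[of tensor_rels] by (simp add: tensor_cong_def[abs_def])

text \<open>\<open>('a, 'n) tensor_power\<close> is the tensor power of \<open>'a\<close> over the complex numbers whose factors
  are indexed by the finite type \<open>'n\<close>.\<close>

quotient_type (overloaded) ('a, 'n) tensor_power =
    "('a::complex_algebra_1, 'n::finite) pre_tensor" / tensor_cong
  by (rule tensor_cong_equivp)

lemma tensor_rels_mult_single:
  fixes g :: "('a::complex_algebra_1, 'n) pre_tensor"
  assumes "g \<in> tensor_rels"
  shows "\<exists>h\<in>tensor_rels. Poly_Mapping.single s c * g * Poly_Mapping.single t d = cst (c * d) * h"
  using assms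
proof cases
  case (add f i x y)
  define k where "k = (\<lambda>j. entry s j * f j * entry t j)"
  have eq: "s + Tuple (f(i := z)) + t = Tuple (k(i := entry s i * z * entry t i))" for z
    by (auto simp: plus_tuple_def k_def fun_eq_iff)
  show ?thesis
    by (rule bexI[OF _ tensor_rels.add[of k i "entry s i * x * entry t i" "entry s i * y * entry t i"]])
       (simp add: add eq mult_single right_diff_distrib left_diff_distrib distrib_left distrib_right)
next
  case (scale f i e x)
  define k where "k = (\<lambda>j. entry s j * f j * entry t j)"
  have eq: "s + Tuple (f(i := z)) + t = Tuple (k(i := entry s i * z * entry t i))" for z
    by (auto simp: plus_tuple_def k_def fun_eq_iff)
  show ?thesis
    by (rule bexI[OF _ tensor_rels.scale[of k i e "entry s i * x * entry t i"]])
       (simp add: scale eq mult_single right_diff_distrib left_diff_distrib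
         mult_scaleC_left mult_scaleC_right mult.assoc mult.left_commute mult.commute)
qed

lemma tensor_ideal_span:
  fixes p :: "('a::complex_algebra_1, 'n) pre_tensor"
    and \<Phi> :: "('a, 'n) tuple \<Rightarrow> 'v::complex_vector"
  assumes \<Phi>: "\<And>g. g \<in> tensor_rels \<Longrightarrow> pm_extend \<Phi> g = 0" and "p \<in> ideal_gen tensor_rels"
  shows "pm_extend \<Phi> p = 0"
proof -
  have scale: "pm_extend \<Phi> (cst c * q) = c *\<^sub>C pm_extend \<Phi> q" for c and q :: "('a, 'n) pre_tensor"
    by (induction q rule: pm_induct)
       (simp_all add: mult_single distrib_left pm_extend_add scaleC_add_right scaleC_scaleC)
  have "pm_extend \<Phi> (u * p * v) = 0" for u v
    using assms(2)
  proof (induction arbitrary: u v)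
    case (gen g)
    show ?case
    proof (induction u rule: pm_induct)
      case (single s c)
      show ?case
      proof (induction v rule: pm_induct)
        case (single t d)
        show ?case
          using tensor_rels_mult_single[OF gen, of s c t d] by (auto simp: scale \<Phi>)
      qed (simp_all add: distrib_left pm_extend_add)
    qed (simp_all add: distrib_right pm_extend_add)
  next
    case (mult p x y)
    then show ?case by (metis mult.assoc)
  qed (simp_all add: distrib_left distrib_right pm_extend_add)
  from this[of 1 1] show ?thesis by simp
qed

lemma exists_functional_one:
  "\<exists>l :: 'a::complex_algebra_1 \<Rightarrow> complex.
     (\<forall>x y. l (x + y) = l x + l y) \<and> (\<forall>c x. l (c *\<^sub>C x) = c * l x) \<and> l 1 = 1"
proof -
  interpret vp: vector_space_pair "scaleC :: complex \<Rightarrow> 'a \<Rightarrow> 'a" "scaleC :: complex \<Rightarrow> complex \<Rightarrow> complex"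
    by unfold_locales
  have "\<not> module.dependent scaleC {1 :: 'a}"
    using cvec.dependent_single[of "1 :: 'a"] by (simp add: cdependent_def)
  from vp.linear_independent_extend[OF this, of "\<lambda>_. 1"]
  obtain l :: "'a \<Rightarrow> complex" where l: "Vector_Spaces.linear scaleC scaleC l" "l 1 = 1" by auto
  interpret Vector_Spaces.linear scaleC scaleC l by (rule l)
  show ?thesis using l(2) add scale by (intro exI[of _ l]) (simp add: scaleC_complex_def)
qed

lemma tensor_nontrivial: "\<not> tensor_cong 0 (1 :: ('a::complex_algebra_1, 'n::finite) pre_tensor)"
proof
  assume "tensor_cong 0 (1 :: ('a, 'n) pre_tensor)"
  then have *: "(0 - 1 :: ('a, 'n) pre_tensor) \<in> ideal_gen tensor_rels"
    by (simp add: tensor_cong_def)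
  obtain l :: "'a \<Rightarrow> complex"
    where l: "\<And>x y. l (x + y) = l x + l y" "\<And>c x. l (c *\<^sub>C x) = c * l x" "l 1 = 1"
    using exists_functional_one by blast
  have prod_upd: "(\<Prod>j\<in>UNIV. l ((f(i := x)) j)) = l x * (\<Prod>j\<in>UNIV - {i}. l (f j))"
    for f :: "'n \<Rightarrow> 'a" and i x
    by (subst prod.remove[of _ i]) auto
  have "pm_extend (\<lambda>t. \<Prod>j\<in>UNIV. l (entry t j)) (0 - 1 :: ('a, 'n) pre_tensor) = 0"
  proof (rule tensor_ideal_span[OF _ *])
    fix g :: "('a, 'n) pre_tensor" assume "g \<in> tensor_rels"
    then show "pm_extend (\<lambda>t. \<Prod>j\<in>UNIV. l (entry t j)) g = 0"
      by cases (simp_all del: fun_upd_apply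
          add: pm_extend_add pm_extend_diff mult_single prod_upd l scaleC_complex_def
            distrib_right mult.assoc)
  qed
  then show False by (simp add: pm_extend_uminus zero_tuple_def l)
qed

instantiation tensor_power :: (complex_algebra_1, finite) complex_algebra_1
begin

lift_definition zero_tensor_power :: "('a, 'b) tensor_power" is 0 .
lift_definition one_tensor_power :: "('a, 'b) tensor_power" is 1 .
lift_definition plus_tensor_power ::
  "('a, 'b) tensor_power \<Rightarrow> ('a, 'b) tensor_power \<Rightarrow> ('a, 'b) tensor_power" is "(+)"
  unfolding tensor_cong_def by (rule ideal_gen_cong_add)
lift_definition minus_tensor_power ::
  "('a, 'b) tensor_power \<Rightarrow> ('a, 'b) tensor_power \<Rightarrow> ('a, 'b) tensor_power" is "(-)"
  unfolding tensor_cong_def by (rule ideal_gen_cong_diff)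
lift_definition uminus_tensor_power ::
  "('a, 'b) tensor_power \<Rightarrow> ('a, 'b) tensor_power" is uminus
  unfolding tensor_cong_def by (rule ideal_gen_cong_uminus)
lift_definition times_tensor_power ::
  "('a, 'b) tensor_power \<Rightarrow> ('a, 'b) tensor_power \<Rightarrow> ('a, 'b) tensor_power" is "(*)"
  unfolding tensor_cong_def by (rule ideal_gen_cong_mult)
lift_definition scaleC_tensor_power ::
  "complex \<Rightarrow> ('a, 'b) tensor_power \<Rightarrow> ('a, 'b) tensor_power" is "\<lambda>c p. cst c * p"
  unfolding tensor_cong_def by (simp add: ideal_gen_left flip: right_diff_distrib)

instance
proof
  show "(0 :: ('a, 'b) tensor_power) \<noteq> 1" by transfer (rule tensor_nontrivial)
  show "x * c *\<^sub>C y = c *\<^sub>C (x * y)" for c and x y :: "('a, 'b) tensor_power"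
  proof transfer
    fix c and x y :: "('a, 'b) pre_tensor"
    have "x * (cst c * y) = cst c * (x * y)"
      by (metis cst_commute mult.assoc)
    then show "tensor_cong (x * (cst c * y)) (cst c * (x * y))"
      by (simp add: tensor_cong_def ideal_gen.zero)
  qed
qed (transfer, simp add: tensor_cong_def ideal_gen.zero algebra_simps cst_add cst_mult)+

end

lift_definition pure_tensor :: "('n::finite \<Rightarrow> 'a::complex_algebra_1) \<Rightarrow> ('a, 'n) tensor_power"
  is "\<lambda>f. mon (Tuple f)" .

definition in_factor :: "'n::finite \<Rightarrow> 'a::complex_algebra_1 \<Rightarrow> ('a, 'n) tensor_power"
  where "in_factor a x = pure_tensor ((\<lambda>_. 1)(a := x))"

lemma pure_tensor_mult: "pure_tensor f * pure_tensor g = pure_tensor (\<lambda>i. f i * g i)"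
  by transfer (simp add: mult_single plus_tuple_def tensor_cong_def ideal_gen.zero)

lemma pure_tensor_one: "pure_tensor (\<lambda>_. 1) = 1"
  by transfer (simp flip: single_one zero_tuple_def add: tensor_cong_def ideal_gen.zero)

lemma pure_tensor_add:
  "pure_tensor (f(i := x + y)) = pure_tensor (f(i := x)) + pure_tensor (f(i := y))"
  by transfer (simp add: tensor_cong_def ideal_gen.gen tensor_rels.add)

lemma pure_tensor_scaleC: "pure_tensor (f(i := c *\<^sub>C x)) = c *\<^sub>C pure_tensor (f(i := x))"
  by transfer (simp add: tensor_cong_def ideal_gen.gen tensor_rels.scale)

lemma in_factor_add: "in_factor a (x + y) = in_factor a x + in_factor a y"
  by (simp add: in_factor_def pure_tensor_add)

lemma in_factor_scaleC: "in_factor a (c *\<^sub>C x) = c *\<^sub>C in_factor a x"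
  by (simp add: in_factor_def pure_tensor_scaleC)

lemma in_factor_diff: "in_factor a (x - y) = in_factor a x - in_factor a y"
  using in_factor_add[of a "x - y" y] by simp

lemma in_factor_mult: "in_factor a (x * y) = in_factor a x * in_factor a y"
  unfolding in_factor_def pure_tensor_mult by (rule arg_cong[of _ _ pure_tensor]) auto

lemma in_factor_commute: "a \<noteq> b \<Longrightarrow> in_factor a x * in_factor b y = in_factor b y * in_factor a x"
  unfolding in_factor_def pure_tensor_mult by (rule arg_cong[of _ _ pure_tensor]) auto


section \<open>The diagonal embedding and its centralizer\<close>

definition diag_gen :: "'g::complex_lie_algebra \<Rightarrow> ('g uea, 'n::finite) tensor_power"
  where "diag_gen x = (\<Sum>a\<in>UNIV. in_factor a (uea_incl x))"

lemma diag_gen_add: "diag_gen (x + y) = diag_gen x + diag_gen y"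
  by (simp add: diag_gen_def uea_incl_add in_factor_add sum.distrib)

lemma diag_gen_scaleC: "diag_gen (c *\<^sub>C x) = c *\<^sub>C diag_gen x"
  by (simp add: diag_gen_def uea_incl_scaleC in_factor_scaleC cvec.scale_sum_right)

lemma diag_gen_bracket:
  fixes x y :: "'g::complex_lie_algebra"
  shows "(diag_gen (bracket x y) :: ('g uea, 'n::finite) tensor_power) =
    diag_gen x * diag_gen y - diag_gen y * diag_gen x"
proof -
  let ?X = "\<lambda>a::'n. in_factor a (uea_incl x)" and ?Y = "\<lambda>a::'n. in_factor a (uea_incl y)"
  have "(diag_gen x * diag_gen y - diag_gen y * diag_gen x :: ('g uea, 'n) tensor_power) =
      (\<Sum>a\<in>UNIV. \<Sum>b\<in>UNIV. ?X a * ?Y b) - (\<Sum>a\<in>UNIV. \<Sum>b\<in>UNIV. ?Y b * ?X a)"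
    unfolding diag_gen_def sum_product by (subst (2) sum.swap) simp
  also have "\<dots> = (\<Sum>a\<in>UNIV. \<Sum>b\<in>UNIV. if b = a then ?X a * ?Y a - ?Y a * ?X a else 0)"
    unfolding sum_subtractf[symmetric]
    by (intro sum.cong refl) (simp add: in_factor_commute)
  also have "\<dots> = diag_gen (bracket x y)"
    by (simp add: diag_gen_def uea_incl_bracket in_factor_diff in_factor_mult)
  finally show ?thesis by simp
qed

lift_definition diag :: "'g::complex_lie_algebra uea \<Rightarrow> ('g uea, 'n::finite) tensor_power"
  is "pm_extend (\<lambda>w. prod_list (map diag_gen (letters w)))"
proof -
  fix p q :: "'g free_algebra" assume "uea_cong p q"
  then have "pm_extend (\<lambda>w. prod_list (map (diag_gen :: _ \<Rightarrow> ('g uea, 'n) tensor_power) (letters w))) (p - q) = 0"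
    unfolding uea_cong_def
    by (intro pm_extend_word_uea_rels) (simp_all add: diag_gen_add diag_gen_scaleC diag_gen_bracket)
  then show "pm_extend (\<lambda>w. prod_list (map (diag_gen :: _ \<Rightarrow> ('g uea, 'n) tensor_power) (letters w))) p =
      pm_extend (\<lambda>w. prod_list (map diag_gen (letters w))) q"
    by (simp add: pm_extend_diff)
qed

lemma diag_uea_incl: "diag (uea_incl x) = (\<Sum>a\<in>UNIV. in_factor a (uea_incl x))"
  by (simp add: diag.abs_eq uea_incl.abs_eq scaleC_one diag_gen_def)

lemma diag_add: "diag (u + v) = diag u + diag v"
  by transfer (rule pm_extend_add)

lemma diag_mult: "diag (u * v) = diag u * diag v"
  by transfer (rule pm_extend_mult, simp add: plus_free_monoid_def)

lemma diag_one: "diag 1 = 1"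
  by transfer (simp flip: single_one add: zero_free_monoid_def scaleC_one)

lemma diag_scaleC: "diag (c *\<^sub>C u) = c *\<^sub>C diag u"
proof transfer
  fix c and u :: "'a free_algebra"
  let ?\<phi> = "\<lambda>w. prod_list (map (diag_gen :: _ \<Rightarrow> ('a uea, 'b) tensor_power) (letters w))"
  have "pm_extend ?\<phi> (cst c * u) = pm_extend ?\<phi> (cst c) * pm_extend ?\<phi> u"
    by (rule pm_extend_mult) (simp add: plus_free_monoid_def)
  then show "pm_extend ?\<phi> (cst c * u) = c *\<^sub>C pm_extend ?\<phi> u"
    by (simp add: zero_free_monoid_def mult_scaleC_left)
qed

definition centralizer :: "('g::complex_lie_algebra uea, 'n::finite) tensor_power set"
  where "centralizer = {X. \<forall>u. diag u * X - X * diag u = 0}"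


section \<open>The Lie algebra of traceless two by two matrices\<close>

typedef sl2 = "{A :: complex^2^2. trace A = 0}"
  by (rule exI[of _ 0]) (simp add: trace_def)

setup_lifting type_definition_sl2

instantiation sl2 :: complex_lie_algebra
begin

lift_definition zero_sl2 :: sl2 is 0 by (simp add: trace_def)
lift_definition plus_sl2 :: "sl2 \<Rightarrow> sl2 \<Rightarrow> sl2" is "(+)" by (simp add: trace_add)
lift_definition minus_sl2 :: "sl2 \<Rightarrow> sl2 \<Rightarrow> sl2" is "(-)" by (simp add: trace_sub)
lift_definition uminus_sl2 :: "sl2 \<Rightarrow> sl2" is uminus by (simp add: trace_def sum_negf)
lift_definition scaleC_sl2 :: "complex \<Rightarrow> sl2 \<Rightarrow> sl2" is "\<lambda>c A. \<chi> i j. c * A $ i $ j"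
  by (simp add: trace_def flip: sum_distrib_left)
lift_definition bracket_sl2 :: "sl2 \<Rightarrow> sl2 \<Rightarrow> sl2" is "\<lambda>A B. A ** B - B ** A"
  by (simp add: trace_sub) (metis trace_mul_sym)

instance
  by standard
     (transfer, simp add: vec_eq_iff matrix_matrix_mult_def sum_2 algebra_simps)+

end

text \<open>\<open>sl2_e i j\<close> is the image of the matrix unit \<open>E\<^sub>i\<^sub>j\<close> under the projection of the two by two
  matrices onto the traceless ones along the identity matrix; this is what makes
  \<open>e\<^sub>1\<^sub>1 + e\<^sub>2\<^sub>2 = 0\<close> hold.\<close>

lift_definition sl2_e :: "2 \<Rightarrow> 2 \<Rightarrow> sl2"
  is "\<lambda>i j. \<chi> k l. (if k = i \<and> l = j then 1 else 0) - (if i = j \<and> k = l then 1/2 else 0)"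
proof -
  show "trace (\<chi> k l. (if k = i \<and> l = j then 1 else 0) -
      (if i = j \<and> k = l then 1/2 else 0) :: complex^2^2) = 0" for i j :: 2
    using exhaust_2[of i] exhaust_2[of j] by (auto simp: trace_def sum_2)
qed

lemma sl2_e_bracket:
  "bracket (sl2_e i j) (sl2_e k l) =
    (if j = k then sl2_e i l else 0) - (if l = i then sl2_e k j else 0)"
  using exhaust_2[of i] exhaust_2[of j] exhaust_2[of k] exhaust_2[of l]
  by (elim disjE; simp; transfer;
      simp add: vec_eq_iff forall_2 matrix_matrix_mult_def sum_2)

lemma sl2_e_trace: "sl2_e 1 1 + sl2_e 2 2 = 0"
  by transfer (simp add: vec_eq_iff forall_2)

lemma sl2_e_span: "\<exists>a b c. x = a *\<^sub>C sl2_e 1 1 + b *\<^sub>C sl2_e 1 2 + c *\<^sub>C sl2_e 2 1"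
proof transfer
  fix x :: "complex^2^2" assume "trace x = 0"
  then have "x $ 2 $ 2 = - x $ 1 $ 1"
    by (simp add: trace_def sum_2 eq_neg_iff_add_eq_0 add.commute)
  then show "\<exists>a b c. x =
      (\<chi> i j. a * (\<chi> k l. (if k = 1 \<and> l = 1 then 1 else 0) - (if (1::2) = 1 \<and> k = l then 1/2 else 0)) $ i $ j) +
      (\<chi> i j. b * (\<chi> k l. (if k = 1 \<and> l = 2 then 1 else 0) - (if (1::2) = 2 \<and> k = l then 1/2 else 0)) $ i $ j) +
      (\<chi> i j. c * (\<chi> k l. (if k = 2 \<and> l = 1 then 1 else 0) - (if (2::2) = 1 \<and> k = l then 1/2 else 0)) $ i $ j)"
    by (intro exI[of _ "2 * x $ 1 $ 1"] exI[of _ "x $ 1 $ 2"] exI[of _ "x $ 2 $ 1"])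
       (simp add: vec_eq_iff forall_2)
qed


section \<open>Polarized traces\<close>

text \<open>The factors of the \<open>n\<close>-th tensor power are indexed by the numeral type \<open>n\<close>, whose elements
  are \<open>1, \<dots>, n\<close>; the last of them is the same as \<open>0\<close> there, arithmetic being modulo \<open>n\<close>.\<close>

type_synonym 'n U_sl2 = "(sl2 uea, 'n) tensor_power"

definition e_at :: "2 \<Rightarrow> 2 \<Rightarrow> 'n::finite \<Rightarrow> 'n U_sl2"
  where "e_at i j a = in_factor a (uea_incl (sl2_e i j))"

definition trP :: "'n::finite \<Rightarrow> 'n \<Rightarrow> 'n U_sl2"
  where "trP a b = (\<Sum>i\<in>UNIV. \<Sum>j\<in>UNIV. e_at j i a * e_at i j b)"

definition trF :: "'n::finite \<Rightarrow> 'n \<Rightarrow> 'n \<Rightarrow> 'n U_sl2"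
  where "trF a b c =
    - (\<Sum>i\<in>UNIV. \<Sum>j\<in>UNIV. \<Sum>k\<in>UNIV. e_at j i a * e_at k j b * e_at i k c)"

abbreviation Z_sl2 :: "'n::finite U_sl2 set" where "Z_sl2 \<equiv> centralizer"

end

theory Submission
  imports Defs "HOL-Analysis.Derivative" "HOL-Computational_Algebra.Polynomial"
begin

text \<open>The tensor power of the enveloping algebra is filtered by degree, and by the
  Poincare-Birkhoff-Witt theorem its associated graded algebra is the algebra of polynomial functions
  on \<open>sl\<^sub>2\<^sup>n\<close>. The symbol of a central element is an invariant function, and the symbols of the
  traces \<open>P\<^sub>a\<^sub>b\<close> and \<open>F\<^sub>a\<^sub>b\<^sub>c\<close> are the scalar products and the triple products of vectors in a
  three-dimensional quadratic space. So it is enough that the corresponding monomials in these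
  functions form a basis of the invariants of (up to) four vectors.

  Generation: make the matrices nilpotent one after the other. A function vanishing for nilpotent
  \<open>a\<close>-th matrix is divisible by \<open>P\<^sub>a\<^sub>a\<close>, so the degree drops. For nilpotent matrices, i.e. squares of
  vectors in the plane, the invariants are spanned by products of brackets, which is shown in the
  same way by making two vectors parallel.

  Spanning by the chosen monomials: the Gram determinant of four vectors vanishes, and so does the
  alternating sum of the \<open>F\<^sub>b\<^sub>c\<^sub>d P\<^sub>a\<^sub>x\<close>; these relations lower the degree in the diagonal \<open>P\<^sub>a\<^sub>a\<close>.

  Independence: let three of the vectors become large and nearly orthogonal and the fourth one small,
  with prescribed mixed scalar products; only the monomials of top degree in the diagonal \<open>P\<^sub>a\<^sub>a\<close>
  survive.\<close>

section \<open>Polynomial functions\<close>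

text \<open>Only one inclusion needs an argument: the symbol of an element of the centralizer is
  invariant, because its commutator with the diagonal copy of a generator has as symbol the
  derivative along a one-parameter group. The reverse comes from the traces, which commute with the
  diagonal and whose symbols already generate. Nilpotent matrices are the right place to restrict
  to, since there \<open>pairing\<close> is minus the square of a bracket and \<open>triple\<close>
  a product of three brackets: invariants of multidegree \<open>D\<close> become bracket polynomials
  of multidegree \<open>2 * D\<close>. The obstacle is to lift every bracket monomial with even
  degrees, not only the squares. The shape of the standard monomials is dictated by the
  degeneration: the Gram relation forbids prescribing all ten pairings of four vectors in
  three-space, but all except one \<open>P_ss\<close> can be prescribed to leading order. A
  surviving monomial must avoid that \<open>P_ss\<close>, and the only triple product that survives
  is the one omitting \<open>s\<close>. Two and three factors are treated as four with zero matrices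
  in the missing places.\<close>

inductive polyf :: "(('i \<Rightarrow> complex) \<Rightarrow> complex) \<Rightarrow> bool" where
  const: "polyf (\<lambda>_. c)"
| var: "polyf f \<Longrightarrow> polyf (\<lambda>v. v i * f v)"
| add: "polyf f \<Longrightarrow> polyf g \<Longrightarrow> polyf (\<lambda>v. f v + g v)"

lemma polyf_mult: "polyf f \<Longrightarrow> polyf g \<Longrightarrow> polyf (\<lambda>v. f v * g v)"
proof (induction rule: polyf.induct)
  case (const c)
  from const.prems show ?case
  proof (induction rule: polyf.induct)
    case (var f i)
    show ?case using polyf.var[OF var.IH, of i] by (simp add: mult.left_commute)
  next
    case (add f g)
    show ?case using polyf.add[OF add.IH] by (simp add: distrib_left)
  qed (rule polyf.const)
next
  case (var f i)
  show ?case using polyf.var[OF var.IH[OF var.prems], of i] by (simp add: mult.assoc)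
next
  case (add f h)
  show ?case using polyf.add[OF add.IH(1)[OF add.prems] add.IH(2)[OF add.prems]]
    by (simp add: distrib_right)
qed

lemma polyf_coord: "polyf (\<lambda>v. v i)"
  using polyf.var[OF polyf.const[of 1], of i] by simp

lemma polyf_uminus: "polyf f \<Longrightarrow> polyf (\<lambda>v. - f v)"
  using polyf_mult[OF polyf.const[of "-1"]] by simp

lemma polyf_diff: "polyf f \<Longrightarrow> polyf g \<Longrightarrow> polyf (\<lambda>v. f v - g v)"
  using polyf.add[OF _ polyf_uminus, of f g] by simp

lemma polyf_power: "polyf f \<Longrightarrow> polyf (\<lambda>v. f v ^ k)"
  by (induction k) (simp_all add: polyf.const polyf_mult)

lemma polyf_sum: "(\<And>k. k \<in> K \<Longrightarrow> polyf (f k)) \<Longrightarrow> polyf (\<lambda>v. \<Sum>k\<in>K. f k v)"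
  by (induction K rule: infinite_finite_induct) (simp_all add: polyf.const polyf.add)

lemma polyf_prod: "(\<And>k. k \<in> K \<Longrightarrow> polyf (f k)) \<Longrightarrow> polyf (\<lambda>v. \<Prod>k\<in>K. f k v)"
  by (induction K rule: infinite_finite_induct) (simp_all add: polyf.const polyf_mult)

lemmas polyf_intros = polyf.const polyf_coord polyf.add polyf_mult polyf_uminus polyf_diff
  polyf_power polyf_sum polyf_prod

lemma polyf_subst:
  assumes "polyf f" "\<And>i. polyf (\<lambda>v. \<sigma> v i)"
  shows "polyf (\<lambda>v. f (\<sigma> v))"
  using assms(1)
proof (induction rule: polyf.induct)
  case (var f i)
  show ?case by (rule polyf_mult[OF assms(2) var.IH])
qed (rule polyf.const, rule polyf.add)

lemma polyf_line:
  assumes "polyf f"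
  shows "\<exists>p. \<forall>t. f (\<lambda>i. u i + t * w i) = poly p t"
  using assms
proof (induction rule: polyf.induct)
  case (const c)
  show ?case by (rule exI[of _ "[:c:]"]) simp
next
  case (var f i)
  then obtain p where "\<forall>t. f (\<lambda>i. u i + t * w i) = poly p t" by blast
  then show ?case by (intro exI[of _ "[:u i, w i:] * p"]) (simp add: algebra_simps)
next
  case (add f g)
  then obtain p q where "\<forall>t. f (\<lambda>i. u i + t * w i) = poly p t"
    "\<forall>t. g (\<lambda>i. u i + t * w i) = poly q t" by blast
  then show ?case by (intro exI[of _ "p + q"]) simp
qed

text \<open>On the line through \<open>u\<close> and \<open>w\<close> both functions are polynomials
  in one variable, and these form an integral domain; the first is nonzero because of
  \<open>u\<close>, the second because of \<open>w\<close>. All later divisions of identities by a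
  nonzero polynomial function rest on this.\<close>

lemma polyf_cancel:
  assumes "polyf f" "polyf g" "\<And>v. f v * g v = 0" "f u \<noteq> 0"
  shows "g w = 0"
proof (rule ccontr)
  assume g: "g w \<noteq> 0"
  obtain p where p: "\<And>t. f (\<lambda>i. u i + t * (w i - u i)) = poly p t"
    using polyf_line[OF assms(1)] by metis
  obtain q where q: "\<And>t. g (\<lambda>i. u i + t * (w i - u i)) = poly q t"
    using polyf_line[OF assms(2)] by metis
  have "poly (p * q) t = 0" for t
    using assms(3) by (simp flip: p q)
  then have "p * q = 0" using poly_all_0_iff_0 by blast
  moreover have "p \<noteq> 0" using p[of 0] assms(4) by auto
  moreover have "q \<noteq> 0" using q[of 1] g by auto
  ultimately show False by simp
qed

lemma polyf_cancel_eq: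
  assumes "polyf f" "polyf p" "polyf q" "\<And>v. f v * p v = f v * q v" "f u \<noteq> 0"
  shows "p w = q w"
  using polyf_cancel[OF assms(1) polyf_diff[OF assms(2,3)] _ assms(5), of w] assms(4)
  by (simp add: right_diff_distrib)

lemma polyf_upd: "polyf f \<Longrightarrow> polyf c \<Longrightarrow> polyf (\<lambda>v. f (v(i := c v)))"
proof (rule polyf_subst[where \<sigma> = "\<lambda>v. v(i := c v)"])
  show "polyf (\<lambda>v. (v(i := c v)) j)" if "polyf c" for j
    using that by (cases "j = i") (simp_all add: polyf_coord)
qed

text \<open>Division with remainder by a coordinate. The remainder is the restriction to
  \<open>v i = 0\<close>, so vanishing there means divisibility.\<close>

lemma polyf_divide_coord:
  assumes "polyf f"
  shows "\<exists>h. polyf h \<and> (\<forall>v. f v = f (v(i := 0)) + v i * h v)"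
  using assms
proof (induction rule: polyf.induct)
  case (const c)
  show ?case by (rule exI[of _ "\<lambda>_. 0"]) (simp add: polyf.const)
next
  case (var f j)
  show ?case
  proof (cases "j = i")
    case True
    then show ?thesis using var.hyps by (intro exI[of _ f]) simp
  next
    case False
    obtain h where h: "polyf h" "\<And>v. f v = f (v(i := 0)) + v i * h v" using var.IH by blast
    show ?thesis
    proof (intro exI[of _ "\<lambda>v. v j * h v"] conjI allI)
      fix v
      show "v j * f v = (v(i := 0)) j * f (v(i := 0)) + v i * (v j * h v)"
        using False by (subst h(2)) (simp add: algebra_simps)
    qed (intro polyf.var h(1))
  qed
next
  case (add f g)
  obtain h where h: "polyf h" "\<And>v. f v = f (v(i := 0)) + v i * h v" using add.IH by blast
  obtain k where k: "polyf k" "\<And>v. g v = g (v(i := 0)) + v i * k v" using add.IH by blast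
  show ?case
  proof (intro exI[of _ "\<lambda>v. h v + k v"] conjI allI)
    fix v
    show "f v + g v = f (v(i := 0)) + g (v(i := 0)) + v i * (h v + k v)"
      by (simp only: h(2)[of v] k(2)[of v] distrib_left ac_simps)
  qed (intro polyf.add h(1) k(1))
qed

text \<open>Dedekind's argument for the linear independence of characters.\<close>

lemma monomials_indep:
  fixes c :: "('i::finite \<Rightarrow> nat) \<Rightarrow> complex"
  assumes "finite M"
    and "\<And>s. (\<And>i. s i \<noteq> 0) \<Longrightarrow> (\<Sum>\<alpha>\<in>M. c \<alpha> * (\<Prod>i\<in>UNIV. s i ^ \<alpha> i)) = 0"
    and "\<alpha> \<in> M"
  shows "c \<alpha> = 0"
  using assms
proof (induction M arbitrary: c \<alpha> rule: finite_induct)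
  case empty
  then show ?case by simp
next
  case (insert \<beta> M)
  let ?\<chi> = "\<lambda>\<alpha> s. \<Prod>i\<in>UNIV. s i ^ \<alpha> i :: complex"
  have M0: "c \<gamma> = 0" if \<gamma>: "\<gamma> \<in> M" for \<gamma>
  proof -
    from \<gamma> insert.hyps have "\<gamma> \<noteq> \<beta>" by auto
    then obtain j where j: "\<gamma> j \<noteq> \<beta> j" by auto
    \<comment> \<open>A point that separates \<open>\<gamma>\<close> from \<open>\<beta>\<close>:
      all coordinates are 1 except one where the exponents differ, and the powers of 2 are
      distinct.\<close>
    define u where "u = (\<lambda>i. if i = j then 2 else 1 :: complex)"
    have u: "?\<chi> \<delta> u = 2 ^ \<delta> j" for \<delta>
    proof -
      have "?\<chi> \<delta> u = (\<Prod>i\<in>UNIV. if i = j then 2 ^ \<delta> i else 1)"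
        by (rule prod.cong) (auto simp: u_def)
      then show ?thesis by simp
    qed
    \<comment> \<open>Substituting \<open>u i * s i\<close> for \<open>s i\<close> multiplies each
      term by \<open>?\<chi> \<alpha> u\<close>; subtracting \<open>?\<chi> \<beta> u\<close> times
      the original relation removes the term of \<open>\<beta>\<close>.\<close>
    have "c \<gamma> * (?\<chi> \<gamma> u - ?\<chi> \<beta> u) = 0"
    proof (rule insert.IH[OF _ \<gamma>])
      fix s :: "'i \<Rightarrow> complex" assume s: "\<And>i. s i \<noteq> 0"
      have 1: "(\<Sum>\<alpha>\<in>insert \<beta> M. c \<alpha> * ?\<chi> \<alpha> s) = 0" by (rule insert.prems(1)) (rule s)
      have 2: "(\<Sum>\<alpha>\<in>insert \<beta> M. c \<alpha> * (?\<chi> \<alpha> u * ?\<chi> \<alpha> s)) = 0"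
        using insert.prems(1)[of "\<lambda>i. u i * s i"] s
        by (simp add: power_mult_distrib prod.distrib u_def)
      have "(\<Sum>\<alpha>\<in>M. c \<alpha> * (?\<chi> \<alpha> u - ?\<chi> \<beta> u) * ?\<chi> \<alpha> s) =
          (\<Sum>\<alpha>\<in>insert \<beta> M. c \<alpha> * (?\<chi> \<alpha> u * ?\<chi> \<alpha> s)) -
          ?\<chi> \<beta> u * (\<Sum>\<alpha>\<in>insert \<beta> M. c \<alpha> * ?\<chi> \<alpha> s)"
        using insert.hyps
        by (simp add: algebra_simps sum_distrib_left sum_subtractf)
      then show "(\<Sum>\<alpha>\<in>M. c \<alpha> * (?\<chi> \<alpha> u - ?\<chi> \<beta> u) * ?\<chi> \<alpha> s) = 0" by (simp only: 1 2) simp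
    qed
    moreover have "?\<chi> \<gamma> u - ?\<chi> \<beta> u \<noteq> 0"
    proof
      assume "?\<chi> \<gamma> u - ?\<chi> \<beta> u = 0"
      then have "(of_nat (2 ^ \<gamma> j) :: complex) = of_nat (2 ^ \<beta> j)" unfolding u by simp
      then have "(2::nat) ^ \<gamma> j = 2 ^ \<beta> j" by (simp only: of_nat_eq_iff)
      then show False using j by simp
    qed
    ultimately show ?thesis by simp
  qed
  have "c \<beta> = 0"
    using insert.prems(1)[of "\<lambda>_. 1"] insert.hyps M0 by simp
  then show ?case using M0 insert.prems(2) by auto
qed

section \<open>Multihomogeneous functions\<close>

definition rescale :: "('n \<Rightarrow> complex) \<Rightarrow> ('n \<times> 'c \<Rightarrow> complex) \<Rightarrow> 'n \<times> 'c \<Rightarrow> complex"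
  where "rescale s v = (\<lambda>p. s (fst p) * v p)"

text \<open>Scalings by 0 are included and \<open>0 ^ 0 = 1\<close>, so a homogeneous function
  ignores the vectors in which its degree is 0.\<close>

definition homog :: "('n::finite \<Rightarrow> nat) \<Rightarrow> (('n \<times> 'c \<Rightarrow> complex) \<Rightarrow> complex) \<Rightarrow> bool"
  where "homog D f \<longleftrightarrow> (\<forall>s v. f (rescale s v) = (\<Prod>a\<in>UNIV. s a ^ D a) * f v)"

definition unit_at :: "'a \<Rightarrow> 'a \<Rightarrow> nat"
  where "unit_at a = (\<lambda>c. if c = a then 1 else 0)"

lemma unit_at_same [simp]: "unit_at a a = 1"
  and unit_at_other [simp]: "c \<noteq> a \<Longrightarrow> unit_at a c = 0"
  by (simp_all add: unit_at_def)

lemma prod_power_unit_at: "(\<Prod>c\<in>UNIV. s c ^ unit_at a c) = (s (a::'n::finite) :: 'b::comm_monoid_mult)"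
proof -
  have "(\<Prod>c\<in>UNIV. s c ^ unit_at a c) = (\<Prod>c\<in>UNIV. if c = a then s c else 1)"
    by (rule prod.cong) (auto simp: unit_at_def)
  then show ?thesis by simp
qed

lemma sum_unit_at: "(\<Sum>c\<in>UNIV. unit_at (a::'n::finite) c) = 1"
  by (simp add: unit_at_def)

lemma homog_add: "homog D f \<Longrightarrow> homog D g \<Longrightarrow> homog D (\<lambda>v. f v + g v)"
  by (simp add: homog_def distrib_left)

lemma homog_diff: "homog D f \<Longrightarrow> homog D g \<Longrightarrow> homog D (\<lambda>v. f v - g v)"
  by (simp add: homog_def right_diff_distrib)

lemma homog_zero: "homog D (\<lambda>_. 0)"
  by (simp add: homog_def)

lemma homog_const: "homog (\<lambda>_. 0) (\<lambda>_. c)"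
  by (simp add: homog_def)

lemma polyf_rescale: "polyf f \<Longrightarrow> polyf (\<lambda>v. f (rescale s v))"
  by (rule polyf_subst[where \<sigma> = "rescale s"]) (simp_all add: rescale_def polyf_mult polyf.const polyf_coord)

lemma polyf_rescale_left: "polyf f \<Longrightarrow> polyf (\<lambda>s. f (rescale s v))"
  by (rule polyf_subst[where \<sigma> = "\<lambda>s. rescale s v"]) (simp_all add: rescale_def polyf_mult polyf.const polyf_coord)


section \<open>Invariants of vectors in the plane\<close>

text \<open>A point is a family of vectors \<open>(x (a, True), x (a, False))\<close>. The invariants under the two
  one-parameter groups \<open>shearE\<close> and \<open>shearF\<close> are those under \<open>SL\<^sub>2\<close>.\<close>

definition br :: "'n \<Rightarrow> 'n \<Rightarrow> ('n \<times> bool \<Rightarrow> complex) \<Rightarrow> complex"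
  where "br a b x = x (a, True) * x (b, False) - x (a, False) * x (b, True)"

definition shearE :: "complex \<Rightarrow> ('n \<times> bool \<Rightarrow> complex) \<Rightarrow> 'n \<times> bool \<Rightarrow> complex"
  where "shearE t x = (\<lambda>(a, i). if i then x (a, True) else x (a, False) + t * x (a, True))"

definition shearF :: "complex \<Rightarrow> ('n \<times> bool \<Rightarrow> complex) \<Rightarrow> 'n \<times> bool \<Rightarrow> complex"
  where "shearF t x = (\<lambda>(a, i). if i then x (a, True) + t * x (a, False) else x (a, False))"

definition inv2 :: "(('n \<times> bool \<Rightarrow> complex) \<Rightarrow> complex) \<Rightarrow> bool"
  where "inv2 f \<longleftrightarrow> (\<forall>t x. f (shearE t x) = f x \<and> f (shearF t x) = f x)"

lemma br_shear [simp]: "br a b (shearE t x) = br a b x" "br a b (shearF t x) = br a b x"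
  by (simp_all add: br_def shearE_def shearF_def algebra_simps)

lemma br_rescale: "br a b (rescale s x) = s a * s b * br a b x"
  by (simp add: br_def rescale_def algebra_simps)

lemma br_self [simp]: "br a a x = 0"
  by (simp add: br_def)

lemma polyf_br: "polyf (br a b)"
  unfolding br_def[abs_def] by (intro polyf_diff polyf_mult polyf_coord)

lemma polyf_shearE: "polyf f \<Longrightarrow> polyf (\<lambda>x. f (shearE t x))"
proof (rule polyf_subst[where \<sigma> = "shearE t"])
  show "polyf (\<lambda>x. shearE t x p)" for p :: "'a \<times> bool"
    by (cases p; cases "snd p")
       (auto simp: shearE_def intro!: polyf_coord polyf.add polyf_mult polyf.const)
qed

lemma polyf_shearF: "polyf f \<Longrightarrow> polyf (\<lambda>x. f (shearF t x))"
proof (rule polyf_subst[where \<sigma> = "shearF t"])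
  show "polyf (\<lambda>x. shearF t x p)" for p :: "'a \<times> bool"
    by (cases p; cases "snd p")
       (auto simp: shearF_def intro!: polyf_coord polyf.add polyf_mult polyf.const)
qed

lemma inv2_diff: "inv2 f \<Longrightarrow> inv2 g \<Longrightarrow> inv2 (\<lambda>v. f v - g v)"
  by (simp add: inv2_def)

text \<open>Indexed by the multidegree, so that renaming letters and dividing by a bracket can be
  tracked; \<open>zero\<close> is available in every degree, also in those without bracket
  monomials.\<close>

inductive bracket_span ::
    "('n \<Rightarrow> nat) \<Rightarrow> (('n \<times> bool \<Rightarrow> complex) \<Rightarrow> complex) \<Rightarrow> bool" where
  zero: "bracket_span D (\<lambda>_. 0)"
| const: "bracket_span (\<lambda>_. 0) (\<lambda>_. c)"
| add: "bracket_span D f \<Longrightarrow> bracket_span D g \<Longrightarrow> bracket_span D (\<lambda>x. f x + g x)"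
| br: "bracket_span D f \<Longrightarrow>
    bracket_span (\<lambda>c. D c + unit_at a c + unit_at b c) (\<lambda>x. br a b x * f x)"

lemma bracket_span_props:
  fixes D :: "'n::finite \<Rightarrow> nat"
  assumes "bracket_span D f"
  shows "polyf f \<and> homog D f \<and> inv2 f"
  using assms
proof (induction rule: bracket_span.induct)
  case (br D f a b)
  then have "homog (\<lambda>c. D c + unit_at a c + unit_at b c) (\<lambda>x. br a b x * f x)"
    by (simp add: homog_def br_rescale power_add prod.distrib prod_power_unit_at mult_ac)
  then show ?case using br by (simp add: polyf_br polyf_mult inv2_def)
next
  case zero
  show ?case by (simp add: homog_zero polyf.const inv2_def)
next
  case const
  show ?case by (simp add: homog_const polyf.const inv2_def)
next
  case add
  then show ?case by (simp add: homog_add polyf.add inv2_def)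
qed

section \<open>Identification of two vectors and divisibility by their bracket\<close>

definition merge :: "'n \<Rightarrow> 'n \<Rightarrow> ('n \<times> bool \<Rightarrow> complex) \<Rightarrow> 'n \<times> bool \<Rightarrow> complex"
  where "merge a b x = (\<lambda>(c, i). if c = b then x (a, i) else x (c, i))"

lemma br_merge_left: "br b d (merge a b x) = br a d (merge a b x)"
  and br_merge_right: "br d b (merge a b x) = br d a (merge a b x)"
  by (simp_all add: br_def merge_def)

text \<open>One occurrence of the letter \<open>a\<close> is renamed to \<open>b\<close>; after
  \<open>merge\<close> the two vectors coincide, so the values there do not change.\<close>

lemma bracket_span_move:
  assumes "bracket_span D f" "D a > 0" "a \<noteq> b"
  shows "\<exists>g. bracket_span (\<lambda>c. D c - unit_at a c + unit_at b c) g \<and>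
    (\<forall>x. g (merge a b x) = f (merge a b x))"
  using assms
proof (induction rule: bracket_span.induct)
  case (zero D)
  show ?case by (rule exI[of _ "\<lambda>_. 0"]) (simp add: bracket_span.zero)
next
  case (const c)
  then show ?case by simp
next
  case (add D f g)
  obtain f' where "bracket_span (\<lambda>c. D c - unit_at a c + unit_at b c) f'"
    "\<forall>x. f' (merge a b x) = f (merge a b x)" using add by blast
  moreover obtain g' where "bracket_span (\<lambda>c. D c - unit_at a c + unit_at b c) g'"
    "\<forall>x. g' (merge a b x) = g (merge a b x)" using add by blast
  ultimately show ?case
    by (intro exI[of _ "\<lambda>x. f' x + g' x"]) (simp add: bracket_span.add)
next
  case (br D f c d)
  consider "c = a" | "d = a" | "c \<noteq> a" "d \<noteq> a" "D a > 0"
    using br.prems by (fastforce simp: unit_at_def split: if_splits)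
  then show ?case
  proof cases
    case 1
    have "(\<lambda>e. D e + unit_at c e + unit_at d e - unit_at a e + unit_at b e) =
        (\<lambda>e. D e + unit_at b e + unit_at d e)"
      using 1 by auto
    then show ?thesis using bracket_span.br[OF br.hyps, of b d] 1
      by (intro exI[of _ "\<lambda>x. br b d x * f x"]) (simp add: br_merge_left)
  next
    case 2
    have "(\<lambda>e. D e + unit_at c e + unit_at d e - unit_at a e + unit_at b e) =
        (\<lambda>e. D e + unit_at c e + unit_at b e)"
      using 2 by auto
    then show ?thesis using bracket_span.br[OF br.hyps, of c b] 2
      by (intro exI[of _ "\<lambda>x. br c b x * f x"]) (simp add: br_merge_right)
  next
    case 3
    then obtain g where g: "bracket_span (\<lambda>c. D c - unit_at a c + unit_at b c) g"
      "\<forall>x. g (merge a b x) = f (merge a b x)" using br.IH br.prems by blast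
    have "(\<lambda>e. D e + unit_at c e + unit_at d e - unit_at a e + unit_at b e) =
        (\<lambda>e. D e - unit_at a e + unit_at b e + unit_at c e + unit_at d e)"
    proof
      fix e
      show "D e + unit_at c e + unit_at d e - unit_at a e + unit_at b e =
        D e - unit_at a e + unit_at b e + unit_at c e + unit_at d e"
        using 3 by (cases "e = a") auto
    qed
    then show ?thesis using bracket_span.br[OF g(1), of c d] g(2)
      by (intro exI[of _ "\<lambda>x. br c d x * g x"]) simp
  qed
qed

lemma bracket_span_split:
  assumes "bracket_span D f" "D a \<ge> k" "a \<noteq> b"
  shows "\<exists>g. bracket_span (\<lambda>c. D c - k * unit_at a c + k * unit_at b c) g \<and>
    (\<forall>x. g (merge a b x) = f (merge a b x))"
  using assms(2)
proof (induction k)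
  case 0
  then show ?case using assms(1) by (intro exI[of _ f]) simp
next
  case (Suc k)
  then obtain g where g: "bracket_span (\<lambda>c. D c - k * unit_at a c + k * unit_at b c) g"
    "\<forall>x. g (merge a b x) = f (merge a b x)" by auto
  have "D a - k * unit_at a a + k * unit_at b a > 0" using Suc.prems by simp
  from bracket_span_move[OF g(1) this assms(3)]
  obtain h where h: "bracket_span
      (\<lambda>c. D c - k * unit_at a c + k * unit_at b c - unit_at a c + unit_at b c) h"
    "\<forall>x. h (merge a b x) = g (merge a b x)" by blast
  have "(\<lambda>c. D c - k * unit_at a c + k * unit_at b c - unit_at a c + unit_at b c) =
      (\<lambda>c. D c - Suc k * unit_at a c + Suc k * unit_at b c)"
  proof
    fix c
    show "D c - k * unit_at a c + k * unit_at b c - unit_at a c + unit_at b c =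
      D c - Suc k * unit_at a c + Suc k * unit_at b c"
      using assms(3) by (cases "c = a"; cases "c = b") auto
  qed
  then show ?case using h g(2) by auto
qed

text \<open>Every \<open>v i\<close> is completed to \<open>v j * v i\<close> at the price of a
  power of \<open>v j\<close>: once \<open>v j\<close> is inverted, this product can serve as a
  coordinate in place of \<open>v i\<close>.\<close>

lemma polyf_clear_denominator:
  fixes i j :: 'i
  assumes "polyf f" "i \<noteq> j"
  shows "\<exists>N G. polyf G \<and> (\<forall>v. v j ^ N * f v = G (v(i := v j * v i)))"
  using assms(1)
proof (induction rule: polyf.induct)
  case (const c)
  show ?case by (rule exI[of _ 0], rule exI[of _ "\<lambda>_. c"]) (simp add: polyf.const)
next
  case (var f k)
  then obtain N G where G: "polyf G" "\<And>v. v j ^ N * f v = G (v(i := v j * v i))" by blast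
  show ?case
  proof (cases "k = i")
    case True
    have "v j ^ Suc N * (v k * f v) = (v j * v i) * (v j ^ N * f v)" for v
      using True by simp
    then show ?thesis using G
      by (intro exI[of _ "Suc N"] exI[of _ "\<lambda>v. v i * G v"])
        (simp add: polyf.var fun_upd_same del: fun_upd_apply power_Suc)
  next
    case False
    have "v j ^ N * (v k * f v) = v k * (v j ^ N * f v)" for v
      by simp
    then show ?thesis using G False
      by (intro exI[of _ N] exI[of _ "\<lambda>v. v k * G v"])
        (simp add: polyf.var fun_upd_other del: fun_upd_apply)
  qed
next
  case (add f g)
  obtain N G where G: "polyf G" "\<And>v. v j ^ N * f v = G (v(i := v j * v i))" using add.IH by blast
  obtain M H where H: "polyf H" "\<And>v. v j ^ M * g v = H (v(i := v j * v i))" using add.IH by blast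
  have "v j ^ (N + M) * (f v + g v) = v j ^ M * (v j ^ N * f v) + v j ^ N * (v j ^ M * g v)" for v
    by (simp add: power_add algebra_simps)
  then show ?case using G H assms(2)
    by (intro exI[of _ "N + M"] exI[of _ "\<lambda>v. v j ^ M * G v + v j ^ N * H v"])
       (simp add: polyf_intros fun_upd_other del: fun_upd_apply)
qed

text \<open>Up to a power of \<open>x (a, True)\<close>, \<open>f\<close> is a polynomial with
  \<open>x (a, True) * x (b, False)\<close> as one of its coordinates. The bracket differs from this
  product by \<open>x (a, False) * x (b, True)\<close> and can replace it as a coordinate, so
  divisibility by the bracket becomes divisibility by a coordinate.\<close>

lemma br_divides_mult:
  assumes "polyf f" "a \<noteq> b" and vanish: "\<And>x. br a b x = 0 \<Longrightarrow> f x = 0"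
  shows "\<exists>N h. polyf h \<and> (\<forall>x. x (a, True) ^ N * f x = br a b x * h x)"
proof -
  let ?x = "(a, True)" and ?y = "(a, False)" and ?x' = "(b, True)" and ?y' = "(b, False)"
  obtain N G where G: "polyf G" "\<And>v. v ?x ^ N * f v = G (v(?y' := v ?x * v ?y'))"
    using polyf_clear_denominator[OF assms(1), of ?y' ?x] assms(2) by auto
  \<comment> \<open>From here on the slot \<open>?y'\<close> holds the value of the bracket.\<close>
  define G' where "G' = (\<lambda>v. G (v(?y' := v ?y' + v ?y * v ?x')))"
  have "polyf G'"
    unfolding G'_def by (intro polyf_upd G(1) polyf.add polyf_mult polyf_coord)
  then obtain H where H: "polyf H" "\<And>v. G' v = G' (v(?y' := 0)) + v ?y' * H v"
    using polyf_divide_coord by metis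
  \<comment> \<open>The remainder, i.e. the value at bracket 0. Where \<open>v ?x\<close> is nonzero
    it comes from a point \<open>w\<close> of the zero set of the bracket, so \<open>vanish\<close>
    applies; the factor \<open>v ?x\<close> is then cancelled.\<close>
  have zero: "G (v(?y' := v ?y * v ?x')) = 0" for v
  proof -
    let ?k = "\<lambda>v. G (v(?y' := v ?y * v ?x'))"
    have "polyf ?k" by (intro polyf_upd G(1) polyf_mult polyf_coord)
    moreover have "v ?x * ?k v = 0" for v
    proof (cases "v ?x = 0")
      case False
      define w where "w = v(?y' := v ?y * v ?x' / v ?x)"
      have "f w = 0" using assms(2) False by (intro vanish) (simp add: br_def w_def)
      then have "G (w(?y' := w ?x * w ?y')) = 0" using G(2)[of w] by simp
      moreover have "w(?y' := w ?x * w ?y') = v(?y' := v ?y * v ?x')"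
        using assms(2) False by (auto simp: w_def)
      ultimately show ?thesis by simp
    qed simp
    ultimately show ?thesis
      using polyf_cancel[OF polyf_coord[of ?x], of ?k "\<lambda>_. 1" v] by simp
  qed
  have "v ?x ^ N * f v = br a b v * H (v(?y' := br a b v))" for v
  proof -
    have "v ?x ^ N * f v = G' (v(?y' := br a b v))"
      unfolding G(2) G'_def using assms(2) by (simp add: br_def)
    also have "\<dots> = G' (v(?y' := 0)) + br a b v * H (v(?y' := br a b v))"
      by (subst H(2)) simp
    also have "G' (v(?y' := 0)) = 0"
      using zero[of v] assms(2) by (simp add: G'_def)
    finally show ?thesis by (simp del: fun_upd_apply)
  qed
  moreover have "polyf (\<lambda>v. H (v(?y' := br a b v)))" by (intro polyf_upd H(1) polyf_br)
  ultimately show ?thesis by blast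
qed

text \<open>The bracket is coprime to \<open>x (a, True)\<close>: at \<open>x (a, True) = 0\<close>
  it becomes \<open>- x (a, False) * x (b, True)\<close>, which is not the zero function, so
  \<open>h\<close> vanishes there and is divisible by that coordinate.\<close>

lemma br_divides_coord_mult:
  assumes "polyf f" "polyf h" "a \<noteq> b" and eq: "\<And>x. x (a, True) * f x = br a b x * h x"
  shows "\<exists>k. polyf k \<and> (\<forall>x. f x = br a b x * k x)"
proof -
  let ?x = "(a, True)" and ?y = "(a, False)" and ?x' = "(b, True)" and ?y' = "(b, False)"
  obtain k where k: "polyf k" "\<And>v. h v = h (v(?x := 0)) + v ?x * k v"
    using polyf_divide_coord[OF assms(2)] by metis
  have h0: "h (v(?x := 0)) = 0" for v
  proof -
    have "polyf (\<lambda>v. h (v(?x := 0)))" by (rule polyf_upd[OF assms(2) polyf.const])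
    moreover have "v ?y * v ?x' * h (v(?x := 0)) = 0" for v
      using eq[of "v(?x := 0)"] assms(3) by (simp add: br_def)
    ultimately show ?thesis
      using polyf_cancel[of "\<lambda>v. v ?y * v ?x'" "\<lambda>v. h (v(?x := 0))" "\<lambda>_. 1" v]
      by (simp add: polyf_mult polyf_coord)
  qed
  have "f v = br a b v * k v" for v
  proof (rule polyf_cancel_eq[of "\<lambda>v. v ?x" f "\<lambda>v. br a b v * k v" "\<lambda>_. 1"])
    show "w ?x * f w = w ?x * (br a b w * k w)" for w
      using eq[of w] k(2)[of w] h0[of w] by (simp add: algebra_simps)
  qed (simp_all add: polyf_coord polyf_mult polyf_br k(1) assms(1))
  then show ?thesis using k(1) by (intro exI[of _ k]) simp
qed

lemma br_divides:
  assumes "polyf f" "a \<noteq> b" and vanish: "\<And>x. br a b x = 0 \<Longrightarrow> f x = 0"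
  shows "\<exists>h. polyf h \<and> (\<forall>x. f x = br a b x * h x)"
proof -
  obtain N h where "polyf h" "\<And>x. x (a, True) ^ N * f x = br a b x * h x"
    using br_divides_mult[OF assms] by blast
  then show ?thesis
  proof (induction N arbitrary: h)
    case 0
    then show ?case by auto
  next
    case (Suc N)
    have "\<exists>k. polyf k \<and> (\<forall>x. x (a, True) ^ N * f x = br a b x * k x)"
    proof (rule br_divides_coord_mult[OF _ Suc.prems(1) assms(2)])
      show "x (a, True) * (x (a, True) ^ N * f x) = br a b x * h x" for x
        using Suc.prems(2)[of x] by (simp add: mult.assoc)
    qed (intro polyf_mult polyf_power polyf_coord assms(1))
    then show ?case using Suc.IH by blast
  qed
qed

text \<open>The shears connect any two nonzero vectors of the plane, so \<open>f\<close> is constant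
  on them, whereas homogeneity of positive degree makes doubling the vector multiply
  \<open>f\<close> by \<open>2 ^ D a\<close>.\<close>

lemma inv2_one_vector:
  fixes D :: "'n::finite \<Rightarrow> nat"
  assumes "homog D f" "inv2 f" "D a > 0" "\<And>b. b \<noteq> a \<Longrightarrow> D b = 0"
  shows "f x = 0"
proof -
  define pt where "pt = (\<lambda>u w. \<lambda>(c, i). if c = a then (if i then u else w) else 0 :: complex)"
  have E: "f (pt u w) = f (pt u w')" if "u \<noteq> 0" for u w w'
  proof -
    have "shearE ((w' - w) / u) (pt u w) = pt u w'"
      using that by (auto simp: shearE_def pt_def fun_eq_iff)
    then show ?thesis using assms(2) unfolding inv2_def by metis
  qed
  have F: "f (pt u w) = f (pt u' w)" if "w \<noteq> 0" for u u' w
  proof -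
    have "shearF ((u' - u) / w) (pt u w) = pt u' w"
      using that by (auto simp: shearF_def pt_def fun_eq_iff)
    then show ?thesis using assms(2) unfolding inv2_def by metis
  qed
  have scale: "f (pt (c * u) (c * w)) = c ^ D a * f (pt u w)" for c u w
  proof -
    have "pt (c * u) (c * w) = rescale (\<lambda>_. c) (pt u w)"
      by (auto simp: pt_def rescale_def)
    moreover have "(\<Prod>b\<in>UNIV. c ^ D b) = (\<Prod>b\<in>UNIV. if b = a then c ^ D b else 1)"
      using assms(4) by (intro prod.cong) auto
    ultimately show ?thesis using assms(1) by (simp add: homog_def)
  qed
  have big: "f (pt u w) = 0" if "u \<noteq> 0" for u w
  proof -
    \<comment> \<open>Three shears lead from \<open>(u, w)\<close> to \<open>(2 * u, 2 * w)\<close>,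
      each at a point where the coordinate it divides by is nonzero.\<close>
    have "f (pt u w) = f (pt u 1)" using E that by blast
    also have "\<dots> = f (pt (2 * u) 1)" by (rule F) simp
    also have "\<dots> = f (pt (2 * u) (2 * w))" using that by (intro E) simp
    finally have eq: "f (pt u w) = 2 ^ D a * f (pt u w)" by (simp only: scale)
    have "(2::complex) ^ D a \<noteq> 1"
    proof
      assume "(2::complex) ^ D a = 1"
      then have "norm ((2::complex) ^ D a) = 1" by simp
      then have "(2::real) ^ D a = 1" by (simp add: norm_power)
      then show False using assms(3) by (metis less_numeral_extra(4) one_less_numeral_iff one_less_power semiring_norm(76))
    qed
    with eq show ?thesis by simp
  qed
  have "f (pt u w) = 0" for u w
  proof (cases "u = 0 \<and> w = 0")
    case True
    then show ?thesis using scale[of 0 u w] assms(3) by (simp add: zero_power)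
  next
    case False
    then show ?thesis using big F[of w u 1] by (cases "u = 0") auto
  qed
  moreover have "f x = f (rescale (\<lambda>b. if b = a then 1 else 0) x)"
  proof -
    have "(\<Prod>b\<in>UNIV. (if b = a then 1 else 0 :: complex) ^ D b) = 1"
      by (rule prod.neutral) (simp add: assms(4))
    then show ?thesis using assms(1) by (simp add: homog_def)
  qed
  moreover have "rescale (\<lambda>b. if b = a then 1 else 0) x = pt (x (a, True)) (x (a, False))"
    by (auto simp: rescale_def pt_def)
  ultimately show ?thesis by simp
qed

lemma br_zero_cases:
  assumes "br a b x = 0"
  obtains t where "\<And>i. x (b, i) = t * x (a, i)" | "\<And>i. x (a, i) = 0"
proof (cases "x (a, True) = 0 \<and> x (a, False) = 0")
  case True
  then have "x (a, i) = 0" for i by (cases i) auto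
  then show ?thesis using that(2) by blast
next
  case False
  define t where "t = (if x (a, True) \<noteq> 0 then x (b, True) / x (a, True) else x (b, False) / x (a, False))"
  have "x (b, i) = t * x (a, i)" for i
    using False assms by (cases i) (auto simp: t_def br_def field_simps)
  then show ?thesis using that(1) by blast
qed

text \<open>The restriction to \<open>x\<^sub>a = x\<^sub>b\<close> of an invariant involves fewer vectors, so it is a combination of
  bracket monomials, which lifts to one of the right multidegree; the difference vanishes whenever
  \<open>x\<^sub>a\<close> and \<open>x\<^sub>b\<close> are parallel and is therefore divisible by the bracket of \<open>a\<close> and \<open>b\<close>.\<close>

theorem bracket_span_invariants:
  fixes D :: "'n::finite \<Rightarrow> nat"
  assumes "polyf f" "homog D f" "inv2 f"
  shows "bracket_span D f"
  using assms
\<comment> \<open>Identifying two vectors keeps the total degree and lowers the number of vectors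
  that occur; dividing by a bracket lowers the total degree by 2.\<close>
proof (induction "(\<Sum>a\<in>UNIV. D a, card {a. D a > 0})" arbitrary: D f
    rule: wf_induct_rule[OF wf_lex_prod[OF wf_less_than wf_less_than]])
  case (1 D f)
  note IH = "1.hyps"
  consider "\<And>a. D a = 0" | a where "D a > 0" "\<And>b. b \<noteq> a \<Longrightarrow> D b = 0" |
    a b where "D a > 0" "D b > 0" "a \<noteq> b" by auto
  then show ?case
  proof cases
    case 1
    then have D: "D = (\<lambda>_. 0)" by auto
    have "f x = f (\<lambda>_. 0)" for x
    proof -
      have "f (rescale (\<lambda>_. 0) x) = f x" using "1.prems"(2) 1 by (simp add: homog_def)
      then show ?thesis by (simp add: rescale_def)
    qed
    then have "f = (\<lambda>_. f (\<lambda>_. 0))" by blast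
    then show ?thesis using bracket_span.const D by metis
  next
    case (2 a)
    then have "f = (\<lambda>_. 0)" using inv2_one_vector[OF "1.prems"(2,3)] by blast
    then show ?thesis using bracket_span.zero by metis
  next
    case (3 a b)
    define D' where "D' = (\<lambda>c. if c = a then D a + D b else if c = b then 0 else D c)"
    have sumD': "(\<Sum>c\<in>UNIV. D' c) = (\<Sum>c\<in>UNIV. D c)"
    proof -
      have "(\<Sum>c\<in>UNIV. g c) = g a + g b + (\<Sum>c\<in>UNIV - {a, b}. g c)" for g :: "'n \<Rightarrow> nat"
        using 3(3) by (subst sum.subset_diff[of "{a, b}"]) auto
      moreover have "(\<Sum>c\<in>UNIV - {a, b}. D' c) = (\<Sum>c\<in>UNIV - {a, b}. D c)"
        by (rule sum.cong) (auto simp: D'_def)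
      ultimately show ?thesis using 3(3) by (simp add: D'_def)
    qed
    have "{c. D' c > 0} \<subset> {c. D c > 0}"
      using 3 by (auto simp: D'_def split: if_splits)
    then have cardD': "card {c. D' c > 0} < card {c. D c > 0}"
      by (intro psubset_card_mono) auto
    define g where "g = (\<lambda>x. f (merge a b x))"
    have "bracket_span D' g"
    proof (rule IH)
      show "((\<Sum>c\<in>UNIV. D' c, card {c. D' c > 0}), (\<Sum>c\<in>UNIV. D c, card {c. D c > 0}))
          \<in> less_than <*lex*> less_than"
        using sumD' cardD' by simp
      show "polyf g" unfolding g_def
      proof (rule polyf_subst[OF "1.prems"(1)])
        show "polyf (\<lambda>x. merge a b x p)" for p
          by (cases p; cases "fst p = b") (simp_all add: merge_def polyf_coord)
      qed
      show "homog D' g" unfolding homog_def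
      proof (intro allI)
        fix s :: "'n \<Rightarrow> complex" and x :: "'n \<times> bool \<Rightarrow> complex"
        define s' where "s' = s(b := s a)"
        have "merge a b (rescale s x) = rescale s' (merge a b x)"
          by (auto simp: merge_def rescale_def s'_def)
        moreover have "(\<Prod>c\<in>UNIV. s' c ^ D c) = (\<Prod>c\<in>UNIV. s c ^ D' c)"
        proof -
          have "(\<Prod>c\<in>UNIV. h c) = h a * h b * (\<Prod>c\<in>UNIV - {a, b}. h c)" for h :: "'n \<Rightarrow> complex"
            using 3(3) by (subst prod.subset_diff[of "{a, b}"]) auto
          moreover have "(\<Prod>c\<in>UNIV - {a, b}. s' c ^ D c) = (\<Prod>c\<in>UNIV - {a, b}. s c ^ D' c)"
            by (rule prod.cong) (auto simp: D'_def s'_def)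
          ultimately show ?thesis using 3(3) by (simp add: D'_def s'_def power_add)
        qed
        ultimately show "g (rescale s x) = (\<Prod>c\<in>UNIV. s c ^ D' c) * g x"
          using "1.prems"(2) by (simp add: g_def homog_def)
      qed
      have "merge a b (shearE t x) = shearE t (merge a b x)"
        "merge a b (shearF t x) = shearF t (merge a b x)" for t x
        by (auto simp: merge_def shearE_def shearF_def fun_eq_iff)
      then show "inv2 g" using "1.prems"(3) by (simp add: inv2_def g_def)
    qed
    \<comment> \<open>Of the \<open>D a + D b\<close> letters \<open>a\<close> in each term,
      \<open>D b\<close> are renamed back to \<open>b\<close>.\<close>
    from bracket_span_split[OF this, of "D b" a b]
    obtain g' where g': "bracket_span (\<lambda>c. D' c - D b * unit_at a c + D b * unit_at b c) g'"
      "\<And>x. g' (merge a b x) = g (merge a b x)"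
      using 3(3) by (auto simp: D'_def)
    have "(\<lambda>c. D' c - D b * unit_at a c + D b * unit_at b c) = D"
      using 3(3) by (auto simp: D'_def unit_at_def)
    with g' have g'D: "bracket_span D g'" by simp
    define k where "k = (\<lambda>x. f x - g' x)"
    have k: "polyf k" "homog D k" "inv2 k"
      using bracket_span_props[OF g'D] "1.prems"
      by (simp_all add: k_def polyf_diff homog_diff inv2_diff)
    have kmerge: "k x = 0" if "\<And>i. x (a, i) = x (b, i)" for x
    proof -
      have "merge a b x = x" using that by (auto simp: merge_def)
      then show ?thesis using g'(2)[of x] by (simp add: k_def g_def)
    qed
    \<comment> \<open>Homogeneity carries the vanishing from equal vectors to proportional
      ones.\<close>
    have "k x = 0" if "br a b x = 0" for x
      using that
    proof (rule br_zero_cases)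
      fix t assume t: "\<And>i. x (b, i) = t * x (a, i)"
      define y where "y = merge a b x"
      have "x = rescale (\<lambda>c. if c = b then t else 1) y"
        using t 3(3) by (auto simp: y_def merge_def rescale_def)
      moreover have "k y = 0" by (rule kmerge) (simp add: y_def merge_def)
      ultimately show ?thesis using k(2) by (simp add: homog_def)
    next
      assume z: "\<And>i. x (a, i) = 0"
      define y where "y = merge b a x"
      have "x = rescale (\<lambda>c. if c = a then 0 else 1) y"
        using z 3(3) by (auto simp: y_def merge_def rescale_def)
      moreover have "k y = 0" by (rule kmerge) (simp add: y_def merge_def)
      ultimately show ?thesis using k(2) by (simp add: homog_def)
    qed
    then obtain h where h: "polyf h" "\<And>x. k x = br a b x * h x"
      using br_divides[OF k(1) 3(3)] by blast
    have ab: "br a b (\<lambda>(c, i). if c = a \<longleftrightarrow> i then 1 else 0) \<noteq> 0"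
      using 3(3) by (simp add: br_def)
    have cancel: "p = q" if "polyf p" "polyf q" "\<And>x. br a b x * p x = br a b x * q x" for p q
      by (rule ext) (rule polyf_cancel_eq[of "br a b" p q, OF polyf_br that ab])
    define D'' where "D'' = (\<lambda>c. D c - unit_at a c - unit_at b c)"
    have DD'': "D = (\<lambda>c. D'' c + unit_at a c + unit_at b c)"
    proof
      fix c show "D c = D'' c + unit_at a c + unit_at b c"
        using 3 by (cases "c = a"; cases "c = b") (auto simp: D''_def)
    qed
    have "bracket_span D'' h"
    proof (rule IH)
      have "(\<Sum>c\<in>UNIV. D c) = (\<Sum>c\<in>UNIV. D'' c) + 2"
        by (subst DD'') (simp add: sum.distrib sum_unit_at)
      then show "((\<Sum>c\<in>UNIV. D'' c, card {c. D'' c > 0}), (\<Sum>c\<in>UNIV. D c, card {c. D c > 0}))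
          \<in> less_than <*lex*> less_than"
        by simp
      show "polyf h" by (rule h(1))
      show "homog D'' h" unfolding homog_def
      proof (intro allI)
        fix s :: "'n \<Rightarrow> complex" and x :: "'n \<times> bool \<Rightarrow> complex"
        have "(\<lambda>x. s a * s b * h (rescale s x)) = (\<lambda>x. (\<Prod>c\<in>UNIV. s c ^ D c) * h x)" for s
        proof (rule cancel)
          fix x
          have "br a b x * (s a * s b * h (rescale s x)) = k (rescale s x)"
            by (simp add: h(2) br_rescale mult_ac)
          also have "\<dots> = (\<Prod>c\<in>UNIV. s c ^ D c) * k x"
            using k(2) by (simp add: homog_def)
          also have "\<dots> = br a b x * ((\<Prod>c\<in>UNIV. s c ^ D c) * h x)" by (simp add: h(2))
          finally show "br a b x * (s a * s b * h (rescale s x)) =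
            br a b x * ((\<Prod>c\<in>UNIV. s c ^ D c) * h x)" .
        qed (intro polyf_mult polyf.const polyf_rescale[OF h(1)] h(1))+
        note fun_eq = this
        have eq: "s a * s b * h (rescale s x) = (\<Prod>c\<in>UNIV. s c ^ D c) * h x" for s
          using fun_cong[OF fun_eq[of s], of x] .
        \<comment> \<open>For fixed \<open>x\<close> both sides are polynomial in \<open>s\<close>,
          so the factor \<open>s a * s b\<close> can be cancelled even where it vanishes.\<close>
        show "h (rescale s x) = (\<Prod>c\<in>UNIV. s c ^ D'' c) * h x"
        proof (rule polyf_cancel_eq[of "\<lambda>s. s a * s b" "\<lambda>s. h (rescale s x)"
              "\<lambda>s. (\<Prod>c\<in>UNIV. s c ^ D'' c) * h x" "\<lambda>_. 1"])
          fix s :: "'n \<Rightarrow> complex"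
          have "(\<Prod>c\<in>UNIV. s c ^ D c) = s a * s b * (\<Prod>c\<in>UNIV. s c ^ D'' c)"
            by (subst DD'') (simp add: power_add prod.distrib prod_power_unit_at mult_ac)
          with eq[of s] show "s a * s b * h (rescale s x) = s a * s b * ((\<Prod>c\<in>UNIV. s c ^ D'' c) * h x)"
            by simp
        next
          show "polyf (\<lambda>s. (\<Prod>c\<in>UNIV. s c ^ D'' c) * h x)"
            by (intro polyf_mult polyf_prod polyf_power polyf_coord polyf.const)
        qed (simp_all add: polyf_mult polyf_coord polyf_rescale_left[OF h(1)])
      qed
      have "h (shearE t x) = h x \<and> h (shearF t x) = h x" for t x
      proof -
        have "(\<lambda>x. h (shearE t x)) = h"
          using k(3) by (intro cancel polyf_shearE[OF h(1)] h(1)) (simp add: inv2_def h(2))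
        moreover have "(\<lambda>x. h (shearF t x)) = h"
          using k(3) by (intro cancel polyf_shearF[OF h(1)] h(1)) (simp add: inv2_def h(2))
        ultimately show ?thesis by metis
      qed
      then show "inv2 h" by (simp add: inv2_def)
    qed
    from bracket_span.br[OF this, of a b] have "bracket_span D (\<lambda>x. br a b x * h x)"
      by (simp flip: DD'')
    with g'D have "bracket_span D (\<lambda>x. g' x + br a b x * h x)" by (rule bracket_span.add)
    moreover have "(\<lambda>x. g' x + br a b x * h x) = f" by (simp flip: h(2) add: k_def)
    ultimately show ?thesis by simp
  qed
qed

section \<open>Invariants of four traceless matrices\<close>

text \<open>Always four indices: fewer tensor factors enter through an injection into this type. The
  numeral type \<open>4\<close> is only reached at the end, through \<open>emb4\<close>.\<close>

datatype ix = I1 | I2 | I3 | I4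

lemma UNIV_ix: "UNIV = {I1, I2, I3, I4}"
  using ix.exhaust by auto

instance ix :: finite
  by standard (simp add: UNIV_ix)

lemma sum_ix: "(\<Sum>a\<in>UNIV. f a) = f I1 + f I2 + f I3 + (f I4 :: 'a::comm_monoid_add)"
  by (simp add: UNIV_ix add.assoc)

text \<open>The point \<open>v\<close> of \<open>sl\<^sub>2\<^sup>n\<close> has the \<open>a\<close>-th matrix \<open>(q, p; r, -q)\<close> with
  \<open>p = v (a, Ep)\<close>, \<open>q = v (a, Hz)\<close> and \<open>r = v (a, Fm)\<close>.\<close>

datatype gen = Ep | Hz | Fm

lemma UNIV_gen: "UNIV = {Ep, Hz, Fm}"
  using gen.exhaust by auto

instance gen :: finite
  by standard (simp add: UNIV_gen)

lemma sum_gen: "(\<Sum>g\<in>UNIV. f g) = f Ep + f Hz + (f Fm :: 'a::comm_monoid_add)"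
  by (simp add: UNIV_gen add.assoc)

type_synonym 'n sl2pt = "'n \<times> gen \<Rightarrow> complex"

text \<open>For \<open>Ep\<close> and \<open>Fm\<close> this is conjugation of all matrices by the
  lower, respectively upper, unitriangular matrix with entry \<open>t\<close>. On the coordinate
  functions it integrates the commutator action of \<open>e_12\<close> or \<open>e_21\<close>, see
  \<open>flow_deriv\<close>. These two groups generate SL_2; \<open>Hz\<close> is given the identity
  so that statements can range over all \<open>g\<close>.\<close>

definition flow :: "gen \<Rightarrow> complex \<Rightarrow> 'n sl2pt \<Rightarrow> 'n sl2pt"
  where "flow g t v = (\<lambda>(a, h). case g of
      Ep \<Rightarrow> (case h of Ep \<Rightarrow> v (a, Ep) | Hz \<Rightarrow> v (a, Hz) - t * v (a, Ep)
        | Fm \<Rightarrow> v (a, Fm) + 2 * t * v (a, Hz) - t ^ 2 * v (a, Ep))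
    | Hz \<Rightarrow> v (a, h)
    | Fm \<Rightarrow> (case h of Ep \<Rightarrow> v (a, Ep) - 2 * t * v (a, Hz) - t ^ 2 * v (a, Fm)
        | Hz \<Rightarrow> v (a, Hz) + t * v (a, Fm) | Fm \<Rightarrow> v (a, Fm)))"

definition pairing :: "'n \<Rightarrow> 'n \<Rightarrow> 'n sl2pt \<Rightarrow> complex"
  where "pairing a b v = 2 * v (a, Hz) * v (b, Hz) + v (a, Ep) * v (b, Fm) + v (a, Fm) * v (b, Ep)"

text \<open>The trace of \<open>- c b a\<close> for the three matrices with these indices.\<close>

definition triple :: "'n \<Rightarrow> 'n \<Rightarrow> 'n \<Rightarrow> 'n sl2pt \<Rightarrow> complex"
  where "triple a b c v =
    v (a, Hz) * (v (b, Ep) * v (c, Fm) - v (b, Fm) * v (c, Ep))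
    - v (b, Hz) * (v (a, Ep) * v (c, Fm) - v (a, Fm) * v (c, Ep))
    + v (c, Hz) * (v (a, Ep) * v (b, Fm) - v (a, Fm) * v (b, Ep))"

lemma pairing_commute: "pairing a b = pairing b a"
  by (simp add: pairing_def fun_eq_iff)

lemma pairing_flow: "pairing a b (flow g t v) = pairing a b v"
  by (cases g) (simp_all add: pairing_def flow_def algebra_simps power2_eq_square)

lemma triple_flow: "triple a b c (flow g t v) = triple a b c v"
  by (cases g) (simp_all add: triple_def flow_def algebra_simps power2_eq_square)

lemma pairing_rescale: "pairing a b (rescale s v) = s a * s b * pairing a b v"
  by (simp add: pairing_def rescale_def algebra_simps)

lemma triple_rescale: "triple a b c (rescale s v) = s a * s b * s c * triple a b c v"
  by (simp add: triple_def rescale_def algebra_simps)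

lemma polyf_pairing: "polyf (pairing a b)"
  unfolding pairing_def[abs_def] by (intro polyf_mult polyf.add polyf_coord polyf.const)

lemma polyf_triple: "polyf (triple a b c)"
  unfolding triple_def[abs_def] by (intro polyf_mult polyf.add polyf_diff polyf_coord polyf.const)

lemma polyf_flow:
  assumes "polyf f"
  shows "polyf (\<lambda>v. f (flow g t v))"
proof (rule polyf_subst[where \<sigma> = "flow g t", OF assms])
  show "polyf (\<lambda>v. flow g t v p)" for p :: "'a \<times> gen"
    by (cases p; cases g; cases "snd p")
       (simp_all add: flow_def, (intro polyf_diff polyf.add polyf_mult polyf.const polyf_coord)+)
qed

text \<open>The triple products are labelled by the index that they lack, because in a standard
  monomial \<open>omit s\<close> must not be accompanied by the pairing of \<open>s\<close> with
  itself.\<close>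

definition omit :: "ix \<Rightarrow> ix sl2pt \<Rightarrow> complex"
  where "omit s = (case s of I1 \<Rightarrow> triple I2 I3 I4 | I2 \<Rightarrow> triple I1 I3 I4
    | I3 \<Rightarrow> triple I1 I2 I4 | I4 \<Rightarrow> triple I1 I2 I3)"

inductive inv_span :: "(ix \<Rightarrow> nat) \<Rightarrow> (ix sl2pt \<Rightarrow> complex) \<Rightarrow> bool" where
  const: "inv_span (\<lambda>_. 0) (\<lambda>_. c)"
| zero: "inv_span D (\<lambda>_. 0)"
| add: "inv_span D f \<Longrightarrow> inv_span D g \<Longrightarrow> inv_span D (\<lambda>v. f v + g v)"
| pairing: "inv_span D f \<Longrightarrow>
    inv_span (\<lambda>c. D c + unit_at a c + unit_at b c) (\<lambda>v. pairing a b v * f v)"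
| omit: "inv_span D f \<Longrightarrow>
    inv_span (\<lambda>c. D c + (if c = s then 0 else 1)) (\<lambda>v. omit s v * f v)"

lemma omit_rescale: "omit s (rescale u v) = (\<Prod>c\<in>UNIV. u c ^ (if c = s then 0 else 1)) * omit s v"
  by (cases s) (simp_all add: omit_def triple_rescale UNIV_ix mult_ac)

lemma inv_span_props:
  assumes "inv_span D f"
  shows "polyf f \<and> homog D f \<and> (\<forall>g t v. f (flow g t v) = f v)"
  using assms
proof (induction rule: inv_span.induct)
  case (pairing D f a b)
  then have "homog (\<lambda>c. D c + unit_at a c + unit_at b c) (\<lambda>v. pairing a b v * f v)"
    by (simp add: homog_def pairing_rescale power_add prod.distrib prod_power_unit_at mult_ac)
  then show ?case using pairing by (simp add: polyf_pairing polyf_mult pairing_flow)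
next
  case (omit D f s)
  have "polyf (omit s)" by (cases s) (simp_all add: omit_def polyf_triple)
  moreover have "homog (\<lambda>c. D c + (if c = s then 0 else 1)) (\<lambda>v. omit s v * f v)"
    using omit by (simp only: homog_def omit_rescale power_add prod.distrib simp_thms) (simp add: mult_ac)
  moreover have "omit s (flow g t v) = omit s v" for g t v
    by (cases s) (simp_all add: omit_def triple_flow)
  ultimately show ?case using omit by (simp add: polyf_mult)
qed (simp_all add: homog_zero homog_const homog_add polyf.const polyf.add)

lemma inv_span_scale: "inv_span D f \<Longrightarrow> inv_span D (\<lambda>v. c * f v)"
proof (induction rule: inv_span.induct)
  case (const d)
  show ?case using inv_span.const[of "c * d"] by simp
next
  case (zero D)
  show ?case using inv_span.zero by simp
next
  case (add D f g)
  show ?case using inv_span.add[OF add.IH] by (simp add: distrib_left)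
next
  case (pairing D f a b)
  show ?case using inv_span.pairing[OF pairing.IH, of a b] by (simp add: mult.left_commute)
next
  case (omit D f s)
  show ?case using inv_span.omit[OF omit.IH, of s] by (simp add: mult.left_commute)
qed

lemma inv_span_cong: "inv_span D f \<Longrightarrow> D = D' \<Longrightarrow> (\<And>v. f v = f' v) \<Longrightarrow> inv_span D' f'"
  by (metis ext)

section \<open>Restriction to nilpotent matrices\<close>

text \<open>The column \<open>(x, y)\<close> times the row \<open>(y, - x)\<close>: every nilpotent
  two by two matrix has this form, with a vector that is unique up to sign.\<close>

definition nilp :: "('n \<times> bool \<Rightarrow> complex) \<Rightarrow> 'n sl2pt"
  where "nilp x = (\<lambda>(a, g). case g of Ep \<Rightarrow> - (x (a, True) ^ 2)
    | Hz \<Rightarrow> x (a, True) * x (a, False) | Fm \<Rightarrow> x (a, False) ^ 2)"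

lemma pairing_nilp: "pairing a b (nilp x) = - (br a b x ^ 2)"
  by (simp add: pairing_def nilp_def br_def) algebra

lemma triple_nilp: "triple a b c (nilp x) = br a b x * br b c x * br a c x"
  by (simp add: triple_def nilp_def br_def) algebra

section \<open>Bracket monomials with even degrees lift to pairings and triple products\<close>

definition brmon :: "nat \<Rightarrow> nat \<Rightarrow> nat \<Rightarrow> nat \<Rightarrow> nat \<Rightarrow> nat \<Rightarrow> (ix \<times> bool \<Rightarrow> complex) \<Rightarrow> complex"
  where "brmon e12 e13 e14 e23 e24 e34 x = br I1 I2 x ^ e12 * br I1 I3 x ^ e13 * br I1 I4 x ^ e14 *
    br I2 I3 x ^ e23 * br I2 I4 x ^ e24 * br I3 I4 x ^ e34"

text \<open>Vertex degrees of the multigraph on four vertices with these edge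
  multiplicities.\<close>

definition brdeg :: "nat \<Rightarrow> nat \<Rightarrow> nat \<Rightarrow> nat \<Rightarrow> nat \<Rightarrow> nat \<Rightarrow> ix \<Rightarrow> nat"
  where "brdeg e12 e13 e14 e23 e24 e34 a = (case a of I1 \<Rightarrow> e12 + e13 + e14
    | I2 \<Rightarrow> e12 + e23 + e24 | I3 \<Rightarrow> e13 + e23 + e34 | I4 \<Rightarrow> e14 + e24 + e34)"

inductive brmon_span :: "(ix \<Rightarrow> nat) \<Rightarrow> ((ix \<times> bool \<Rightarrow> complex) \<Rightarrow> complex) \<Rightarrow> bool" where
  zero: "brmon_span D (\<lambda>_. 0)"
| add: "brmon_span D f \<Longrightarrow> brmon_span D g \<Longrightarrow> brmon_span D (\<lambda>x. f x + g x)"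
| mon: "D = brdeg e12 e13 e14 e23 e24 e34 \<Longrightarrow>
    brmon_span D (\<lambda>x. c * brmon e12 e13 e14 e23 e24 e34 x)"

lemma brmon_span_cong: "brmon_span D f \<Longrightarrow> (\<And>x. f x = g x) \<Longrightarrow> brmon_span D g"
  by (metis ext)

lemma brmon_span_uminus: "brmon_span D f \<Longrightarrow> brmon_span D (\<lambda>x. - f x)"
proof (induction rule: brmon_span.induct)
  case (add D f g)
  show ?case using brmon_span.add[OF add.IH] by (rule brmon_span_cong) simp
next
  case (mon D e12 e13 e14 e23 e24 e34 c)
  show ?case using brmon_span.mon[OF mon, of "- c"] by (rule brmon_span_cong) simp
qed (simp add: brmon_span.zero)

lemma brmon_span_br_mon:
  assumes "D = brdeg e12 e13 e14 e23 e24 e34"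
  shows "brmon_span (\<lambda>c. D c + unit_at a c + unit_at b c)
    (\<lambda>x. br a b x * (k * brmon e12 e13 e14 e23 e24 e34 x))"
proof -
  let ?B = "\<lambda>a b. brmon_span (\<lambda>c. D c + unit_at a c + unit_at b c)
    (\<lambda>x. br a b x * (k * brmon e12 e13 e14 e23 e24 e34 x))"
  have swap: "?B a b" if "?B b a" for a b
  proof -
    have "(\<lambda>c. D c + unit_at b c + unit_at a c) = (\<lambda>c. D c + unit_at a c + unit_at b c)"
      by auto
    with brmon_span_uminus[OF that]
    have "brmon_span (\<lambda>c. D c + unit_at a c + unit_at b c)
      (\<lambda>x. - (br b a x * (k * brmon e12 e13 e14 e23 e24 e34 x)))" by simp
    then show ?thesis
      by (rule brmon_span_cong) (simp add: br_def algebra_simps)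
  qed
  have self: "?B a a" for a
    by (simp add: brmon_span.zero)
  have deg: "(\<lambda>c. D c + unit_at I1 c + unit_at I2 c) = brdeg (Suc e12) e13 e14 e23 e24 e34"
    "(\<lambda>c. D c + unit_at I1 c + unit_at I3 c) = brdeg e12 (Suc e13) e14 e23 e24 e34"
    "(\<lambda>c. D c + unit_at I1 c + unit_at I4 c) = brdeg e12 e13 (Suc e14) e23 e24 e34"
    "(\<lambda>c. D c + unit_at I2 c + unit_at I3 c) = brdeg e12 e13 e14 (Suc e23) e24 e34"
    "(\<lambda>c. D c + unit_at I2 c + unit_at I4 c) = brdeg e12 e13 e14 e23 (Suc e24) e34"
    "(\<lambda>c. D c + unit_at I3 c + unit_at I4 c) = brdeg e12 e13 e14 e23 e24 (Suc e34)"
    unfolding assms by (auto simp: fun_eq_iff brdeg_def unit_at_def split: ix.split)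
  have m: "?B I1 I2" "?B I1 I3" "?B I1 I4" "?B I2 I3" "?B I2 I4" "?B I3 I4"
    unfolding deg
    by (rule brmon_span_cong[OF brmon_span.mon[OF refl, of _ _ _ _ _ _ k]],
        simp add: brmon_def mult_ac)+
  show ?thesis
    by (cases a; cases b; simp only:) (rule m self swap | rule swap, rule m)+
qed

lemma bracket_span_brmon_span:
  assumes "bracket_span D f"
  shows "brmon_span D f"
  using assms
proof (induction rule: bracket_span.induct)
  case (const c)
  have "brmon_span (\<lambda>_. 0) (\<lambda>x. c * brmon 0 0 0 0 0 0 x)"
    by (rule brmon_span.mon) (auto simp: brdeg_def fun_eq_iff split: ix.split)
  then show ?case by (simp add: brmon_def)
next
  case (br D f a b)
  from br.IH show ?case
  proof (induction rule: brmon_span.induct)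
    case (zero D)
    show ?case by (simp add: brmon_span.zero)
  next
    case (add D f g)
    show ?case using brmon_span.add[OF add.IH] by (rule brmon_span_cong) (simp add: distrib_left)
  next
    case (mon D e12 e13 e14 e23 e24 e34 c)
    then show ?case by (rule brmon_span_br_mon)
  qed
qed (auto intro: brmon_span.zero brmon_span.add)

lemma inv_span_neg_pairing_power:
  assumes "inv_span D f"
  shows "inv_span (\<lambda>c. D c + k * unit_at a c + k * unit_at b c) (\<lambda>v. (- pairing a b v) ^ k * f v)"
proof (induction k)
  case 0
  show ?case using assms by simp
next
  case (Suc k)
  show ?case using inv_span_scale[OF inv_span.pairing[OF Suc.IH, of a b], of "- 1"]
    by (rule inv_span_cong) (simp_all add: fun_eq_iff mult.assoc)
qed

lemma inv_span_pairing2: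
  "inv_span (\<lambda>c. unit_at a c + unit_at b c + unit_at a' c + unit_at b' c)
    (\<lambda>v. pairing a b v * pairing a' b' v)"
  using inv_span.pairing[OF inv_span.pairing[OF inv_span.const[of 1], of a' b'], of a b]
  by (rule inv_span_cong) (simp_all add: fun_eq_iff)

lemma inv_span_omit: "inv_span (\<lambda>c. if c = s then 0 else 1) (omit s)"
  using inv_span.omit[OF inv_span.const[of 1], of s] by simp

text \<open>An even subgraph of the complete graph on four vertices is empty, a triangle or a 4-cycle;
  for the latter, with \<open>X = [12][34]\<close>, \<open>Y = [14][23]\<close>, \<open>Z = [13][24]\<close>, the Pluecker relation
  \<open>X - Z + Y = 0\<close> expresses \<open>X Y\<close>, \<open>X Z\<close>, \<open>Y Z\<close> through the squares.\<close>

lemma even_brackets_squarefree: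
  assumes r: "r12 \<in> {0,1}" "r13 \<in> {0,1}" "r14 \<in> {0,1}" "r23 \<in> {0,1}" "r24 \<in> {0,1}" "r34 \<in> {0,1}"
    and even: "\<And>a. even (brdeg r12 r13 r14 r23 r24 r34 a)"
  shows "\<exists>f. inv_span (\<lambda>a. brdeg r12 r13 r14 r23 r24 r34 a div 2) f \<and>
    (\<forall>x. f (nilp x) = brmon r12 r13 r14 r23 r24 r34 x)"
proof -
  let ?P = "\<lambda>a b a' b' v. pairing a b v * pairing a' b' v"
  \<comment> \<open>Squaring \<open>Z = X + Y\<close> gives
    \<open>X * Y = (Z^2 - X^2 - Y^2) / 2\<close>; likewise \<open>X * Z\<close> and
    \<open>Y * Z\<close> are half a signed sum of the squares, with signs \<open>i\<close>,
    \<open>j\<close>, \<open>k\<close> for \<open>X^2\<close>, \<open>Y^2\<close>,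
    \<open>Z^2\<close>. Each square is a product of two pairings, in which the minus signs of
    \<open>pairing_nilp\<close> cancel.\<close>
  define h where "h = (\<lambda>i j k v. (1/2) * (i * ?P I1 I2 I3 I4 v + j * ?P I1 I4 I2 I3 v + k * ?P I1 I3 I2 I4 v))"
  have h: "inv_span (\<lambda>_. 1) (h i j k)" for i j k
    unfolding h_def
    by (intro inv_span_scale inv_span.add; rule inv_span_cong[OF inv_span_pairing2])
       (auto simp: unit_at_def fun_eq_iff split: ix.split intro: ix.exhaust)
  have pl: "br I1 I3 x * br I2 I4 x = br I1 I2 x * br I3 I4 x + br I1 I4 x * br I2 I3 x" for x
    by (simp add: br_def algebra_simps)
  have sq: "h i j k (nilp x) = (1/2) * (i * (br I1 I2 x * br I3 I4 x)^2 +
      j * (br I1 I4 x * br I2 I3 x)^2 + k * (br I1 I3 x * br I2 I4 x)^2)" for i j k x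
    by (simp add: h_def pairing_nilp power_mult_distrib)
  have "even (brdeg r12 r13 r14 r23 r24 r34 I1)" "even (brdeg r12 r13 r14 r23 r24 r34 I2)"
    "even (brdeg r12 r13 r14 r23 r24 r34 I3)" "even (brdeg r12 r13 r14 r23 r24 r34 I4)"
    by (rule even)+
  \<comment> \<open>The cycle space of the complete graph on four vertices has dimension three,
    hence eight elements.\<close>
  with r have patterns: "(r12, r13, r14, r23, r24, r34) \<in>
    {(0,0,0,0,0,0), (1,1,0,1,0,0), (1,0,1,0,1,0), (0,1,1,0,0,1), (0,0,0,1,1,1),
     (1,0,1,1,0,1), (1,1,0,0,1,1), (0,1,1,1,1,0)}"
    unfolding brdeg_def ix.case by (elim insertE emptyE) simp_all
  have witness: ?thesis
    if "inv_span D f" "\<And>a. D a = brdeg r12 r13 r14 r23 r24 r34 a div 2"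
      "\<And>x. f (nilp x) = brmon r12 r13 r14 r23 r24 r34 x" for D f
  proof -
    have "D = (\<lambda>a. brdeg r12 r13 r14 r23 r24 r34 a div 2)" using that(2) by blast
    with that(1,3) show ?thesis by blast
  qed
  from patterns show ?thesis
  proof (elim insertE emptyE, goal_cases)
    case 1
    then show ?thesis
      by (intro witness[OF inv_span.const[of 1]]) (auto simp: brdeg_def brmon_def split: ix.split)
  next
    case 2
    then show ?thesis by (intro witness[OF inv_span_omit[of I4]])
      (auto simp: brdeg_def brmon_def omit_def triple_nilp split: ix.split)
  next
    case 3
    then show ?thesis by (intro witness[OF inv_span_omit[of I3]])
      (auto simp: brdeg_def brmon_def omit_def triple_nilp split: ix.split)
  next
    case 4
    then show ?thesis by (intro witness[OF inv_span_omit[of I2]])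
      (auto simp: brdeg_def brmon_def omit_def triple_nilp split: ix.split)
  next
    case 5
    then show ?thesis by (intro witness[OF inv_span_omit[of I1]])
      (auto simp: brdeg_def brmon_def omit_def triple_nilp split: ix.split)
  next
    case 6
    show ?thesis
    proof (rule witness[OF h[of "- 1" "- 1" 1]])
      show "h (- 1) (- 1) 1 (nilp x) = brmon r12 r13 r14 r23 r24 r34 x" for x
        using 6 by (simp add: sq pl brmon_def power2_eq_square algebra_simps)
    qed (use 6 in \<open>auto simp: brdeg_def split: ix.split\<close>)
  next
    case 7
    show ?thesis
    proof (rule witness[OF h[of 1 "- 1" 1]])
      fix x
      have "brmon r12 r13 r14 r23 r24 r34 x = br I1 I2 x * br I3 I4 x * (br I1 I3 x * br I2 I4 x)"
        using 7 by (simp add: brmon_def mult_ac)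
      then show "h 1 (- 1) 1 (nilp x) = brmon r12 r13 r14 r23 r24 r34 x"
        by (simp add: sq pl power2_eq_square algebra_simps)
    qed (use 7 in \<open>auto simp: brdeg_def split: ix.split\<close>)
  next
    case 8
    show ?thesis
    proof (rule witness[OF h[of "- 1" 1 1]])
      fix x
      have "brmon r12 r13 r14 r23 r24 r34 x = br I1 I4 x * br I2 I3 x * (br I1 I3 x * br I2 I4 x)"
        using 8 by (simp add: brmon_def mult_ac)
      then show "h (- 1) 1 1 (nilp x) = brmon r12 r13 r14 r23 r24 r34 x"
        by (simp add: sq pl power2_eq_square algebra_simps)
    qed (use 8 in \<open>auto simp: brdeg_def split: ix.split\<close>)
  qed
qed

lemma power_even_odd: "x ^ e = (x ^ 2) ^ (e div 2) * x ^ (e mod 2)" for x :: "'a::comm_monoid_mult"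
  by (simp flip: power_mult power_add)

text \<open>The even part of each exponent is realised by a power of \<open>- pairing\<close>; the
  exponents mod 2 have the same vertex parities and fall under the squarefree case.\<close>

lemma even_brackets:
  assumes "(\<lambda>a. 2 * D a) = brdeg e12 e13 e14 e23 e24 e34"
  shows "\<exists>f. inv_span D f \<and> (\<forall>x. f (nilp x) = brmon e12 e13 e14 e23 e24 e34 x)"
proof -
  let ?r = "brdeg (e12 mod 2) (e13 mod 2) (e14 mod 2) (e23 mod 2) (e24 mod 2) (e34 mod 2)"
  have mod2: "e mod 2 \<in> {0, 1}" for e :: nat by auto
  have deg: "2 * D a = brdeg e12 e13 e14 e23 e24 e34 a" for a
    using fun_cong[OF assms] .
  have parity: "even (?r a)" for a
  proof -
    have "even (?r a) = even (brdeg e12 e13 e14 e23 e24 e34 a)"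
      by (cases a) (simp_all add: brdeg_def)
    then show ?thesis by (simp flip: deg)
  qed
  then obtain f where f: "inv_span (\<lambda>a. ?r a div 2) f"
    "\<And>x. f (nilp x) = brmon (e12 mod 2) (e13 mod 2) (e14 mod 2) (e23 mod 2) (e24 mod 2) (e34 mod 2) x"
    using even_brackets_squarefree[OF mod2 mod2 mod2 mod2 mod2 mod2 parity] by blast
  define g where "g = (\<lambda>v. (- pairing I1 I2 v) ^ (e12 div 2) * ((- pairing I1 I3 v) ^ (e13 div 2) *
    ((- pairing I1 I4 v) ^ (e14 div 2) * ((- pairing I2 I3 v) ^ (e23 div 2) *
    ((- pairing I2 I4 v) ^ (e24 div 2) * ((- pairing I3 I4 v) ^ (e34 div 2) * f v))))))"
  let ?D = "\<lambda>c. ?r c div 2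
        + (e34 div 2) * unit_at I3 c + (e34 div 2) * unit_at I4 c
        + (e24 div 2) * unit_at I2 c + (e24 div 2) * unit_at I4 c
        + (e23 div 2) * unit_at I2 c + (e23 div 2) * unit_at I3 c
        + (e14 div 2) * unit_at I1 c + (e14 div 2) * unit_at I4 c
        + (e13 div 2) * unit_at I1 c + (e13 div 2) * unit_at I3 c
        + (e12 div 2) * unit_at I1 c + (e12 div 2) * unit_at I2 c"
  have "inv_span ?D g"
    unfolding g_def by (intro inv_span_neg_pairing_power f(1))
  moreover have "?D = D"
  proof
    fix c
    have "2 * (?r c div 2) = ?r c" using parity[of c] by simp
    moreover have "e12 = 2 * (e12 div 2) + e12 mod 2" "e13 = 2 * (e13 div 2) + e13 mod 2"
      "e14 = 2 * (e14 div 2) + e14 mod 2" "e23 = 2 * (e23 div 2) + e23 mod 2"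
      "e24 = 2 * (e24 div 2) + e24 mod 2" "e34 = 2 * (e34 div 2) + e34 mod 2"
      by simp_all
    ultimately have "2 * ?D c = 2 * D c"
      unfolding deg brdeg_def by (cases c) (simp_all only: ix.case, simp_all)
    then show "?D c = D c" by simp
  qed
  ultimately have "inv_span D g" by simp
  moreover have "g (nilp x) = brmon e12 e13 e14 e23 e24 e34 x" for x
    unfolding g_def pairing_nilp minus_minus f(2) brmon_def
      power_even_odd[of "br I1 I2 x" e12] power_even_odd[of "br I1 I3 x" e13]
      power_even_odd[of "br I1 I4 x" e14] power_even_odd[of "br I2 I3 x" e23]
      power_even_odd[of "br I2 I4 x" e24] power_even_odd[of "br I3 I4 x" e34]
    by (simp only: mult_ac)
  ultimately show ?thesis by blast
qed

lemma even_bracket_span: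
  assumes "bracket_span (\<lambda>a. 2 * D a) f"
  shows "\<exists>g. inv_span D g \<and> (\<forall>x. g (nilp x) = f x)"
proof -
  have "brmon_span E f \<Longrightarrow> E = (\<lambda>a. 2 * D a) \<Longrightarrow> \<exists>g. inv_span D g \<and> (\<forall>x. g (nilp x) = f x)" for E f
  proof (induction rule: brmon_span.induct)
    case (zero E)
    show ?case by (rule exI[of _ "\<lambda>_. 0"]) (simp add: inv_span.zero)
  next
    case (add E f f')
    obtain g where g: "inv_span D g" "\<And>x. g (nilp x) = f x" using add by blast
    obtain g' where g': "inv_span D g'" "\<And>x. g' (nilp x) = f' x" using add by blast
    show ?case by (rule exI[of _ "\<lambda>v. g v + g' v"]) (simp add: inv_span.add g g')
  next
    case (mon E e12 e13 e14 e23 e24 e34 c)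
    then obtain g where g: "inv_span D g" "\<And>x. g (nilp x) = brmon e12 e13 e14 e23 e24 e34 x"
      using even_brackets by metis
    show ?case by (rule exI[of _ "\<lambda>v. c * g v"]) (simp add: inv_span_scale g)
  qed
  then show ?thesis using bracket_span_brmon_span[OF assms] by blast
qed

section \<open>Invariants when some of the matrices are nilpotent\<close>

text \<open>\<open>nilp_on J\<close> parametrizes the points whose matrices with index in \<open>J\<close> are nilpotent.\<close>

definition nilp_on :: "'n set \<Rightarrow> 'n sl2pt \<Rightarrow> 'n sl2pt"
  where "nilp_on J v = (\<lambda>(a, g). if a \<in> J then (case g of Ep \<Rightarrow> - (v (a, Ep) ^ 2)
    | Hz \<Rightarrow> v (a, Ep) * v (a, Hz) | Fm \<Rightarrow> v (a, Hz) ^ 2) else v (a, g))"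

text \<open>Minus the determinant of the \<open>a\<close>-th matrix, the equation of the nilpotent
  cone.\<close>

definition quad :: "'n \<Rightarrow> 'n sl2pt \<Rightarrow> complex"
  where "quad a v = v (a, Hz) ^ 2 + v (a, Ep) * v (a, Fm)"

lemma quad_pairing: "quad a v = pairing a a v / 2"
  by (simp add: quad_def pairing_def power2_eq_square)

lemma quad_rescale: "quad a (rescale s v) = s a ^ 2 * quad a v"
  by (simp add: quad_def rescale_def power_mult_distrib power2_eq_square algebra_simps)

lemma polyf_quad: "polyf (quad a)"
  unfolding quad_def[abs_def] by (intro polyf_mult polyf.add polyf_coord polyf_power)

lemma polyf_nilp_on:
  assumes "polyf f"
  shows "polyf (\<lambda>v. f (nilp_on J v))"
proof (rule polyf_subst[where \<sigma> = "nilp_on J", OF assms])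
  show "polyf (\<lambda>v. nilp_on J v p)" for p :: "'a \<times> gen"
    by (cases p; cases "fst p \<in> J"; cases "snd p")
       (simp_all add: nilp_on_def polyf_coord polyf_mult polyf_uminus polyf_power)
qed

lemma nilp_on_UNIV: "nilp_on UNIV v = nilp (\<lambda>(a, i). if i then v (a, Ep) else v (a, Hz))"
  by (auto simp: nilp_on_def nilp_def fun_eq_iff split: gen.split)

lemma nilp_eq_nilp_on: "\<exists>v. nilp x = nilp_on UNIV v"
  by (rule exI[of _ "\<lambda>(a, g). case g of Ep \<Rightarrow> x (a, True) | Hz \<Rightarrow> x (a, False) | Fm \<Rightarrow> 0"])
     (auto simp: nilp_on_def nilp_def fun_eq_iff split: gen.split)

lemma flow_nilp:
  "flow Ep t (nilp x) = nilp (shearE t x)" "flow Fm t (nilp x) = nilp (shearF t x)"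
  by (auto simp: flow_def nilp_def shearE_def shearF_def fun_eq_iff power2_eq_square algebra_simps
      split: gen.split)

lemma rescale_nilp: "nilp (rescale s x) = rescale (\<lambda>a. s a ^ 2) (nilp x)"
  by (auto simp: rescale_def nilp_def fun_eq_iff power2_eq_square algebra_simps split: gen.split)

lemma nilp_on_insert: "\<exists>w. nilp_on (insert a J) v = nilp_on J w"
  by (rule exI[of _ "\<lambda>p. if fst p = a \<and> a \<notin> J then nilp_on {a} v p else v p"])
     (auto simp: nilp_on_def fun_eq_iff split: gen.split)

text \<open>Conjugation keeps the matrices in \<open>J\<close> nilpotent: on their plane vectors,
  stored at \<open>Ep\<close> and \<open>Hz\<close>, it acts by a shear.\<close>

lemma flow_nilp_on: "\<exists>w. flow g t (nilp_on J v) = nilp_on J w"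
proof (cases g)
  case Ep
  then show ?thesis
    by (intro exI[of _ "\<lambda>(b, h). if b \<in> J then (case h of Ep \<Rightarrow> v (b, Ep)
        | Hz \<Rightarrow> v (b, Hz) + t * v (b, Ep) | Fm \<Rightarrow> 0) else flow g t v (b, h)"])
       (auto simp: nilp_on_def flow_def fun_eq_iff power2_eq_square algebra_simps split: gen.split)
next
  case Hz
  then show ?thesis by (intro exI[of _ v]) (auto simp: flow_def fun_eq_iff)
next
  case Fm
  then show ?thesis
    by (intro exI[of _ "\<lambda>(b, h). if b \<in> J then (case h of Ep \<Rightarrow> v (b, Ep) + t * v (b, Hz)
        | Hz \<Rightarrow> v (b, Hz) | Fm \<Rightarrow> 0) else flow g t v (b, h)"])
       (auto simp: nilp_on_def flow_def fun_eq_iff power2_eq_square algebra_simps split: gen.split)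
qed

text \<open>Scaling a nilpotent matrix amounts to scaling its plane vector by a square root of the
  factor.\<close>

lemma rescale_nilp_on: "\<exists>w. rescale s (nilp_on J v) = nilp_on J w"
proof -
  define u where "u = (\<lambda>b. csqrt (s b))"
  have u: "u b * u b = s b" for b
    unfolding u_def by (metis power2_csqrt power2_eq_square)
  have u2: "u b * (u b * z) = s b * z" for b z
    by (simp flip: mult.assoc add: u)
  show ?thesis
    by (rule exI[of _ "\<lambda>(b, h). if b \<in> J then u b * v (b, h) else s b * v (b, h)"])
       (auto simp: nilp_on_def rescale_def fun_eq_iff power2_eq_square mult_ac u u2 split: gen.split)
qed

text \<open>\<open>quad a\<close> is monic of degree 2 in \<open>v (a, Hz)\<close>, so division
  leaves a remainder that is linear in this coordinate, with coefficients free of it.\<close>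

lemma polyf_divide_quad:
  assumes "polyf f"
  shows "\<exists>f0 f1 h. polyf f0 \<and> polyf f1 \<and> polyf h \<and>
    (\<forall>v. f v = f0 v + v (a, Hz) * f1 v + quad a v * h v) \<and>
    (\<forall>v t. f0 (v((a, Hz) := t)) = f0 v \<and> f1 (v((a, Hz) := t)) = f1 v)"
  using assms
proof (induction rule: polyf.induct)
  case (const c)
  show ?case
    by (rule exI[of _ "\<lambda>_. c"], rule exI[of _ "\<lambda>_. 0"], rule exI[of _ "\<lambda>_. 0"])
       (simp add: polyf.const)
next
  case (var f k)
  obtain f0 f1 h where f: "polyf f0" "polyf f1" "polyf h"
    "\<And>v. f v = f0 v + v (a, Hz) * f1 v + quad a v * h v"
    "\<And>v t. f0 (v((a, Hz) := t)) = f0 v" "\<And>v t. f1 (v((a, Hz) := t)) = f1 v"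
    using var.IH by blast
  show ?case
  proof (cases "k = (a, Hz)")
    case True
    show ?thesis
    proof (intro exI conjI allI)
      show "v k * f v = - (v (a, Ep) * v (a, Fm)) * f1 v + v (a, Hz) * f0 v +
        quad a v * (f1 v + v (a, Hz) * h v)" for v
        by (simp add: True f(4) quad_def power2_eq_square algebra_simps)
    qed (simp_all add: polyf_intros f del: fun_upd_apply, simp_all)
  next
    case False
    show ?thesis
    proof (intro exI conjI allI)
      show "v k * f v = v k * f0 v + v (a, Hz) * (v k * f1 v) + quad a v * (v k * h v)" for v
        by (simp add: f(4) algebra_simps)
    qed (use False in \<open>simp_all add: polyf_intros f fun_upd_other del: fun_upd_apply\<close>)
  qed
next
  case (add f g)
  obtain f0 f1 h where f: "polyf f0" "polyf f1" "polyf h"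
    "\<And>v. f v = f0 v + v (a, Hz) * f1 v + quad a v * h v"
    "\<And>v t. f0 (v((a, Hz) := t)) = f0 v" "\<And>v t. f1 (v((a, Hz) := t)) = f1 v"
    using add.IH by blast
  obtain g0 g1 k where g: "polyf g0" "polyf g1" "polyf k"
    "\<And>v. g v = g0 v + v (a, Hz) * g1 v + quad a v * k v"
    "\<And>v t. g0 (v((a, Hz) := t)) = g0 v" "\<And>v t. g1 (v((a, Hz) := t)) = g1 v"
    using add.IH by blast
  show ?case
  proof (intro exI conjI allI)
    show "f v + g v = (f0 v + g0 v) + v (a, Hz) * (f1 v + g1 v) + quad a v * (h v + k v)" for v
      by (simp add: f(4) g(4) algebra_simps)
  qed (simp_all add: polyf_intros f g del: fun_upd_apply)
qed

text \<open>Downward induction on the set \<open>J\<close> of indices of the nilpotent matrices. An invariant that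
  agrees with an element of the span once the \<open>a\<close>-th matrix is nilpotent differs from it by a
  multiple of \<open>quad a\<close>, and the quotient is again invariant.\<close>

lemma inv_span_nilp_on:
  assumes "polyf f"
    and "\<And>s v. f (rescale s (nilp_on J v)) = (\<Prod>a\<in>UNIV. s a ^ D a) * f (nilp_on J v)"
    and "\<And>g t v. f (flow g t (nilp_on J v)) = f (nilp_on J v)"
  shows "\<exists>b. inv_span D b \<and> (\<forall>v. b (nilp_on J v) = f (nilp_on J v))"
  using assms
\<comment> \<open>Either one more matrix becomes nilpotent, or \<open>J\<close> stays and the
  quotient by \<open>quad a\<close> has total degree two less.\<close>
proof (induction "card (- J) + (\<Sum>a\<in>UNIV. D a)" arbitrary: J D f rule: less_induct)
  case (less J D f)
  show ?case
  proof (cases "J = UNIV")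
    case True
    have *: "\<exists>v. nilp x = nilp_on J v" for x :: "ix \<times> bool \<Rightarrow> complex"
      using nilp_eq_nilp_on True by blast
    define F where "F = (\<lambda>x. f (nilp x))"
    have "polyf F" unfolding F_def
    proof (rule polyf_subst[where \<sigma> = nilp, OF less.prems(1)])
      show "polyf (\<lambda>x. nilp x p)" for p :: "ix \<times> gen"
        by (cases p; cases "snd p")
           (simp_all add: nilp_def polyf_coord polyf_mult polyf_uminus polyf_power)
    qed
    moreover have "homog (\<lambda>a. 2 * D a) F"
      unfolding homog_def F_def rescale_nilp
    proof (intro allI)
      fix s :: "ix \<Rightarrow> complex" and x
      obtain v where v: "nilp x = nilp_on J v" using * by blast
      show "f (rescale (\<lambda>a. s a ^ 2) (nilp x)) = (\<Prod>a\<in>UNIV. s a ^ (2 * D a)) * f (nilp x)"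
        unfolding v less.prems(2) by (simp add: power_mult)
    qed
    moreover have "inv2 F"
      unfolding inv2_def F_def flow_nilp[symmetric] by (metis * less.prems(3))
    ultimately obtain b where b: "inv_span D b" "\<And>x. b (nilp x) = F x"
      using even_bracket_span[OF bracket_span_invariants] by blast
    then show ?thesis
      by (intro exI[of _ b]) (simp add: True nilp_on_UNIV F_def)
  next
    case False
    then obtain a where a: "a \<notin> J" by auto
    have card: "card (- insert a J) < card (- J)"
      using a by (intro psubset_card_mono) auto
    obtain b where b: "inv_span D b" "\<And>v. b (nilp_on (insert a J) v) = f (nilp_on (insert a J) v)"
    proof -
      have "\<exists>b. inv_span D b \<and> (\<forall>v. b (nilp_on (insert a J) v) = f (nilp_on (insert a J) v))"
      proof (rule less.hyps)
        show "card (- insert a J) + (\<Sum>a\<in>UNIV. D a) < card (- J) + (\<Sum>a\<in>UNIV. D a)"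
          using card by simp
        show "polyf f" by (rule less.prems(1))
        fix s g t and v :: "ix sl2pt"
        obtain w where w: "nilp_on (insert a J) v = nilp_on J w" using nilp_on_insert[of a J v] by blast
        show "f (rescale s (nilp_on (insert a J) v)) =
            (\<Prod>a\<in>UNIV. s a ^ D a) * f (nilp_on (insert a J) v)"
          unfolding w by (rule less.prems(2))
        show "f (flow g t (nilp_on (insert a J) v)) = f (nilp_on (insert a J) v)"
          unfolding w by (rule less.prems(3))
      qed
      then show ?thesis using that by blast
    qed
    note bp = inv_span_props[OF b(1)]
    define k where "k = (\<lambda>v. f v - b v)"
    have k: "polyf k"
      "\<And>s v. k (rescale s (nilp_on J v)) = (\<Prod>a\<in>UNIV. s a ^ D a) * k (nilp_on J v)"
      "\<And>g t v. k (flow g t (nilp_on J v)) = k (nilp_on J v)"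
      "\<And>v. k (nilp_on (insert a J) v) = 0"
      using less.prems bp b(2)
      by (simp_all add: k_def polyf_diff homog_def right_diff_distrib)
    obtain k0 k1 h where h: "polyf k0" "polyf k1" "polyf h"
      "\<And>v. k v = k0 v + v (a, Hz) * k1 v + quad a v * h v"
      "\<And>v t. k0 (v((a, Hz) := t)) = k0 v" "\<And>v t. k1 (v((a, Hz) := t)) = k1 v"
      using polyf_divide_quad[OF k(1), of a] by blast
    \<comment> \<open>With the \<open>Ep\<close> and \<open>Fm\<close> entries of the
      \<open>a\<close>-th matrix fixed, it is nilpotent exactly when its \<open>Hz\<close> entry is
      \<open>x * y\<close> or \<open>- x * y\<close>. The remainder
      \<open>k0 + v (a, Hz) * k1\<close> vanishes for both signs, hence so do \<open>k0\<close> and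
      \<open>x * y * k1\<close>.\<close>
    have split: "k0 (nilp_on J v) = 0 \<and> v (a, Ep) * v (a, Fm) * k1 (nilp_on J v) = 0" for v
    proof -
      define x where "x = csqrt (- v (a, Ep))"
      define y where "y = csqrt (v (a, Fm))"
      have x: "x * x = - v (a, Ep)" and y: "y * y = v (a, Fm)"
        unfolding x_def y_def by (metis power2_csqrt power2_eq_square)+
      have eq: "k0 (nilp_on J v) + \<sigma> * x * y * k1 (nilp_on J v) = 0" if \<sigma>: "\<sigma> * \<sigma> = 1" for \<sigma>
      proof -
        define w where "w = v((a, Ep) := \<sigma> * x, (a, Hz) := y)"
        have \<sigma>': "\<sigma> * (\<sigma> * z) = z" for z by (simp flip: mult.assoc add: \<sigma>)
        have "nilp_on (insert a J) w = (nilp_on J v)((a, Hz) := \<sigma> * x * y)"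
          using a by (auto simp: nilp_on_def w_def fun_eq_iff power2_eq_square mult_ac \<sigma>' x y
              split: gen.split)
        moreover have "quad a ((nilp_on J v)((a, Hz) := \<sigma> * x * y)) = 0"
        proof -
          have "(\<sigma> * x * y) ^ 2 = (\<sigma> * \<sigma>) * (x * x) * (y * y)"
            by (simp add: power2_eq_square mult_ac)
          then show ?thesis using a by (simp add: quad_def nilp_on_def \<sigma> x y)
        qed
        ultimately show ?thesis
          using k(4)[of w] h(4)[of "(nilp_on J v)((a, Hz) := \<sigma> * x * y)"] by (simp add: h(5,6) del: fun_upd_apply add: fun_upd_same)
      qed
      from eq[of 1] eq[of "- 1"] have "k0 (nilp_on J v) = 0 \<and> x * y * k1 (nilp_on J v) = 0"
        by (simp add: add_eq_0_iff)
      moreover have "v (a, Ep) * v (a, Fm) * k1 (nilp_on J v) = - (x * y * (x * y * k1 (nilp_on J v)))"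
        using x y by (metis (no_types, opaque_lifting) minus_mult_left minus_minus mult.assoc mult.commute)
      ultimately show ?thesis by simp
    qed
    have k1: "k1 (nilp_on J v) = 0" for v
      by (rule polyf_cancel[of "\<lambda>v. v (a, Ep) * v (a, Fm)" "\<lambda>v. k1 (nilp_on J v)" "\<lambda>_. 1"])
         (use split in \<open>simp_all add: polyf_mult polyf_coord polyf_nilp_on[OF h(2)]\<close>)
    have quad: "quad a (nilp_on J v) = quad a v" for v
      using a by (simp add: quad_def nilp_on_def)
    have kh: "k (nilp_on J v) = quad a v * h (nilp_on J v)" for v
      using h(4)[of "nilp_on J v"] split[of v] k1[of v] by (simp add: quad)
    have cancel: "p v = q v" if "polyf p" "polyf q" "\<And>v. quad a v * p v = quad a v * q v" for p q v
      by (rule polyf_cancel_eq[of "quad a" p q "\<lambda>_. 1", OF polyf_quad that]) (simp add: quad_def)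
    have hflow: "h (flow g t (nilp_on J v)) = h (nilp_on J v)" for g t v
    proof (rule cancel[of "\<lambda>v. h (flow g t (nilp_on J v))" "\<lambda>v. h (nilp_on J v)"])
      fix v
      obtain w where w: "flow g t (nilp_on J v) = nilp_on J w" using flow_nilp_on[of g t J v] by blast
      have "quad a w = quad a v"
        by (metis quad quad_pairing pairing_flow w)
      then show "quad a v * h (flow g t (nilp_on J v)) = quad a v * h (nilp_on J v)"
        using k(3)[of g t v] by (simp add: w kh)
    qed (rule polyf_nilp_on[OF polyf_flow[OF h(3)]], rule polyf_nilp_on[OF h(3)])
    \<comment> \<open>The factor \<open>s a ^ 2\<close> is kept on the left; whether the right-hand
      side contains it depends on \<open>D a\<close>.\<close>
    have hscale: "s a ^ 2 * h (rescale s (nilp_on J v)) = (\<Prod>c\<in>UNIV. s c ^ D c) * h (nilp_on J v)" for s v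
    proof (rule cancel[of "\<lambda>v. s a ^ 2 * h (rescale s (nilp_on J v))"
          "\<lambda>v. (\<Prod>c\<in>UNIV. s c ^ D c) * h (nilp_on J v)"])
      fix v
      obtain w where w: "rescale s (nilp_on J v) = nilp_on J w" using rescale_nilp_on[of s J v] by blast
      have "quad a w = quad a (rescale s (nilp_on J v))" by (simp add: w quad)
      also have "\<dots> = s a ^ 2 * quad a v"
        by (simp add: quad_rescale quad)
      finally have qw: "quad a w = s a ^ 2 * quad a v" .
      have "quad a v * (s a ^ 2 * h (rescale s (nilp_on J v))) = k (rescale s (nilp_on J v))"
        by (simp add: w kh qw)
      also have "\<dots> = quad a v * ((\<Prod>c\<in>UNIV. s c ^ D c) * h (nilp_on J v))"
        by (simp add: k(2) kh)
      finally show "quad a v * (s a ^ 2 * h (rescale s (nilp_on J v))) =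
        quad a v * ((\<Prod>c\<in>UNIV. s c ^ D c) * h (nilp_on J v))" .
    qed (intro polyf_mult polyf.const polyf_nilp_on[OF polyf_rescale[OF h(3)]] polyf_nilp_on[OF h(3)])+
    show ?thesis
    proof (cases "D a \<ge> 2")
      case True
      define D' where "D' = (\<lambda>c. D c - 2 * unit_at a c)"
      have DD': "D = (\<lambda>c. D' c + unit_at a c + unit_at a c)"
        using True by (auto simp: D'_def unit_at_def fun_eq_iff)
      have prodD: "(\<Prod>c\<in>UNIV. s c ^ D c) = s a ^ 2 * (\<Prod>c\<in>UNIV. s c ^ D' c)" for s :: "ix \<Rightarrow> complex"
        by (subst DD') (simp add: power_add prod.distrib prod_power_unit_at power2_eq_square mult_ac)
      have hom: "h (rescale s (nilp_on J v)) = (\<Prod>c\<in>UNIV. s c ^ D' c) * h (nilp_on J v)" for s v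
      proof (rule polyf_cancel_eq[of "\<lambda>s. s a ^ 2" "\<lambda>s. h (rescale s (nilp_on J v))"
            "\<lambda>s. (\<Prod>c\<in>UNIV. s c ^ D' c) * h (nilp_on J v)" "\<lambda>_. 1"])
        show "polyf (\<lambda>s. (\<Prod>c\<in>UNIV. s c ^ D' c) * h (nilp_on J v))"
          by (intro polyf_mult polyf_prod polyf_power polyf_coord polyf.const)
        show "s a ^ 2 * h (rescale s (nilp_on J v)) =
            s a ^ 2 * ((\<Prod>c\<in>UNIV. s c ^ D' c) * h (nilp_on J v))" for s
          using hscale[of s v] by (simp add: prodD)
      qed (simp_all add: polyf_coord polyf_power polyf_rescale_left[OF h(3)])
      have "(\<Sum>c\<in>UNIV. D c) = (\<Sum>c\<in>UNIV. D' c) + 2"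
        by (subst DD') (simp add: sum.distrib sum_unit_at)
      then obtain b' where b': "inv_span D' b'" "\<And>v. b' (nilp_on J v) = h (nilp_on J v)"
        using less.hyps[of J D' h] h(3) hom hflow by auto
      have "inv_span D (\<lambda>v. b v + (1/2) * (pairing a a v * b' v))"
        using inv_span.pairing[OF b'(1), of a a]
        by (intro inv_span.add b(1) inv_span_scale) (simp flip: DD')
      moreover have "b (nilp_on J v) + (1/2) * (pairing a a (nilp_on J v) * b' (nilp_on J v))
          = f (nilp_on J v)" for v
      proof -
        have "(1/2) * (pairing a a (nilp_on J v) * b' (nilp_on J v)) = k (nilp_on J v)"
          using quad[of v] by (simp add: kh b'(2) quad_pairing)
        then show ?thesis by (simp only: k_def) simp
      qed
      ultimately show ?thesis by blast
    next
      \<comment> \<open>Degree at most 1 in the \<open>a\<close>-th matrix leaves no room for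
        \<open>quad a\<close>: putting \<open>s a = 0\<close> into \<open>hscale\<close>, after
        cancelling one \<open>s a\<close> if the degree is 1, shows that the quotient is 0.\<close>
      case False
      have "h (nilp_on J v) = 0" for v
      proof (cases "D a = 0")
        case True
        then have "(\<Prod>c\<in>UNIV. ((\<lambda>_. 1)(a := 0)) c ^ D c) = (1::complex)"
          by (intro prod.neutral) auto
        then show ?thesis using hscale[of "(\<lambda>_. 1)(a := 0)" v] by simp
      next
        case False
        with \<open>\<not> D a \<ge> 2\<close> have Da: "D a = 1" by simp
        define E where "E = (\<lambda>c. D c - unit_at a c)"
        have DE: "D = (\<lambda>c. E c + unit_at a c)"
          using Da by (auto simp: E_def unit_at_def fun_eq_iff)
        have prodE: "(\<Prod>c\<in>UNIV. s c ^ D c) = s a * (\<Prod>c\<in>UNIV. s c ^ E c)" for s :: "ix \<Rightarrow> complex"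
          by (subst DE) (simp add: power_add prod.distrib prod_power_unit_at mult_ac)
        have Ea: "E a = 0" using Da by (simp add: E_def)
        have "s a * h (rescale s (nilp_on J v)) = (\<Prod>c\<in>UNIV. s c ^ E c) * h (nilp_on J v)" for s
        proof (rule polyf_cancel_eq[of "\<lambda>s. s a" "\<lambda>s. s a * h (rescale s (nilp_on J v))"
              "\<lambda>s. (\<Prod>c\<in>UNIV. s c ^ E c) * h (nilp_on J v)" "\<lambda>_. 1"])
          show "polyf (\<lambda>s. (\<Prod>c\<in>UNIV. s c ^ E c) * h (nilp_on J v))"
            by (intro polyf_mult polyf_prod polyf_power polyf_coord polyf.const)
          show "s a * (s a * h (rescale s (nilp_on J v))) =
              s a * ((\<Prod>c\<in>UNIV. s c ^ E c) * h (nilp_on J v))" for s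
            using hscale[of s v] unfolding prodE power2_eq_square by (simp only: mult.assoc)
        qed (simp_all add: polyf_coord polyf_mult polyf_rescale_left[OF h(3)])
        from this[of "(\<lambda>_. 1)(a := 0)"] Ea show ?thesis by (auto split: if_splits)
      qed
      then have "k (nilp_on J v) = 0" for v by (simp add: kh)
      then show ?thesis using b(1) by (intro exI[of _ b]) (simp add: k_def)
    qed
  qed
qed

theorem inv_span_invariants:
  assumes "polyf f" "homog D f" "\<And>g t v. f (flow g t v) = f v"
  shows "inv_span D f"
proof -
  have [simp]: "nilp_on {} v = v" for v :: "ix sl2pt" by (simp add: nilp_on_def)
  have "\<exists>b. inv_span D b \<and> (\<forall>v. b (nilp_on {} v) = f (nilp_on {} v))"
    using assms by (intro inv_span_nilp_on) (simp_all add: homog_def)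
  then show ?thesis using inv_span_cong by auto
qed

section \<open>Standard monomials\<close>

definition upper :: "(ix \<times> ix) set"
  where "upper = {(I1, I1), (I1, I2), (I1, I3), (I1, I4), (I2, I2), (I2, I3), (I2, I4),
    (I3, I3), (I3, I4), (I4, I4)}"

lemma finite_upper [simp]: "finite upper"
  by (simp add: upper_def)

lemma diag_upper [simp]: "(s, s) \<in> upper"
  by (cases s) (simp_all add: upper_def)

definition upper_pair :: "ix \<Rightarrow> ix \<Rightarrow> ix \<times> ix"
  where "upper_pair a b = (if (a, b) \<in> upper then (a, b) else (b, a))"

lemma upper_pair_upper [simp]: "upper_pair a b \<in> upper"
  by (cases a; cases b) (simp_all add: upper_pair_def upper_def)

lemma upper_pair_diag [simp]: "upper_pair a b = (s, s) \<longleftrightarrow> a = s \<and> b = s"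
  by (auto simp: upper_pair_def)

lemma upper_pair_same: "upper_pair a a = (a, a)"
  by (simp add: upper_pair_def)

definition pmon :: "(ix \<times> ix \<Rightarrow> nat) \<Rightarrow> ix sl2pt \<Rightarrow> complex"
  where "pmon \<alpha> v = (\<Prod>p\<in>upper. pairing (fst p) (snd p) v ^ \<alpha> p)"

definition omit_opt :: "ix option \<Rightarrow> ix sl2pt \<Rightarrow> complex"
  where "omit_opt t v = (case t of None \<Rightarrow> 1 | Some s \<Rightarrow> omit s v)"

definition invmon :: "ix option \<times> (ix \<times> ix \<Rightarrow> nat) \<Rightarrow> ix sl2pt \<Rightarrow> complex"
  where "invmon i v = omit_opt (fst i) v * pmon (snd i) v"

definition invdeg :: "ix option \<times> (ix \<times> ix \<Rightarrow> nat) \<Rightarrow> nat"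
  where "invdeg i = (if fst i = None then 0 else 3) + 2 * (\<Sum>p\<in>upper. snd i p)"

definition diagdeg :: "(ix \<times> ix \<Rightarrow> nat) \<Rightarrow> nat"
  where "diagdeg \<alpha> = (\<Sum>s\<in>UNIV. \<alpha> (s, s))"

text \<open>All five families at once: \<open>Some s\<close> stands for a factor
  \<open>omit s\<close>, and \<open>None\<close> for the family without a triple product.\<close>

definition standard :: "(ix option \<times> (ix \<times> ix \<Rightarrow> nat)) set"
  where "standard = {i. (\<forall>p. p \<notin> upper \<longrightarrow> snd i p = 0) \<and>
    (case fst i of None \<Rightarrow> \<exists>s. snd i (s, s) = 0 | Some s \<Rightarrow> snd i (s, s) = 0)}"

inductive std_span :: "nat \<Rightarrow> (ix sl2pt \<Rightarrow> complex) \<Rightarrow> bool" where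
  zero: "std_span d (\<lambda>_. 0)"
| add: "std_span d f \<Longrightarrow> std_span d g \<Longrightarrow> std_span d (\<lambda>v. f v + g v)"
| mon: "i \<in> standard \<Longrightarrow> invdeg i = d \<Longrightarrow> std_span d (\<lambda>v. c * invmon i v)"

text \<open>The bound \<open>k\<close> on the diagonal degree is the quantity that straightening
  decreases.\<close>

inductive mon_span :: "nat \<Rightarrow> nat \<Rightarrow> (ix sl2pt \<Rightarrow> complex) \<Rightarrow> bool" where
  zero: "mon_span d k (\<lambda>_. 0)"
| add: "mon_span d k f \<Longrightarrow> mon_span d k g \<Longrightarrow> mon_span d k (\<lambda>v. f v + g v)"
| mon: "\<forall>p. p \<notin> upper \<longrightarrow> snd i p = 0 \<Longrightarrow> invdeg i = d \<Longrightarrow> diagdeg (snd i) \<le> k \<Longrightarrow>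
    mon_span d k (\<lambda>v. c * invmon i v)"

lemma mon_span_cong: "mon_span d k f \<Longrightarrow> d = d' \<Longrightarrow> k \<le> k' \<Longrightarrow> (\<And>v. f v = g v) \<Longrightarrow> mon_span d' k' g"
proof -
  have "mon_span d k f \<Longrightarrow> k \<le> k' \<Longrightarrow> mon_span d k' f"
    by (induction rule: mon_span.induct) (auto intro: mon_span.intros)
  then show "mon_span d k f \<Longrightarrow> d = d' \<Longrightarrow> k \<le> k' \<Longrightarrow> (\<And>v. f v = g v) \<Longrightarrow> ?thesis"
    by (metis ext)
qed

lemma mon_span_scale: "mon_span d k f \<Longrightarrow> mon_span d k (\<lambda>v. c * f v)"
proof (induction rule: mon_span.induct)
  case (zero d k)
  show ?case by (simp add: mon_span.zero)
next
  case (add d k f g)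
  show ?case using mon_span.add[OF add.IH] by (simp add: distrib_left)
next
  case (mon i d k b)
  show ?case using mon_span.mon[OF mon, of "c * b"] by (simp add: mult.assoc)
qed

lemma pmon_bump:
  assumes "q \<in> upper"
  shows "pmon (\<lambda>p. \<alpha> p + unit_at q p) v = pairing (fst q) (snd q) v * pmon \<alpha> v"
proof -
  have "(\<Prod>p\<in>upper. pairing (fst p) (snd p) v ^ unit_at q p) =
      (\<Prod>p\<in>upper. if p = q then pairing (fst p) (snd p) v else 1)"
    by (rule prod.cong) (auto simp: unit_at_def)
  also have "\<dots> = pairing (fst q) (snd q) v" using assms by simp
  finally show ?thesis by (simp add: pmon_def power_add prod.distrib mult.commute)
qed

lemma pmon_bump_pair:
  "pmon (\<lambda>p. \<alpha> p + unit_at (upper_pair a b) p) v = pairing a b v * pmon \<alpha> v"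
  using pmon_bump[OF upper_pair_upper, of \<alpha> a b v]
  by (simp add: upper_pair_def pairing_commute[of b a] split: if_splits)

lemma sum_upper_bump: "q \<in> upper \<Longrightarrow> (\<Sum>p\<in>upper. \<alpha> p + unit_at q p) = Suc (\<Sum>p\<in>upper. \<alpha> p)"
  by (simp add: sum.distrib unit_at_def)

lemma diagdeg_bump:
  "diagdeg (\<lambda>p. \<alpha> p + unit_at (upper_pair a b) p) = diagdeg \<alpha> + (if a = b then 1 else 0)"
proof -
  have "(\<Sum>s\<in>UNIV. unit_at (upper_pair a b) (s, s)) = (\<Sum>s\<in>UNIV. if s = a \<and> a = b then 1 else 0)"
    by (rule sum.cong) (auto simp: unit_at_def eq_commute[of "(_, _)"])
  also have "\<dots> = (if a = b then 1 else 0)" by simp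
  finally show ?thesis by (simp add: diagdeg_def sum.distrib)
qed

lemma mon_span_pairing:
  assumes "mon_span d k f"
  shows "mon_span (d + 2) (k + (if a = b then 1 else 0)) (\<lambda>v. pairing a b v * f v)"
  using assms
proof (induction rule: mon_span.induct)
  case (zero d k)
  show ?case by (simp add: mon_span.zero)
next
  case (add d k f g)
  show ?case using mon_span.add[OF add.IH] by (rule mon_span_cong) (simp_all add: distrib_left)
next
  case (mon i d k c)
  define j where "j = (fst i, \<lambda>p. snd i p + unit_at (upper_pair a b) p)"
  have "mon_span (d + 2) (k + (if a = b then 1 else 0)) (\<lambda>v. c * invmon j v)"
  proof (rule mon_span.mon)
    show "\<forall>p. p \<notin> upper \<longrightarrow> snd j p = 0"
    proof (intro allI impI)
      fix p assume "p \<notin> upper"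
      then have "p \<noteq> upper_pair a b" using upper_pair_upper by metis
      moreover have "snd i p = 0" using \<open>p \<notin> upper\<close> mon(1) by blast
      ultimately show "snd j p = 0" by (simp add: j_def)
    qed
    show "invdeg j = d + 2"
      using mon(2) sum_upper_bump[OF upper_pair_upper, of "snd i" a b] by (simp add: invdeg_def j_def)
    show "diagdeg (snd j) \<le> k + (if a = b then 1 else 0)"
      using mon(3) by (simp add: j_def diagdeg_bump)
  qed
  then show ?case
    by (rule mon_span_cong) (simp_all add: invmon_def j_def pmon_bump_pair)
qed

lemma mon_span_pairing_weak:
  "mon_span d k f \<Longrightarrow> mon_span (d + 2) (Suc k) (\<lambda>v. pairing a b v * f v)"
  using mon_span_pairing[of d k f a b] by (rule mon_span_cong) auto

section \<open>Relations between pairings and triple products\<close>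

definition minor :: "ix \<Rightarrow> ix \<Rightarrow> ix \<Rightarrow> ix \<Rightarrow> ix \<Rightarrow> ix \<Rightarrow> ix sl2pt \<Rightarrow> complex"
  where "minor a b c d e f v =
    pairing a d v * (pairing b e v * pairing c f v) - pairing a d v * (pairing b f v * pairing c e v)
    - pairing a e v * (pairing b d v * pairing c f v) + pairing a e v * (pairing b f v * pairing c d v)
    + pairing a f v * (pairing b d v * pairing c e v) - pairing a f v * (pairing b e v * pairing c d v)"

text \<open>\<open>triple\<close> is a constant multiple of the determinant of three vectors, so a
  product of two of them is a multiple of the Gram minor with rows \<open>a b c\<close> and columns
  \<open>d e f\<close>. This is why one triple product per monomial is enough.\<close>

lemma triple_triple: "triple a b c v * triple d e f v = - (1/2) * minor a b c d e f v"
  by (simp add: triple_def minor_def pairing_def algebra_simps)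

text \<open>Four vectors in three-space satisfy a linear relation with triple products as
  coefficients (Cramer's rule); it is paired here with the vector \<open>x\<close>.\<close>

lemma triple_pairing:
  "triple I1 I2 I3 v * pairing I4 x v - triple I1 I2 I4 v * pairing I3 x v
    + triple I1 I3 I4 v * pairing I2 x v - triple I2 I3 I4 v * pairing I1 x v = 0"
  by (simp add: triple_def pairing_def algebra_simps)

lemma mon_span_minor:
  assumes "mon_span m k g"
  shows "mon_span (m + 6) (k + 3) (\<lambda>v. minor a b c d e f v * g v)"
proof -
  have t: "mon_span (m + 6) (k + 3) (\<lambda>v. s * (pairing a b v * (pairing c d v * (pairing e f v * g v))))"
    for s a b c d e f
    by (rule mon_span_cong[OF mon_span_scale[OF mon_span_pairing_weak[OF
              mon_span_pairing_weak[OF mon_span_pairing_weak[OF assms, of e f], of c d], of a b], of s]])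
       simp_all
  have "mon_span (m + 6) (k + 3) (\<lambda>v.
    1 * (pairing a d v * (pairing b e v * (pairing c f v * g v))) +
    (-1) * (pairing a d v * (pairing b f v * (pairing c e v * g v))) +
    (-1) * (pairing a e v * (pairing b d v * (pairing c f v * g v))) +
    1 * (pairing a e v * (pairing b f v * (pairing c d v * g v))) +
    1 * (pairing a f v * (pairing b d v * (pairing c e v * g v))) +
    (-1) * (pairing a f v * (pairing b e v * (pairing c d v * g v))))"
    by (intro mon_span.add t)
  then show ?thesis by (rule mon_span_cong) (simp_all add: minor_def algebra_simps)
qed

lemma omit_omit: "\<exists>a b c d e f. \<forall>v. omit s v * omit t v = - (1/2) * minor a b c d e f v"
  by (cases s; cases t; simp only: omit_def ix.case triple_triple; blast)

text \<open>If the monomial already contains a triple product, the two are traded for three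
  pairings, whence the bound \<open>k + 3\<close>.\<close>

lemma mon_span_omit:
  assumes "mon_span d k f"
  shows "mon_span (d + 3) (k + 3) (\<lambda>v. omit s v * f v)"
  using assms
proof (induction rule: mon_span.induct)
  case (zero d k)
  show ?case by (simp add: mon_span.zero)
next
  case (add d k f g)
  show ?case using mon_span.add[OF add.IH] by (rule mon_span_cong) (simp_all add: distrib_left)
next
  case (mon i d k c)
  obtain t \<alpha> where i: "i = (t, \<alpha>)" by (cases i)
  show ?case
  proof (cases t)
    case None
    have "mon_span (d + 3) (k + 3) (\<lambda>v. c * invmon (Some s, \<alpha>) v)"
      using mon by (intro mon_span.mon) (auto simp: i None invdeg_def)
    then show ?thesis
      by (rule mon_span_cong) (simp_all add: i None invmon_def omit_opt_def)
  next
    case (Some u)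
    obtain a b c' d' e f where m: "\<And>v. omit s v * omit u v = - (1/2) * minor a b c' d' e f v"
      using omit_omit by blast
    have "mon_span (2 * (\<Sum>p\<in>upper. \<alpha> p)) k (\<lambda>v. 1 * invmon (None, \<alpha>) v)"
      using mon by (intro mon_span.mon) (auto simp: i invdeg_def)
    from mon_span_scale[OF mon_span_minor[OF this, of a b c' d' e f], of "- c / 2"]
    show ?thesis
    proof (rule mon_span_cong)
      show "- c / 2 * (minor a b c' d' e f v * (1 * invmon (None, \<alpha>) v)) = omit s v * (c * invmon i v)" for v
      proof -
        have "omit s v * (c * invmon i v) = c * (omit s v * omit u v) * pmon \<alpha> v"
          by (simp add: i Some invmon_def omit_opt_def)
        also have "\<dots> = - c / 2 * (minor a b c' d' e f v * (1 * invmon (None, \<alpha>) v))"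
          unfolding m by (simp add: invmon_def omit_opt_def)
        finally show ?thesis by simp
      qed
    qed (use mon(2) in \<open>auto simp: i Some invdeg_def\<close>)
  qed
qed

text \<open>The Gram determinant of four vectors in three-space vanishes. Solved for the product of
  the four diagonal pairings, it has at most two diagonal pairings in every other term.\<close>

lemma gram_det:
  fixes v :: "ix sl2pt"
  defines "p \<equiv> \<lambda>a b. pairing a b v"
  shows "p I1 I1 * p I2 I2 * p I3 I3 * p I4 I4 =
      p I1 I1 * p I2 I2 * p I3 I4 * p I3 I4 + p I1 I1 * p I2 I3 * p I2 I3 * p I4 I4
      - 2 * p I1 I1 * p I2 I3 * p I2 I4 * p I3 I4 + p I1 I1 * p I2 I4 * p I2 I4 * p I3 I3
      + p I1 I2 * p I1 I2 * p I3 I3 * p I4 I4 - p I1 I2 * p I1 I2 * p I3 I4 * p I3 I4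
      - 2 * p I1 I2 * p I1 I3 * p I2 I3 * p I4 I4 + 2 * p I1 I2 * p I1 I3 * p I2 I4 * p I3 I4
      + 2 * p I1 I2 * p I1 I4 * p I2 I3 * p I3 I4 - 2 * p I1 I2 * p I1 I4 * p I2 I4 * p I3 I3
      + p I1 I3 * p I1 I3 * p I2 I2 * p I4 I4 - p I1 I3 * p I1 I3 * p I2 I4 * p I2 I4
      - 2 * p I1 I3 * p I1 I4 * p I2 I2 * p I3 I4 + 2 * p I1 I3 * p I1 I4 * p I2 I3 * p I2 I4
      + p I1 I4 * p I1 I4 * p I2 I2 * p I3 I3 - p I1 I4 * p I1 I4 * p I2 I3 * p I2 I3"
    (is "?lhs = ?rhs")
proof -
  have sym: "pairing I2 I1 v = pairing I1 I2 v" "pairing I3 I1 v = pairing I1 I3 v"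
    "pairing I4 I1 v = pairing I1 I4 v" "pairing I3 I2 v = pairing I2 I3 v"
    "pairing I4 I2 v = pairing I2 I4 v" "pairing I4 I3 v = pairing I3 I4 v"
    by (simp_all add: pairing_commute)
  \<comment> \<open>Expansion along the row of \<open>I4\<close>. Each minor is a product of two
    triple products with the common factor \<open>triple I1 I2 I3\<close>; what remains is
    \<open>triple_pairing\<close> at \<open>I4\<close>.\<close>
  have "?lhs - ?rhs = minor I1 I2 I3 I1 I2 I3 v * p I4 I4 - minor I1 I2 I3 I1 I2 I4 v * p I3 I4
      + minor I1 I2 I3 I1 I3 I4 v * p I2 I4 - minor I1 I2 I3 I2 I3 I4 v * p I1 I4"
    unfolding minor_def p_def sym by (simp add: algebra_simps)
  also have "\<dots> = -2 * triple I1 I2 I3 v * (triple I1 I2 I3 v * p I4 I4 - triple I1 I2 I4 v * p I3 I4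
    + triple I1 I3 I4 v * p I2 I4 - triple I2 I3 I4 v * p I1 I4)"
  proof -
    have "minor a b c d e f v = -2 * (triple a b c v * triple d e f v)" for a b c d e f
      by (simp add: triple_triple)
    then show ?thesis by (simp add: algebra_simps)
  qed
  also have "\<dots> = 0" using triple_pairing[of v I4] by (simp add: p_def)
  finally show ?thesis by simp
qed


text \<open>The sign with which \<open>omit s\<close> enters \<open>triple_pairing\<close>.\<close>

definition omit_sign :: "ix \<Rightarrow> complex"
  where "omit_sign s = (if s = I1 \<or> s = I3 then - 1 else 1)"

text \<open>\<open>triple_pairing\<close> at \<open>x = s\<close>, solved for the term of
  \<open>omit s\<close>: the diagonal pairing is traded for off-diagonal ones.\<close>

lemma omit_diag:
  "omit s v * pairing s s v =
    (\<Sum>t\<in>UNIV. (if t = s then 0 else - omit_sign s * omit_sign t) * (pairing t s v * omit t v))"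
proof -
  have "(\<Sum>t\<in>UNIV. omit_sign t * (pairing t s v * omit t v)) = 0"
    using triple_pairing[of v s] by (simp add: sum_ix omit_sign_def omit_def algebra_simps)
  then show ?thesis
    by (cases s) (simp_all add: sum_ix omit_sign_def algebra_simps eq_neg_iff_add_eq_0)
qed

lemma unbump:
  assumes "\<alpha> q > 0"
  shows "(\<lambda>p. (\<alpha> p - unit_at q p) + unit_at q p) = \<alpha>"
  using assms by (auto simp: fun_eq_iff unit_at_def)

text \<open>The relations \<open>omit_diag\<close> and \<open>gram_det\<close> replace a nonstandard monomial by monomials of
  smaller degree in the diagonal pairings.\<close>

lemma mon_span_std_span:
  assumes "mon_span d k f"
  shows "std_span d f"
  using assms
proof (induction k arbitrary: d f rule: less_induct)
  case (less k)
  from less.prems less.IH show ?case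
  proof (induction rule: mon_span.induct)
    case (zero d k)
    show ?case by (rule std_span.zero)
  next
    case (add d k f g)
    then show ?case by (auto intro: std_span.add)
  next
    case (mon i d k c)
    obtain t \<alpha> where i: "i = (t, \<alpha>)" by (cases i)
    have supp: "\<And>p. p \<notin> upper \<Longrightarrow> \<alpha> p = 0" using mon(1) by (auto simp: i)
    show ?case
    proof (cases "i \<in> standard")
      case True
      then show ?thesis using mon(2) by (rule std_span.mon)
    next
      case False
      show ?thesis
      proof (cases t)
        case (Some s)
        with False have pos: "\<alpha> (s, s) > 0" using supp by (auto simp: standard_def i)
        define \<beta> where "\<beta> = (\<lambda>p. \<alpha> p - unit_at (upper_pair s s) p)"
        have \<alpha>: "\<alpha> = (\<lambda>p. \<beta> p + unit_at (upper_pair s s) p)"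
          unfolding \<beta>_def using unbump[of \<alpha> "(s, s)"] pos by (simp only: upper_pair_same)
        have \<beta>supp: "\<forall>p. p \<notin> upper \<longrightarrow> \<beta> p = 0" using supp by (simp add: \<beta>_def)
        have dd: "diagdeg \<alpha> = diagdeg \<beta> + 1" by (subst \<alpha>) (simp only: diagdeg_bump, simp)
        have deg: "invdeg i = invdeg (Some u, \<beta>) + 2" for u
          unfolding i Some by (subst \<alpha>) (simp only: invdeg_def snd_conv fst_conv sum_upper_bump[OF upper_pair_upper], simp)
        have m: "mon_span (d - 2) (diagdeg \<beta>) (\<lambda>v. 1 * invmon (Some u, \<beta>) v)" for u
          using \<beta>supp deg[of u] mon(2) by (intro mon_span.mon) simp_all
        have trm: "mon_span d (diagdeg \<beta>)
            (\<lambda>v. (if u = s then 0 else - omit_sign s * omit_sign u) * (pairing u s v * invmon (Some u, \<beta>) v))" for u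
        proof (cases "u = s")
          case True
          then show ?thesis by (simp add: mon_span.zero)
        next
          case False
          have "d - 2 + 2 = d" using deg[of s] mon(2) by simp
          with False show ?thesis
            by (intro mon_span_scale mon_span_cong[OF mon_span_pairing[OF m[of u], of u s]]) simp_all
        qed
        have "mon_span d (diagdeg \<beta>) (\<lambda>v. c * (\<Sum>u\<in>UNIV.
            (if u = s then 0 else - omit_sign s * omit_sign u) * (pairing u s v * invmon (Some u, \<beta>) v)))"
          unfolding sum_ix by (intro mon_span_scale mon_span.add trm)
        moreover have "(\<Sum>u\<in>UNIV. (if u = s then 0 else - omit_sign s * omit_sign u) *
            (pairing u s v * invmon (Some u, \<beta>) v)) = invmon i v" for v
        proof -
          have "invmon i v = (omit s v * pairing s s v) * pmon \<beta> v"
            unfolding i Some by (subst \<alpha>) (simp only: invmon_def fst_conv snd_conv pmon_bump_pair omit_opt_def option.case mult_ac)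
          then show ?thesis
            unfolding omit_diag sum_distrib_right by (simp add: invmon_def omit_opt_def mult_ac)
        qed
        ultimately have "mon_span d (diagdeg \<beta>) (\<lambda>v. c * invmon i v)" by simp
        moreover have "diagdeg \<beta> < k" using mon(3) dd by (simp add: i)
        ultimately show ?thesis using mon(4) by blast
      next
        case None
        with False have pos: "\<And>s. \<alpha> (s, s) > 0" using supp by (auto simp: standard_def i)
        \<comment> \<open>One factor of each of the four diagonal pairings is split off.\<close>
        define \<beta> where "\<beta> = (\<lambda>p. \<alpha> p - (if fst p = snd p then 1 else 0))"
        have \<alpha>: "\<alpha> = (\<lambda>p. (((\<beta> p + unit_at (upper_pair I4 I4) p) + unit_at (upper_pair I3 I3) p)
            + unit_at (upper_pair I2 I2) p) + unit_at (upper_pair I1 I1) p)"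
        proof
          fix p :: "ix \<times> ix"
          show "\<alpha> p = (((\<beta> p + unit_at (upper_pair I4 I4) p) + unit_at (upper_pair I3 I3) p)
              + unit_at (upper_pair I2 I2) p) + unit_at (upper_pair I1 I1) p"
            using pos[of "fst p"] by (cases p; cases "fst p"; cases "snd p") (simp_all add: \<beta>_def unit_at_def upper_pair_same)
        qed
        have \<beta>supp: "\<forall>p. p \<notin> upper \<longrightarrow> \<beta> p = 0" using supp by (simp add: \<beta>_def)
        have dd: "diagdeg \<alpha> = diagdeg \<beta> + 4"
          by (subst \<alpha>) (simp only: diagdeg_bump, simp)
        have deg: "d = invdeg (None, \<beta>) + 2 + 2 + 2 + 2"
          unfolding mon(2)[symmetric] i None
          by (subst \<alpha>) (simp only: invdeg_def snd_conv fst_conv sum_upper_bump[OF upper_pair_upper], simp)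
        have m: "mon_span (invdeg (None, \<beta>)) (diagdeg \<beta>) (\<lambda>v. 1 * invmon (None, \<beta>) v)"
          using \<beta>supp by (intro mon_span.mon) simp_all
        \<comment> \<open>Covers every term of \<open>gram_det\<close>: four diagonal pairings are
          traded for at most two, so the diagonal degree drops by at least 2.\<close>
        have trm: "mon_span d (diagdeg \<beta> + 2) (\<lambda>v. s * (pairing a1 b1 v * (pairing a2 b2 v *
            (pairing a3 b3 v * (pairing a4 b4 v * pmon \<beta> v)))))"
          if "(if a1 = b1 then 1 else 0) + (if a2 = b2 then 1 else 0) + (if a3 = b3 then 1 else 0)
            + (if a4 = b4 then 1 else 0) \<le> (2::nat)" for s a1 a2 a3 a4 b1 b2 b3 b4
        proof (rule mon_span_cong[OF mon_span_scale[OF mon_span_pairing[OF mon_span_pairing[OF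
              mon_span_pairing[OF mon_span_pairing[OF m, of a4 b4], of a3 b3], of a2 b2], of a1 b1], of s]])
          show "diagdeg \<beta> + (if a4 = b4 then 1 else 0) + (if a3 = b3 then 1 else 0)
              + (if a2 = b2 then 1 else 0) + (if a1 = b1 then 1 else 0) \<le> diagdeg \<beta> + 2"
            using that by linarith
        qed (simp_all add: deg invmon_def omit_opt_def)
        let ?r = "\<lambda>s a1 b1 a2 b2 a3 b3 a4 b4 v. s * (pairing a1 b1 v * (pairing a2 b2 v *
            (pairing a3 b3 v * (pairing a4 b4 v * pmon \<beta> v))))"
        let ?S = "\<lambda>v.
            ?r 1 I1 I1 I2 I2 I3 I4 I3 I4 v + ?r 1 I1 I1 I2 I3 I2 I3 I4 I4 v
            + ?r (-2) I1 I1 I2 I3 I2 I4 I3 I4 v + ?r 1 I1 I1 I2 I4 I2 I4 I3 I3 v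
            + ?r 1 I1 I2 I1 I2 I3 I3 I4 I4 v + ?r (-1) I1 I2 I1 I2 I3 I4 I3 I4 v
            + ?r (-2) I1 I2 I1 I3 I2 I3 I4 I4 v + ?r 2 I1 I2 I1 I3 I2 I4 I3 I4 v
            + ?r 2 I1 I2 I1 I4 I2 I3 I3 I4 v + ?r (-2) I1 I2 I1 I4 I2 I4 I3 I3 v
            + ?r 1 I1 I3 I1 I3 I2 I2 I4 I4 v + ?r (-1) I1 I3 I1 I3 I2 I4 I2 I4 v
            + ?r (-2) I1 I3 I1 I4 I2 I2 I3 I4 v + ?r 2 I1 I3 I1 I4 I2 I3 I2 I4 v
            + ?r 1 I1 I4 I1 I4 I2 I2 I3 I3 v + ?r (-1) I1 I4 I1 I4 I2 I3 I2 I3 v"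
        have "mon_span d (diagdeg \<beta> + 2) (\<lambda>v. c * ?S v)"
          by (rule mon_span_scale, (rule mon_span.add)+) (rule trm, simp)+
        then have "mon_span d (diagdeg \<beta> + 2) (\<lambda>v. c * invmon i v)"
        proof (rule mon_span_cong)
          fix v
          have iv: "invmon i v = (pairing I1 I1 v * pairing I2 I2 v * pairing I3 I3 v * pairing I4 I4 v) * pmon \<beta> v"
            unfolding i None by (subst \<alpha>)
              (simp only: invmon_def fst_conv snd_conv pmon_bump_pair omit_opt_def option.case mult_1_left mult.assoc)
          show "c * ?S v = c * invmon i v"
            unfolding iv[unfolded gram_det] by algebra
        qed simp_all
        moreover have "diagdeg \<beta> + 2 < k" using mon(3) dd by (simp add: i)
        ultimately show ?thesis using mon(4) by blast
      qed
    qed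
  qed
qed

lemma inv_span_mon_span:
  assumes "inv_span D f"
  shows "\<exists>k. mon_span (\<Sum>a\<in>UNIV. D a) k f"
  using assms
proof (induction rule: inv_span.induct)
  case (const c)
  have "mon_span 0 0 (\<lambda>v. c * invmon (None, \<lambda>_. 0) v)"
    by (rule mon_span.mon) (simp_all add: invdeg_def diagdeg_def)
  then show ?case by (intro exI[of _ 0]) (simp add: invmon_def omit_opt_def pmon_def)
next
  case (zero D)
  show ?case by (auto intro: mon_span.zero)
next
  case (add D f g)
  then obtain k l where "mon_span (\<Sum>a\<in>UNIV. D a) k f" "mon_span (\<Sum>a\<in>UNIV. D a) l g" by blast
  then have "mon_span (\<Sum>a\<in>UNIV. D a) (max k l) f" "mon_span (\<Sum>a\<in>UNIV. D a) (max k l) g"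
    by (simp_all add: mon_span_cong[OF _ refl max.cobounded1 refl] mon_span_cong[OF _ refl max.cobounded2 refl])
  then show ?case by (blast intro: mon_span.add)
next
  case (pairing D f a b)
  then obtain k where "mon_span (\<Sum>a\<in>UNIV. D a) k f" by blast
  from mon_span_pairing_weak[OF this, of a b] show ?case
    by (intro exI) (simp add: sum.distrib sum_unit_at)
next
  case (omit D f s)
  then obtain k where "mon_span (\<Sum>a\<in>UNIV. D a) k f" by blast
  moreover have "(\<Sum>c\<in>UNIV. if c = s then 0 else 1 :: nat) = 3"
    by (cases s) (simp_all add: sum_ix)
  ultimately show ?case using mon_span_omit[of "\<Sum>a\<in>UNIV. D a" k f s]
    by (intro exI) (simp add: sum.distrib)
qed

theorem std_span_invariants:
  assumes "polyf f" "homog D f" "\<And>g t v. f (flow g t v) = f v"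
  shows "std_span (\<Sum>a\<in>UNIV. D a) f"
  using inv_span_mon_span[OF inv_span_invariants[OF assms]] mon_span_std_span by blast

section \<open>Independence of the standard monomials\<close>

text \<open>Coordinates in which \<open>pairing\<close> is twice the standard bilinear form.\<close>

definition vecpt :: "('n \<Rightarrow> complex) \<Rightarrow> ('n \<Rightarrow> complex) \<Rightarrow> ('n \<Rightarrow> complex) \<Rightarrow> 'n sl2pt"
  where "vecpt x y z = (\<lambda>(a, g). case g of Hz \<Rightarrow> x a | Ep \<Rightarrow> y a + \<i> * z a | Fm \<Rightarrow> y a - \<i> * z a)"

lemma pairing_vecpt: "pairing a b (vecpt x y z) = 2 * (x a * x b + y a * y b + z a * z b)"
  by (simp add: pairing_def vecpt_def algebra_simps)

lemma triple_vecpt: "triple a b c (vecpt x y z) = - 2 * \<i> *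
    (x a * (y b * z c - z b * y c) - x b * (y a * z c - z a * y c) + x c * (y a * z b - z a * y b))"
  by (simp add: triple_def vecpt_def algebra_simps)

text \<open>The growth exponent of the pairing of \<open>i\<close> and \<open>j\<close>: only the
  three large vectors have growing squares.\<close>

definition wt :: "ix \<Rightarrow> ix \<Rightarrow> ix \<Rightarrow> nat"
  where "wt s i j = (if i = j \<and> i \<noteq> s then 2 else 0)"

text \<open>Three of the vectors become large and nearly orthogonal, the fourth becomes small, such that
  the mixed pairings converge to prescribed values.\<close>

definition degenerates :: "ix \<Rightarrow> (ix \<Rightarrow> ix \<Rightarrow> complex) \<Rightarrow> (nat \<Rightarrow> ix sl2pt) \<Rightarrow> complex \<Rightarrow> bool"
  where "degenerates s L v l \<longleftrightarrow> l \<noteq> 0 \<and>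
    (\<forall>i j. (\<lambda>n. pairing i j (v n) / of_nat (Suc n) ^ wt s i j) \<longlonglongrightarrow>
      (if i = s \<and> j = s then 0 else L i j)) \<and>
    (\<forall>t. (\<lambda>n. omit t (v n) / of_nat (Suc n) ^ 3) \<longlonglongrightarrow> (if t = s then l else 0))"

lemma eps_tendsto: "(\<lambda>n. 1 / of_nat (Suc n) :: complex) \<longlonglongrightarrow> 0"
  using LIMSEQ_Suc[OF lim_1_over_n[where 'a = complex]] by simp

text \<open>The three large vectors form a triangular array with entries of size
  \<open>\<tau>\<close> on the diagonal and \<open>\<epsilon> = 1 / \<tau>\<close> on one side of
  it; all entries of the fourth vector have size \<open>\<epsilon>\<close>. A mixed pairing is then
  one product of a large and a small entry, constant in \<open>n\<close>, plus terms of order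
  \<open>\<epsilon> ^ 2\<close>, so the entries can be solved for one at a time.\<close>

lemma degenerates_I4:
  assumes L: "\<And>i j. L i j = L j i" "\<And>i j. L i j \<noteq> 0"
  shows "\<exists>v l. degenerates I4 L v l"
proof -
  define a b c where "a = csqrt (L I1 I1 / 2)" and "b = csqrt (L I2 I2 / 2)" and "c = csqrt (L I3 I3 / 2)"
  have sq: "2 * (a * a) = L I1 I1" "2 * (b * b) = L I2 I2" "2 * (c * c) = L I3 I3"
    unfolding a_def b_def c_def power2_eq_square[symmetric] by simp_all
  have nz: "a \<noteq> 0" "b \<noteq> 0" "c \<noteq> 0"
    using L(2)[of I1 I1] L(2)[of I2 I2] L(2)[of I3 I3] by (auto simp flip: sq)
  define p q x where "p = L I1 I2 / (2 * a)" and "q = L I1 I3 / (2 * a)" and "x = L I1 I4 / (2 * a)"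
  define r y where "r = L I2 I3 / (2 * b)" and "y = L I2 I4 / (2 * b)"
  define z where "z = L I3 I4 / (2 * c)"
  have mixed: "2 * (a * p) = L I1 I2" "2 * (a * q) = L I1 I3" "2 * (a * x) = L I1 I4"
    "2 * (b * r) = L I2 I3" "2 * (b * y) = L I2 I4" "2 * (c * z) = L I3 I4"
    using nz by (simp_all add: p_def q_def x_def r_def y_def z_def)
  define \<tau> :: "nat \<Rightarrow> complex" where "\<tau> = (\<lambda>n. of_nat (Suc n))"
  define \<epsilon> :: "nat \<Rightarrow> complex" where "\<epsilon> = (\<lambda>n. 1 / of_nat (Suc n))"
  have \<tau>\<epsilon>: "\<tau> n * \<epsilon> n = 1" "\<tau> n \<noteq> 0" for n
    unfolding \<tau>_def \<epsilon>_def by (simp_all del: of_nat_Suc)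
  have \<epsilon>: "\<epsilon> \<longlonglongrightarrow> 0" unfolding \<epsilon>_def by (rule eps_tendsto)
  have lim: "(\<lambda>n. A + B * \<epsilon> n ^ Suc k) \<longlonglongrightarrow> A" for A B k
    using tendsto_add[OF tendsto_const tendsto_mult[OF tendsto_const tendsto_power[OF \<epsilon>]], of A B "Suc k"]
    by simp
  have lim': "f \<longlonglongrightarrow> A" if "\<And>n. f n = A + B * \<epsilon> n ^ Suc k" for f A B k
  proof -
    have "f = (\<lambda>n. A + B * \<epsilon> n ^ Suc k)" using that by blast
    then show ?thesis using lim by simp
  qed
  define v where "v = (\<lambda>n. vecpt
    (\<lambda>i. case i of I1 \<Rightarrow> a * \<tau> n | I2 \<Rightarrow> p * \<epsilon> n | I3 \<Rightarrow> q * \<epsilon> n | I4 \<Rightarrow> x * \<epsilon> n)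
    (\<lambda>i. case i of I1 \<Rightarrow> 0 | I2 \<Rightarrow> b * \<tau> n | I3 \<Rightarrow> r * \<epsilon> n | I4 \<Rightarrow> y * \<epsilon> n)
    (\<lambda>i. case i of I1 \<Rightarrow> 0 | I2 \<Rightarrow> 0 | I3 \<Rightarrow> c * \<tau> n | I4 \<Rightarrow> z * \<epsilon> n))"
  have \<tau>\<epsilon>': "\<epsilon> n = 1 / \<tau> n" for n using \<tau>\<epsilon>[of n] by (simp add: field_simps)
  have 1: "(\<lambda>n. pairing i j (v n) / \<tau> n ^ wt I4 i j) \<longlonglongrightarrow> (if i = I4 \<and> j = I4 then 0 else L i j)"
    if "(i, j) \<in> upper" for i j
  proof -
    have 11: "(\<lambda>n. pairing I1 I1 (v n) / \<tau> n ^ wt I4 I1 I1) \<longlonglongrightarrow> L I1 I1"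
      by (rule lim'[of _ _ 0 0])
         (use \<tau>\<epsilon> in \<open>simp add: v_def pairing_vecpt wt_def \<tau>\<epsilon>' field_simps power2_eq_square flip: sq\<close>)
    have 22: "(\<lambda>n. pairing I2 I2 (v n) / \<tau> n ^ wt I4 I2 I2) \<longlonglongrightarrow> L I2 I2"
      by (rule lim'[of _ _ "2 * (p * p)" 3])
         (use \<tau>\<epsilon> in \<open>simp add: v_def pairing_vecpt wt_def \<tau>\<epsilon>' field_simps power2_eq_square eval_nat_numeral flip: sq\<close>)
    have 33: "(\<lambda>n. pairing I3 I3 (v n) / \<tau> n ^ wt I4 I3 I3) \<longlonglongrightarrow> L I3 I3"
      by (rule lim'[of _ _ "2 * (q * q + r * r)" 3])
         (use \<tau>\<epsilon> in \<open>simp add: v_def pairing_vecpt wt_def \<tau>\<epsilon>' field_simps power2_eq_square eval_nat_numeral flip: sq\<close>)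
    have 44: "(\<lambda>n. pairing I4 I4 (v n) / \<tau> n ^ wt I4 I4 I4) \<longlonglongrightarrow> 0"
      by (rule lim'[of _ _ "2 * (x * x + y * y + z * z)" 1])
         (use \<tau>\<epsilon> in \<open>simp add: v_def pairing_vecpt wt_def \<tau>\<epsilon>' field_simps power2_eq_square\<close>)
    have 12: "(\<lambda>n. pairing I1 I2 (v n) / \<tau> n ^ wt I4 I1 I2) \<longlonglongrightarrow> L I1 I2"
      by (rule lim'[of _ _ 0 0])
         (use \<tau>\<epsilon> in \<open>simp add: v_def pairing_vecpt wt_def \<tau>\<epsilon>' field_simps power2_eq_square flip: mixed\<close>)
    have 13: "(\<lambda>n. pairing I1 I3 (v n) / \<tau> n ^ wt I4 I1 I3) \<longlonglongrightarrow> L I1 I3"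
      by (rule lim'[of _ _ 0 0])
         (use \<tau>\<epsilon> in \<open>simp add: v_def pairing_vecpt wt_def \<tau>\<epsilon>' field_simps power2_eq_square flip: mixed\<close>)
    have 14: "(\<lambda>n. pairing I1 I4 (v n) / \<tau> n ^ wt I4 I1 I4) \<longlonglongrightarrow> L I1 I4"
      by (rule lim'[of _ _ 0 0])
         (use \<tau>\<epsilon> in \<open>simp add: v_def pairing_vecpt wt_def \<tau>\<epsilon>' field_simps power2_eq_square flip: mixed\<close>)
    have 23: "(\<lambda>n. pairing I2 I3 (v n) / \<tau> n ^ wt I4 I2 I3) \<longlonglongrightarrow> L I2 I3"
      by (rule lim'[of _ _ "2 * p * q" 1])
         (use \<tau>\<epsilon> in \<open>simp add: v_def pairing_vecpt wt_def \<tau>\<epsilon>' field_simps power2_eq_square flip: mixed\<close>)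
    have 24: "(\<lambda>n. pairing I2 I4 (v n) / \<tau> n ^ wt I4 I2 I4) \<longlonglongrightarrow> L I2 I4"
      by (rule lim'[of _ _ "2 * p * x" 1])
         (use \<tau>\<epsilon> in \<open>simp add: v_def pairing_vecpt wt_def \<tau>\<epsilon>' field_simps power2_eq_square flip: mixed\<close>)
    have 34: "(\<lambda>n. pairing I3 I4 (v n) / \<tau> n ^ wt I4 I3 I4) \<longlonglongrightarrow> L I3 I4"
      by (rule lim'[of _ _ "2 * (q * x + r * y)" 1])
         (use \<tau>\<epsilon> in \<open>simp add: v_def pairing_vecpt wt_def \<tau>\<epsilon>' field_simps power2_eq_square flip: mixed\<close>)
    show ?thesis
      using that 11 22 33 44 12 13 14 23 24 34 unfolding upper_def by auto
  qed
  have 1: "(\<lambda>n. pairing i j (v n) / \<tau> n ^ wt I4 i j) \<longlonglongrightarrow> (if i = I4 \<and> j = I4 then 0 else L i j)" for i j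
  proof (cases "(i, j) \<in> upper")
    case True
    then show ?thesis by (rule 1)
  next
    case False
    then have "(j, i) \<in> upper" by (cases i; cases j) (simp_all add: upper_def)
    have sym: "pairing j i = pairing i j" "wt I4 j i = wt I4 i j" "L j i = L i j"
      "(j = I4 \<and> i = I4) = (i = I4 \<and> j = I4)"
      by (rule pairing_commute) (auto simp: wt_def L(1)[of j i])
    from 1[OF \<open>(j, i) \<in> upper\<close>] show ?thesis by (simp only: sym)
  qed
  have lim3: "f \<longlonglongrightarrow> A" if "\<And>n. f n = A + B * \<epsilon> n ^ 2 + C * \<epsilon> n ^ 4 + D * \<epsilon> n ^ 6" for f A B C D
  proof -
    have "(\<lambda>n. A + B * \<epsilon> n ^ 2 + C * \<epsilon> n ^ 4 + D * \<epsilon> n ^ 6) \<longlonglongrightarrow> A + B * 0 ^ 2 + C * 0 ^ 4 + D * 0 ^ 6"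
      by (intro tendsto_intros \<epsilon>)
    moreover have "f = (\<lambda>n. A + B * \<epsilon> n ^ 2 + C * \<epsilon> n ^ 4 + D * \<epsilon> n ^ 6)" using that by blast
    ultimately show ?thesis by simp
  qed
  \<comment> \<open>The triple product of the three large vectors has a leading term of size
    \<open>\<tau> ^ 3\<close>; every other one involves the small vector.\<close>
  have 2: "(\<lambda>n. omit t (v n) / \<tau> n ^ 3) \<longlonglongrightarrow> (if t = I4 then - 2 * \<i> * (a * b * c) else 0)" for t
  proof -
    have "(\<lambda>n. omit I1 (v n) / \<tau> n ^ 3) \<longlonglongrightarrow> 0"
      by (rule lim3[of _ _ "- 2 * \<i> * (x * b * c)" "2 * \<i> * (p * c * y + q * b * z)" "- 2 * \<i> * (p * r * z)"])
         (use \<tau>\<epsilon> in \<open>simp add: v_def omit_def triple_vecpt \<tau>\<epsilon>' field_simps eval_nat_numeral\<close>)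
    moreover have "(\<lambda>n. omit I2 (v n) / \<tau> n ^ 3) \<longlonglongrightarrow> 0"
      by (rule lim3[of _ _ "2 * \<i> * (a * c * y)" "- 2 * \<i> * (a * r * z)" 0])
         (use \<tau>\<epsilon> in \<open>simp add: v_def omit_def triple_vecpt \<tau>\<epsilon>' field_simps eval_nat_numeral\<close>)
    moreover have "(\<lambda>n. omit I3 (v n) / \<tau> n ^ 3) \<longlonglongrightarrow> 0"
      by (rule lim3[of _ _ "- 2 * \<i> * (a * b * z)" 0 0])
         (use \<tau>\<epsilon> in \<open>simp add: v_def omit_def triple_vecpt \<tau>\<epsilon>' field_simps eval_nat_numeral\<close>)
    moreover have "(\<lambda>n. omit I4 (v n) / \<tau> n ^ 3) \<longlonglongrightarrow> - 2 * \<i> * (a * b * c)"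
      by (rule lim3[of _ _ 0 0 0])
         (use \<tau>\<epsilon> in \<open>simp add: v_def omit_def triple_vecpt \<tau>\<epsilon>' field_simps eval_nat_numeral\<close>)
    ultimately show ?thesis by (cases t) simp_all
  qed
  have "degenerates I4 L v (- 2 * \<i> * (a * b * c))"
    unfolding degenerates_def \<tau>_def[symmetric, THEN fun_cong] using 1 2 nz
    by (simp add: \<tau>_def del: of_nat_Suc)
  then show ?thesis by blast
qed

lemma degenerates_exists:
  assumes L: "\<And>i j. L i j = L j i" "\<And>i j. L i j \<noteq> 0"
  shows "\<exists>v l. degenerates s L v l"
proof -
  \<comment> \<open>The transposition of \<open>s\<close> and \<open>I4\<close>; permuting the
    indices changes a triple product at most by a sign.\<close>
  define \<pi> where "\<pi> = (\<lambda>i. if i = s then I4 else if i = I4 then s else i)"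
  have \<pi>\<pi>: "\<pi> (\<pi> i) = i" for i by (auto simp: \<pi>_def)
  obtain v l where v: "degenerates I4 (\<lambda>i j. L (\<pi> i) (\<pi> j)) v l"
    using degenerates_I4[of "\<lambda>i j. L (\<pi> i) (\<pi> j)"] L by blast
  define w where "w = (\<lambda>n (a, g). v n (\<pi> a, g))"
  have pw: "pairing i j (w n) = pairing (\<pi> i) (\<pi> j) (v n)" for i j n
    by (simp add: pairing_def w_def)
  have ow: "\<exists>\<sigma>. \<sigma> \<noteq> 0 \<and> (\<forall>n. omit t (w n) = \<sigma> * omit (\<pi> t) (v n))" for t
  proof -
    have "(\<forall>n. omit t (w n) = 1 * omit (\<pi> t) (v n)) \<or> (\<forall>n. omit t (w n) = - 1 * omit (\<pi> t) (v n))"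
      by (cases s; cases t) (simp_all add: \<pi>_def omit_def triple_def w_def algebra_simps)
    then show ?thesis by (metis one_neq_zero neg_equal_0_iff_equal)
  qed
  define \<sigma> where "\<sigma> = (\<lambda>t. SOME \<sigma>. \<sigma> \<noteq> 0 \<and> (\<forall>n. omit t (w n) = \<sigma> * omit (\<pi> t) (v n)))"
  have \<sigma>: "\<sigma> t \<noteq> 0" "omit t (w n) = \<sigma> t * omit (\<pi> t) (v n)" for t n
    using someI_ex[OF ow[of t]] unfolding \<sigma>_def by blast+
  have wt\<pi>: "wt I4 (\<pi> i) (\<pi> j) = wt s i j" for i j
    by (auto simp: wt_def \<pi>_def)
  have \<pi>I4: "\<pi> i = I4 \<longleftrightarrow> i = s" for i
    by (auto simp: \<pi>_def)
  have "(\<lambda>n. pairing i j (w n) / of_nat (Suc n) ^ wt s i j) \<longlonglongrightarrow> (if i = s \<and> j = s then 0 else L i j)" for i j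
  proof -
    have "(\<lambda>n. pairing (\<pi> i) (\<pi> j) (v n) / of_nat (Suc n) ^ wt I4 (\<pi> i) (\<pi> j)) \<longlonglongrightarrow>
        (if \<pi> i = I4 \<and> \<pi> j = I4 then 0 else L (\<pi> (\<pi> i)) (\<pi> (\<pi> j)))"
      using v unfolding degenerates_def by blast
    then show ?thesis by (simp only: pw wt\<pi> \<pi>I4 \<pi>\<pi>)
  qed
  moreover have "(\<lambda>n. omit t (w n) / of_nat (Suc n) ^ 3) \<longlonglongrightarrow> (if t = s then \<sigma> s * l else 0)" for t
  proof -
    have "(\<lambda>n. omit (\<pi> t) (v n) / of_nat (Suc n) ^ 3) \<longlonglongrightarrow> (if \<pi> t = I4 then l else 0)"
      using v unfolding degenerates_def by blast
    from tendsto_mult[OF tendsto_const this, of "\<sigma> t"] show ?thesis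
      by (simp only: \<sigma>(2) \<pi>I4 times_divide_eq_right) (simp split: if_splits)
  qed
  moreover have "\<sigma> s * l \<noteq> 0" using \<sigma>(1) v by (simp add: degenerates_def)
  ultimately have "degenerates s L w (\<sigma> s * l)" unfolding degenerates_def by blast
  then show ?thesis by blast
qed

lemma prod_wt: "(\<Prod>p\<in>upper. (t ^ wt s (fst p) (snd p)) ^ \<alpha> p) = (t :: complex) ^ (2 * (diagdeg \<alpha> - \<alpha> (s, s)))"
  by (cases s) (simp_all add: upper_def wt_def diagdeg_def sum_ix power_mult power_add)

lemma inverse_power_tendsto:
  "k > 0 \<Longrightarrow> (\<lambda>n. 1 / of_nat (Suc n) ^ k :: complex) \<longlonglongrightarrow> 0"
  using tendsto_power[OF eps_tendsto, of k] by (simp add: power_divide zero_power del: of_nat_Suc)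

definition weight :: "ix option \<times> (ix \<times> ix \<Rightarrow> nat) \<Rightarrow> nat"
  where "weight i = (if fst i = None then 0 else 3) + 2 * diagdeg (snd i)"

text \<open>The monomial has a limit after division by the power
  \<open>2 * (diagdeg \<alpha> - \<alpha> (s, s))\<close> of the scale. A factor \<open>P_ss\<close>
  lowers this exponent below \<open>2 * diagdeg \<alpha>\<close>, and any larger \<open>k\<close>
  forces the limit 0.\<close>

lemma pmon_tendsto:
  assumes v: "degenerates s L v l" and k: "2 * diagdeg \<alpha> \<le> k"
  shows "(\<lambda>n. pmon \<alpha> (v n) / of_nat (Suc n) ^ k) \<longlonglongrightarrow>
    (if k = 2 * diagdeg \<alpha> \<and> \<alpha> (s, s) = 0 then \<Prod>p\<in>upper. L (fst p) (snd p) ^ \<alpha> p else 0)"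
proof -
  let ?\<tau> = "\<lambda>n. of_nat (Suc n) :: complex"
  define m where "m = 2 * (diagdeg \<alpha> - \<alpha> (s, s))"
  have le: "\<alpha> (s, s) \<le> diagdeg \<alpha>"
    unfolding diagdeg_def by (cases s) (simp_all add: sum_ix)
  have "(\<lambda>n. \<Prod>p\<in>upper. (pairing (fst p) (snd p) (v n) / ?\<tau> n ^ wt s (fst p) (snd p)) ^ \<alpha> p) \<longlonglongrightarrow>
      (\<Prod>p\<in>upper. (if fst p = s \<and> snd p = s then 0 else L (fst p) (snd p)) ^ \<alpha> p)"
    using v unfolding degenerates_def by (intro tendsto_prod tendsto_power) blast
  moreover have "(\<Prod>p\<in>upper. (pairing (fst p) (snd p) (v n) / ?\<tau> n ^ wt s (fst p) (snd p)) ^ \<alpha> p) =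
      pmon \<alpha> (v n) / ?\<tau> n ^ m" for n
    by (simp only: power_divide prod_dividef prod_wt pmon_def m_def)
  ultimately have lim: "(\<lambda>n. pmon \<alpha> (v n) / ?\<tau> n ^ m) \<longlonglongrightarrow>
      (\<Prod>p\<in>upper. (if fst p = s \<and> snd p = s then 0 else L (fst p) (snd p)) ^ \<alpha> p)"
    by simp
  show ?thesis
  proof (cases "k = m")
    case True
    then have "k = 2 * diagdeg \<alpha>" "\<alpha> (s, s) = 0" using k le by (auto simp: m_def)
    moreover from this have "(\<Prod>p\<in>upper. (if fst p = s \<and> snd p = s then 0 else L (fst p) (snd p)) ^ \<alpha> p) =
        (\<Prod>p\<in>upper. L (fst p) (snd p) ^ \<alpha> p)"
      by (intro prod.cong) auto
    ultimately show ?thesis using lim True by simp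
  next
    case False
    then have less: "m < k" using k by (auto simp: m_def)
    have "pmon \<alpha> (v n) / ?\<tau> n ^ k = pmon \<alpha> (v n) / ?\<tau> n ^ m * (1 / ?\<tau> n ^ (k - m))" for n
      using less by (simp flip: power_add del: of_nat_Suc)
    moreover have "(\<lambda>n. pmon \<alpha> (v n) / ?\<tau> n ^ m * (1 / ?\<tau> n ^ (k - m))) \<longlonglongrightarrow>
      (\<Prod>p\<in>upper. (if fst p = s \<and> snd p = s then 0 else L (fst p) (snd p)) ^ \<alpha> p) * 0"
      using less by (intro tendsto_mult lim inverse_power_tendsto) simp
    moreover have "\<not> (k = 2 * diagdeg \<alpha> \<and> \<alpha> (s, s) = 0)"
      using less by (auto simp: m_def)
    ultimately show ?thesis by (simp only: mult_zero_right if_False)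
  qed
qed

lemma invmon_tendsto:
  assumes v: "degenerates s L v l" and k: "weight i \<le> k"
  shows "(\<lambda>n. invmon i (v n) / of_nat (Suc n) ^ k) \<longlonglongrightarrow>
    (if k = weight i \<and> snd i (s, s) = 0 \<and> fst i \<in> {None, Some s}
     then (if fst i = None then 1 else l) * (\<Prod>p\<in>upper. L (fst p) (snd p) ^ snd i p) else 0)"
proof (cases "fst i")
  case None
  then show ?thesis
    using pmon_tendsto[OF v, of "snd i" k] k
    by (cases "k = 2 * diagdeg (snd i) \<and> snd i (s, s) = 0")
       (auto simp: invmon_def omit_opt_def weight_def simp del: of_nat_Suc)
next
  case (Some t)
  let ?\<tau> = "\<lambda>n. of_nat (Suc n) :: complex"
  have k3: "k = 3 + (k - 3)" "2 * diagdeg (snd i) \<le> k - 3"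
    using k Some by (auto simp: weight_def)
  have "(\<lambda>n. omit t (v n) / ?\<tau> n ^ 3) \<longlonglongrightarrow> (if t = s then l else 0)"
    using v unfolding degenerates_def by blast
  from tendsto_mult[OF this pmon_tendsto[OF v k3(2)]]
  have "(\<lambda>n. omit t (v n) / ?\<tau> n ^ 3 * (pmon (snd i) (v n) / ?\<tau> n ^ (k - 3))) \<longlonglongrightarrow>
    (if t = s then l else 0) * (if k - 3 = 2 * diagdeg (snd i) \<and> snd i (s, s) = 0
      then \<Prod>p\<in>upper. L (fst p) (snd p) ^ snd i p else 0)" .
  moreover have "omit t (v n) / ?\<tau> n ^ 3 * (pmon (snd i) (v n) / ?\<tau> n ^ (k - 3)) =
      invmon i (v n) / ?\<tau> n ^ k" for n
    by (subst (2) k3(1)) (simp add: power_add invmon_def omit_opt_def Some del: of_nat_Suc)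
  ultimately show ?thesis using k3(1) Some by (auto simp: weight_def split: if_splits)
qed

text \<open>For a term of top weight, standardness supplies an index \<open>s\<close> whose
  degeneration keeps that term alive in the limit.\<close>

theorem invmon_independent:
  assumes J: "finite J" "J \<subseteq> standard" and zero: "\<And>v. (\<Sum>i\<in>J. c i * invmon i v) = 0"
    and i: "i \<in> J"
  shows "c i = 0"
proof (rule ccontr)
  assume "c i \<noteq> 0"
  define J' where "J' = {i \<in> J. c i \<noteq> 0}"
  have J': "finite J'" "J' \<noteq> {}" using J(1) i \<open>c i \<noteq> 0\<close> unfolding J'_def by (simp, blast)
  have zero': "(\<Sum>i\<in>J'. c i * invmon i v) = 0" for v
  proof -
    have "(\<Sum>i\<in>J'. c i * invmon i v) = (\<Sum>i\<in>J. c i * invmon i v)"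
      by (rule sum.mono_neutral_left) (auto simp: J(1) J'_def)
    then show ?thesis by (simp add: zero)
  qed
  define k where "k = Max (weight ` J')"
  have k: "weight j \<le> k" if "j \<in> J'" for j
    unfolding k_def using J' that by auto
  have "k \<in> weight ` J'" unfolding k_def using J' by (intro Max_in) simp_all
  then obtain i0 where i0: "i0 \<in> J'" "weight i0 = k" by blast
  obtain s where s: "snd i0 (s, s) = 0" "fst i0 \<in> {None, Some s}"
  proof -
    have std: "i0 \<in> standard" using i0(1) J(2) by (auto simp: J'_def)
    show ?thesis
    proof (cases "fst i0")
      case None
      then obtain s where "snd i0 (s, s) = 0" using std by (auto simp: standard_def)
      then show ?thesis using None that by simp
    next
      case (Some s)
      then have "snd i0 (s, s) = 0" using std by (auto simp: standard_def)
      then show ?thesis using Some that by simp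
    qed
  qed
  define T where "T = {j \<in> J'. k = weight j \<and> snd j (s, s) = 0 \<and> fst j \<in> {None, Some s}}"
  \<comment> \<open>The parity of the weight tells whether there is a triple product, and in
    \<open>T\<close> it can only be \<open>omit s\<close>.\<close>
  have fstT: "fst j = fst i0" if "j \<in> T" for j
  proof -
    have "weight j = weight i0" using that i0 by (simp add: T_def)
    then have "even (weight j) = even (weight i0)" by simp
    then have "(fst j = None) = (fst i0 = None)" by (simp add: weight_def split: if_splits)
    then show ?thesis using that s(2) by (auto simp: T_def)
  qed
  have inj: "inj_on snd T"
    by (intro inj_onI prod_eqI) (simp_all add: fstT)
  have "c (fst i0, \<alpha>) = 0" if "\<alpha> \<in> snd ` T" for \<alpha>
  proof (rule monomials_indep[OF _ _ that])
    show "finite (snd ` T)" using J'(1) by (simp add: T_def)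
    fix u :: "ix \<times> ix \<Rightarrow> complex" assume u: "\<And>p. u p \<noteq> 0"
    \<comment> \<open>The limits of the pairings are free nonzero parameters, so the limiting
      relation is a relation between monomials in them.\<close>
    define L where "L = (\<lambda>i j. u (upper_pair i j))"
    have "upper_pair i j = upper_pair j i" for i j
      by (cases i; cases j) (simp_all add: upper_pair_def upper_def)
    then obtain v l where v: "degenerates s L v l"
      using degenerates_exists[of L s] u by (metis L_def)
    have l: "l \<noteq> 0" using v by (simp add: degenerates_def)
    have prodL: "(\<Prod>p\<in>upper. L (fst p) (snd p) ^ snd j p) = (\<Prod>p\<in>UNIV. u p ^ snd j p)" if "j \<in> T" for j
    proof -
      have "(\<Prod>p\<in>upper. L (fst p) (snd p) ^ snd j p) = (\<Prod>p\<in>upper. u p ^ snd j p)"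
        by (rule prod.cong) (simp_all add: L_def upper_pair_def)
      also have "\<dots> = (\<Prod>p\<in>UNIV. u p ^ snd j p)"
        using that J(2) by (intro prod.mono_neutral_left) (auto simp: T_def J'_def standard_def)
      finally show ?thesis .
    qed
    let ?lim = "\<lambda>j. if k = weight j \<and> snd j (s, s) = 0 \<and> fst j \<in> {None, Some s}
      then (if fst j = None then 1 else l) * (\<Prod>p\<in>upper. L (fst p) (snd p) ^ snd j p) else 0"
    let ?l = "if fst i0 = None then 1 else l"
    have "(\<lambda>n. \<Sum>j\<in>J'. c j * (invmon j (v n) / of_nat (Suc n) ^ k)) \<longlonglongrightarrow>
      (\<Sum>j\<in>J'. c j * ?lim j)"
      using invmon_tendsto[OF v k] by (intro tendsto_sum tendsto_mult tendsto_const) blast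
    moreover have "(\<Sum>j\<in>J'. c j * (invmon j (v n) / of_nat (Suc n) ^ k)) = 0" for n
      using zero'[of "v n"] by (simp flip: sum_divide_distrib del: of_nat_Suc)
    ultimately have "(\<Sum>j\<in>J'. c j * ?lim j) = 0"
      by (simp only: LIMSEQ_const_iff)
    also have "(\<Sum>j\<in>J'. c j * ?lim j) =
      (\<Sum>j\<in>T. c j * (?l * (\<Prod>p\<in>UNIV. u p ^ snd j p)))"
    proof (rule sum.mono_neutral_cong_right[OF J'(1)])
      show "T \<subseteq> J'" unfolding T_def by blast
      show "\<forall>j\<in>J' - T. c j * ?lim j = 0"
      proof
        fix j assume "j \<in> J' - T"
        then have "\<not> (k = weight j \<and> snd j (s, s) = 0 \<and> fst j \<in> {None, Some s})"
          unfolding T_def by blast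
        then show "c j * ?lim j = 0"
          by (simp only: if_False mult_zero_right)
      qed
      fix j assume j: "j \<in> T"
      then have "k = weight j \<and> snd j (s, s) = 0 \<and> fst j \<in> {None, Some s}"
        unfolding T_def by blast
      then show "c j * ?lim j =
          c j * (?l * (\<Prod>p\<in>UNIV. u p ^ snd j p))"
        by (simp only: if_True simp_thms prodL[OF j] fstT[OF j])
    qed
    also have "\<dots> = ?l * (\<Sum>j\<in>T. c j * (\<Prod>p\<in>UNIV. u p ^ snd j p))"
      by (simp add: sum_distrib_left mult.left_commute)
    finally have "(\<Sum>j\<in>T. c j * (\<Prod>p\<in>UNIV. u p ^ snd j p)) = 0" using l by (auto split: if_splits)
    also have "(\<Sum>j\<in>T. c j * (\<Prod>p\<in>UNIV. u p ^ snd j p)) =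
        (\<Sum>\<alpha>\<in>snd ` T. c (fst i0, \<alpha>) * (\<Prod>p\<in>UNIV. u p ^ \<alpha> p))"
      unfolding sum.reindex[OF inj] by (rule sum.cong) (simp_all add: fstT[symmetric])
    finally show "(\<Sum>\<alpha>\<in>snd ` T. c (fst i0, \<alpha>) * (\<Prod>p\<in>UNIV. u p ^ \<alpha> p)) = 0" .
  qed
  moreover have "i0 \<in> T" using i0 s by (simp add: T_def)
  ultimately have "c i0 = 0" by (metis image_eqI prod.collapse)
  then show False using i0 by (simp add: J'_def)
qed

section \<open>A Poincare-Birkhoff-Witt basis\<close>

definition sl2_gen :: "gen \<Rightarrow> sl2"
  where "sl2_gen g = (case g of Ep \<Rightarrow> sl2_e 1 2 | Hz \<Rightarrow> sl2_e 1 1 | Fm \<Rightarrow> sl2_e 2 1)"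

lift_definition coordE :: "sl2 \<Rightarrow> complex" is "\<lambda>A. A $ 1 $ 2" .
text \<open>\<open>e_11\<close> is the matrix with diagonal \<open>1/2, - 1/2\<close>, hence the
  factor 2.\<close>

lift_definition coordH :: "sl2 \<Rightarrow> complex" is "\<lambda>A. 2 * A $ 1 $ 1" .
lift_definition coordF :: "sl2 \<Rightarrow> complex" is "\<lambda>A. A $ 2 $ 1" .

lemma coord_add:
  "coordE (x + y) = coordE x + coordE y" "coordH (x + y) = coordH x + coordH y"
  "coordF (x + y) = coordF x + coordF y"
  by (transfer; simp)+

lemma coord_scaleC:
  "coordE (c *\<^sub>C x) = c * coordE x" "coordH (c *\<^sub>C x) = c * coordH x"
  "coordF (c *\<^sub>C x) = c * coordF x"
  by (transfer; simp)+

lemma coord_bracket: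
  "coordE (bracket x y) = coordH x * coordE y - coordH y * coordE x"
  "coordH (bracket x y) = 2 * (coordE x * coordF y - coordE y * coordF x)"
  "coordF (bracket x y) = coordH y * coordF x - coordH x * coordF y"
proof -
  have tr: "A $ 2 $ 2 = - A $ 1 $ 1" if "trace A = 0" for A :: "complex^2^2"
    using that by (simp add: trace_def sum_2 eq_neg_iff_add_eq_0 add.commute)
  show "coordE (bracket x y) = coordH x * coordE y - coordH y * coordE x"
    by transfer (simp add: matrix_matrix_mult_def sum_2 tr algebra_simps)
  show "coordH (bracket x y) = 2 * (coordE x * coordF y - coordE y * coordF x)"
    by transfer (simp add: matrix_matrix_mult_def sum_2 tr algebra_simps)
  show "coordF (bracket x y) = coordH y * coordF x - coordH x * coordF y"
    by transfer (simp add: matrix_matrix_mult_def sum_2 tr algebra_simps)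
qed

lemma coord_gen:
  "coordE (sl2_gen g) = (if g = Ep then 1 else 0)" "coordH (sl2_gen g) = (if g = Hz then 1 else 0)"
  "coordF (sl2_gen g) = (if g = Fm then 1 else 0)"
proof -
  have "coordE (sl2_e 1 2) = 1" "coordE (sl2_e 1 1) = 0" "coordE (sl2_e 2 1) = 0"
    "coordH (sl2_e 1 2) = 0" "coordH (sl2_e 1 1) = 1" "coordH (sl2_e 2 1) = 0"
    "coordF (sl2_e 1 2) = 0" "coordF (sl2_e 1 1) = 0" "coordF (sl2_e 2 1) = 1"
    by (transfer, simp)+
  then show "coordE (sl2_gen g) = (if g = Ep then 1 else 0)"
    "coordH (sl2_gen g) = (if g = Hz then 1 else 0)"
    "coordF (sl2_gen g) = (if g = Fm then 1 else 0)"
    by (cases g; simp add: sl2_gen_def)+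
qed

lemma sl2_gen_span:
  "x = coordE x *\<^sub>C sl2_gen Ep + coordH x *\<^sub>C sl2_gen Hz + coordF x *\<^sub>C sl2_gen Fm"
proof -
  have "x = coordE x *\<^sub>C sl2_e 1 2 + coordH x *\<^sub>C sl2_e 1 1 + coordF x *\<^sub>C sl2_e 2 1"
  proof transfer
    fix x :: "complex^2^2" assume "trace x = 0"
    then have "x $ 2 $ 2 = - x $ 1 $ 1"
      by (simp add: trace_def sum_2 eq_neg_iff_add_eq_0 add.commute)
    then show "x =
      (\<chi> i j. x $ 1 $ 2 * (\<chi> k l. (if k = 1 \<and> l = 2 then 1 else 0) - (if (1::2) = 2 \<and> k = l then 1/2 else 0)) $ i $ j) +
      (\<chi> i j. 2 * x $ 1 $ 1 * (\<chi> k l. (if k = 1 \<and> l = 1 then 1 else 0) - (if (1::2) = 1 \<and> k = l then 1/2 else 0)) $ i $ j) +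
      (\<chi> i j. x $ 2 $ 1 * (\<chi> k l. (if k = 2 \<and> l = 1 then 1 else 0) - (if (2::2) = 1 \<and> k = l then 1/2 else 0)) $ i $ j)"
      by (simp add: vec_eq_iff forall_2)
  qed
  then show ?thesis by (simp add: sl2_gen_def)
qed

text \<open>The left regular representation of \<open>U(sl\<^sub>2)\<close>: the function \<open>w\<close> stands for the sum of all
  \<open>e\<^sub>2\<^sub>1\<^sup>i (w i k)(e\<^sub>1\<^sub>1) e\<^sub>1\<^sub>2\<^sup>k\<close>.\<close>

type_synonym verma = "nat \<Rightarrow> nat \<Rightarrow> complex \<Rightarrow> complex"

text \<open>With \<open>e, h, f\<close> for \<open>e_12, e_11, e_21\<close>, this encodes
  \<open>e f^i = f^i e + i f^(i - 1) (2 h - (i - 1))\<close> and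
  \<open>e w(h) = w(h - 1) e\<close>.\<close>

definition actE :: "verma \<Rightarrow> verma"
  where "actE w = (\<lambda>i k \<eta>. (if k = 0 then 0 else w i (k - 1) (\<eta> - 1)) +
    of_nat (i + 1) * (2 * \<eta> - of_nat i) * w (i + 1) k \<eta>)"

definition actH :: "verma \<Rightarrow> verma"
  where "actH w = (\<lambda>i k \<eta>. (\<eta> - of_nat i) * w i k \<eta>)"

definition actF :: "verma \<Rightarrow> verma"
  where "actF w = (\<lambda>i k \<eta>. if i = 0 then 0 else w (i - 1) k \<eta>)"

definition act :: "sl2 \<Rightarrow> verma \<Rightarrow> verma"
  where "act x w = (\<lambda>i k \<eta>. coordE x * actE w i k \<eta> + coordH x * actH w i k \<eta> + coordF x * actF w i k \<eta>)"

lemma act_bracket: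
  "act (bracket x y) w i k \<eta> = act x (act y w) i k \<eta> - act y (act x w) i k \<eta>"
  by (cases i; cases k)
     (simp_all add: act_def actE_def actH_def actF_def coord_bracket algebra_simps)

lemma act_lin_left:
  "act (x + y) w i k \<eta> = act x w i k \<eta> + act y w i k \<eta>"
  "act (c *\<^sub>C x) w i k \<eta> = c * act x w i k \<eta>"
  by (simp_all add: act_def coord_add coord_scaleC algebra_simps)

lemma act_lin_right:
  "act x (\<lambda>i k \<eta>. w i k \<eta> + w' i k \<eta>) = (\<lambda>i k \<eta>. act x w i k \<eta> + act x w' i k \<eta>)"
  "act x (\<lambda>i k \<eta>. c * w i k \<eta>) = (\<lambda>i k \<eta>. c * act x w i k \<eta>)"
  by (intro ext; simp add: act_def actE_def actH_def actF_def algebra_simps)+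

definition act_word :: "sl2 free_monoid \<Rightarrow> verma \<Rightarrow> verma"
  where "act_word m = foldr act (letters m)"

lemma act_word_lin:
  "act_word m (\<lambda>i k \<eta>. w i k \<eta> + w' i k \<eta>) = (\<lambda>i k \<eta>. act_word m w i k \<eta> + act_word m w' i k \<eta>)"
  "act_word m (\<lambda>i k \<eta>. c * w i k \<eta>) = (\<lambda>i k \<eta>. c * act_word m w i k \<eta>)"
proof -
  have "foldr act xs (\<lambda>i k \<eta>. w i k \<eta> + w' i k \<eta>) = (\<lambda>i k \<eta>. foldr act xs w i k \<eta> + foldr act xs w' i k \<eta>)"
    "foldr act xs (\<lambda>i k \<eta>. c * w i k \<eta>) = (\<lambda>i k \<eta>. c * foldr act xs w i k \<eta>)" for xs
    by (induction xs) (simp_all add: act_lin_right)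
  then show "act_word m (\<lambda>i k \<eta>. w i k \<eta> + w' i k \<eta>) = (\<lambda>i k \<eta>. act_word m w i k \<eta> + act_word m w' i k \<eta>)"
    "act_word m (\<lambda>i k \<eta>. c * w i k \<eta>) = (\<lambda>i k \<eta>. c * act_word m w i k \<eta>)"
    by (simp_all add: act_word_def)
qed

definition act_free :: "sl2 free_algebra \<Rightarrow> verma \<Rightarrow> verma"
  where "act_free p w = (\<lambda>i k \<eta>. pm_extend (\<lambda>m. act_word m w i k \<eta>) p)"

lemma act_free_add: "act_free (p + q) w = (\<lambda>i k \<eta>. act_free p w i k \<eta> + act_free q w i k \<eta>)"
  by (simp add: act_free_def pm_extend_add)

lemma act_free_single: "act_free (Poly_Mapping.single m c) w = (\<lambda>i k \<eta>. c * act_word m w i k \<eta>)"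
  by (simp add: act_free_def scaleC_complex_def)

lemma act_free_zero: "act_free 0 w = (\<lambda>i k \<eta>. 0)"
  by (simp add: act_free_def)

lemma act_free_lin:
  "act_free p (\<lambda>i k \<eta>. w i k \<eta> + w' i k \<eta>) = (\<lambda>i k \<eta>. act_free p w i k \<eta> + act_free p w' i k \<eta>)"
  "act_free p (\<lambda>i k \<eta>. c * w i k \<eta>) = (\<lambda>i k \<eta>. c * act_free p w i k \<eta>)"
  by (induction p rule: pm_induct)
     (simp_all add: act_free_zero act_free_single act_free_add act_word_lin algebra_simps)

lemma act_free_mult: "act_free (p * q) w = act_free p (act_free q w)"
proof (induction p rule: pm_induct)
  case (single m c)
  show ?case
  proof (induction q rule: pm_induct)
    case zero
    show ?case using act_free_lin(2)[of "Poly_Mapping.single m c" 0] by (simp add: act_free_zero)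
  next
    case (single n d)
    show ?case
      by (simp add: mult_single act_free_single act_word_lin)
         (simp add: act_word_def plus_free_monoid_def mult_ac)
  next
    case (add q q')
    then show ?case by (simp add: distrib_left act_free_add act_free_lin)
  qed
qed (simp_all add: act_free_zero distrib_right act_free_add)

lemma act_free_ideal: "p \<in> ideal_gen uea_rels \<Longrightarrow> act_free p w = (\<lambda>i k \<eta>. 0)"
proof (induction arbitrary: w rule: ideal_gen.induct)
  case (gen g)
  have diff: "act_free (p - q) w = (\<lambda>i k \<eta>. act_free p w i k \<eta> - act_free q w i k \<eta>)" for p q
    by (simp add: act_free_def pm_extend_diff)
  have [simp]: "act_free (letter x) w i k \<eta> = act x w i k \<eta>" for x w i k \<eta>
    by (simp add: act_free_single act_word_def)
  have act_letter: "act_free (letter x) w = act x w" for x w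
    by (simp add: fun_eq_iff)
  show ?case using gen
    by cases (auto simp: diff act_free_add act_free_mult act_letter act_lin_left act_bracket
      act_free_single act_word_def zero_free_monoid_def)
next
  case (mult p x y)
  have "act_free x (\<lambda>i k \<eta>. 0) = (\<lambda>i k \<eta>. 0)"
    using act_free_lin(2)[of x 0] by simp
  then show ?case by (simp add: act_free_mult mult.IH)
qed (simp_all add: act_free_zero act_free_add)

lift_definition uact :: "sl2 uea \<Rightarrow> verma \<Rightarrow> verma" is act_free
proof
  fix p q :: "sl2 free_algebra" and w assume "uea_cong p q"
  then have "act_free (p - q) w = (\<lambda>i k \<eta>. 0)" unfolding uea_cong_def by (rule act_free_ideal)
  then show "act_free p w = act_free q w"
    by (simp add: act_free_def pm_extend_diff fun_eq_iff)
qed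

lemma uact_add: "uact (u + u') w i k \<eta> = uact u w i k \<eta> + uact u' w i k \<eta>"
  by transfer (simp add: act_free_add)

lemma uact_scaleC: "uact (c *\<^sub>C u) w i k \<eta> = c * uact u w i k \<eta>"
  by transfer (simp add: act_free_mult act_free_single act_word_def zero_free_monoid_def)

lemma uact_mult: "uact (u * u') w = uact u (uact u' w)"
  by transfer (simp add: act_free_mult)

lemma uact_one: "uact 1 w = w"
  by transfer (simp add: act_free_def act_word_def zero_free_monoid_def)

lemma uact_incl: "uact (uea_incl x) w = act x w"
  by transfer (simp add: act_free_single act_word_def)

section \<open>Linear independence of the ordered monomials in the tensor power\<close>

definition ugen :: "gen \<Rightarrow> sl2 uea"
  where "ugen g = uea_incl (sl2_gen g)"

lemma uact_ugen: "uact (ugen Ep) = actE" "uact (ugen Hz) = actH" "uact (ugen Fm) = actF"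
  by (simp_all add: fun_eq_iff ugen_def uact_incl act_def coord_gen)

definition pbw :: "(gen \<Rightarrow> nat) \<Rightarrow> sl2 uea"
  where "pbw \<beta> = ugen Fm ^ \<beta> Fm * ugen Hz ^ \<beta> Hz * ugen Ep ^ \<beta> Ep"

text \<open>The function standing for 1, so that \<open>uact u vacuum\<close> records the normal
  form of \<open>u\<close>.\<close>

definition vacuum :: verma
  where "vacuum = (\<lambda>i k \<eta>. if i = 0 \<and> k = 0 then 1 else 0)"

lemma uact_pbw:
  "uact (pbw \<beta>) vacuum = (\<lambda>i k \<eta>. if i = \<beta> Fm \<and> k = \<beta> Ep then \<eta> ^ \<beta> Hz else 0)"
proof -
  have E: "uact (ugen Ep ^ n) vacuum = (\<lambda>i k \<eta>. if i = 0 \<and> k = n then 1 else 0)" for n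
    by (induction n) (auto simp: uact_one vacuum_def uact_mult uact_ugen actE_def fun_eq_iff)
  have H: "uact (ugen Hz ^ n) (\<lambda>i k \<eta>. if i = 0 \<and> k = m then 1 else 0) =
      (\<lambda>i k \<eta>. if i = 0 \<and> k = m then \<eta> ^ n else 0)" for n m
    by (induction n) (auto simp: uact_one uact_mult uact_ugen actH_def fun_eq_iff)
  have F: "uact (ugen Fm ^ n) (\<lambda>i k \<eta>. if i = 0 \<and> k = m then \<eta> ^ l else 0) =
      (\<lambda>i k \<eta>. if i = n \<and> k = m then \<eta> ^ l else 0)" for n m l
    by (induction n) (auto simp: uact_one uact_mult uact_ugen actF_def fun_eq_iff)
  show ?thesis by (simp add: pbw_def uact_mult E H F)
qed

text \<open>The product over all factors of the coefficient with \<open>i a\<close> letters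
  \<open>e_21\<close> and \<open>k a\<close> letters \<open>e_12\<close>, where \<open>e_11\<close>
  is evaluated at \<open>\<eta> a\<close>. Being multilinear in the factors, it descends to the
  tensor power.\<close>

lift_definition tensor_eval :: "('n::finite \<Rightarrow> nat) \<Rightarrow> ('n \<Rightarrow> nat) \<Rightarrow> ('n \<Rightarrow> complex) \<Rightarrow> 'n U_sl2 \<Rightarrow> complex"
  is "\<lambda>i k \<eta>. pm_extend (\<lambda>t. \<Prod>a\<in>UNIV. uact (entry t a) vacuum (i a) (k a) (\<eta> a))"
proof -
  fix i k :: "'n \<Rightarrow> nat" and \<eta> and p q :: "(sl2 uea, 'n) pre_tensor"
  let ?\<Phi> = "\<lambda>t. \<Prod>a\<in>UNIV. uact (entry t a) vacuum (i a) (k a) (\<eta> a)"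
  have upd: "(\<Prod>a\<in>UNIV. uact ((f(b := x)) a) vacuum (i a) (k a) (\<eta> a)) =
      uact x vacuum (i b) (k b) (\<eta> b) * (\<Prod>a\<in>UNIV - {b}. uact (f a) vacuum (i a) (k a) (\<eta> a))" for f b x
    by (subst prod.remove[of _ b]) auto
  assume "tensor_cong p q"
  then have "pm_extend ?\<Phi> (p - q) = 0"
    unfolding tensor_cong_def
  proof (rule tensor_ideal_span[rotated])
    fix g :: "(sl2 uea, 'n) pre_tensor" assume "g \<in> tensor_rels"
    then show "pm_extend ?\<Phi> g = 0"
      by cases (simp_all del: fun_upd_apply
          add: pm_extend_add pm_extend_diff mult_single upd uact_add uact_scaleC scaleC_complex_def
            distrib_right mult.assoc)
  qed
  then show "pm_extend ?\<Phi> p = pm_extend ?\<Phi> q" by (simp add: pm_extend_diff)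
qed

lemma tensor_eval_add: "tensor_eval i k \<eta> (X + Y) = tensor_eval i k \<eta> X + tensor_eval i k \<eta> Y"
  by transfer (simp add: pm_extend_add)

lemma tensor_eval_zero: "tensor_eval i k \<eta> 0 = 0"
  by transfer simp

lemma tensor_eval_scaleC: "tensor_eval i k \<eta> (c *\<^sub>C X) = c * tensor_eval i k \<eta> X"
proof transfer
  fix i k :: "'n \<Rightarrow> nat" and \<eta> c and X :: "(sl2 uea, 'n) pre_tensor"
  show "pm_extend (\<lambda>t. \<Prod>a\<in>UNIV. uact (entry t a) vacuum (i a) (k a) (\<eta> a)) (cst c * X) =
      c * pm_extend (\<lambda>t. \<Prod>a\<in>UNIV. uact (entry t a) vacuum (i a) (k a) (\<eta> a)) X"
    by (induction X rule: pm_induct)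
       (simp_all add: mult_single distrib_left pm_extend_add scaleC_complex_def)
qed

lemma tensor_eval_sum: "tensor_eval i k \<eta> (\<Sum>x\<in>A. f x) = (\<Sum>x\<in>A. tensor_eval i k \<eta> (f x))"
  by (induction A rule: infinite_finite_induct) (simp_all add: tensor_eval_zero tensor_eval_add)

lemma tensor_eval_pure:
  "tensor_eval i k \<eta> (pure_tensor f) = (\<Prod>a\<in>UNIV. uact (f a) vacuum (i a) (k a) (\<eta> a))"
  by (simp add: tensor_eval.abs_eq pure_tensor.abs_eq scaleC_one)

definition tpbw :: "('n::finite \<times> gen \<Rightarrow> nat) \<Rightarrow> 'n U_sl2"
  where "tpbw \<alpha> = pure_tensor (\<lambda>a. pbw (\<lambda>g. \<alpha> (a, g)))"

lemma tensor_eval_tpbw: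
  "tensor_eval i k \<eta> (tpbw \<alpha>) =
    (if (\<forall>a. i a = \<alpha> (a, Fm) \<and> k a = \<alpha> (a, Ep)) then \<Prod>a\<in>UNIV. \<eta> a ^ \<alpha> (a, Hz) else 0)"
proof (cases "\<forall>a. i a = \<alpha> (a, Fm) \<and> k a = \<alpha> (a, Ep)")
  case False
  then obtain a where "\<not> (i a = \<alpha> (a, Fm) \<and> k a = \<alpha> (a, Ep))" by blast
  then have "(\<Prod>a\<in>UNIV. uact (pbw (\<lambda>g. \<alpha> (a, g))) vacuum (i a) (k a) (\<eta> a)) = 0"
    by (intro prod_zero) (auto simp: uact_pbw)
  then have "tensor_eval i k \<eta> (tpbw \<alpha>) = 0" by (simp only: tpbw_def tensor_eval_pure)
  with False show ?thesis by (simp only: if_False)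
qed (simp add: tpbw_def tensor_eval_pure uact_pbw)

text \<open>The functional with the \<open>Fm\<close> and \<open>Ep\<close> exponents of
  \<open>\<alpha>\<close> keeps only the terms that share them; these are told apart by their
  \<open>Hz\<close> exponents, as monomials in \<open>\<eta>\<close>.\<close>

lemma tpbw_independent:
  assumes M: "finite M" and zero: "(\<Sum>\<alpha>\<in>M. c \<alpha> *\<^sub>C tpbw \<alpha>) = 0" and "\<alpha> \<in> M"
  shows "c \<alpha> = 0"
proof -
  define M' where "M' = {\<beta> \<in> M. \<forall>a. \<alpha> (a, Fm) = \<beta> (a, Fm) \<and> \<alpha> (a, Ep) = \<beta> (a, Ep)}"
  define h where "h = (\<lambda>\<beta> :: 'a \<times> gen \<Rightarrow> nat. \<lambda>a. \<beta> (a, Hz))"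
  define k where "k = (\<lambda>\<gamma> :: 'a \<Rightarrow> nat. \<lambda>(a, g). if g = Hz then \<gamma> a else \<alpha> (a, g))"
  have kh: "k (h \<beta>) = \<beta>" if "\<beta> \<in> M'" for \<beta>
  proof
    fix p show "k (h \<beta>) p = \<beta> p"
      using that by (cases p; cases "snd p") (auto simp: k_def h_def M'_def)
  qed
  have inj: "inj_on h M'" by (metis inj_onI kh)
  have "c (k (h \<alpha>)) = 0"
  proof (rule monomials_indep[of "h ` M'" "\<lambda>\<gamma>. c (k \<gamma>)"])
    show "finite (h ` M')" using M by (simp add: M'_def)
    show "h \<alpha> \<in> h ` M'" using assms(3) by (auto simp: M'_def)
    fix \<eta> :: "'a \<Rightarrow> complex"
    have "0 = tensor_eval (\<lambda>a. \<alpha> (a, Fm)) (\<lambda>a. \<alpha> (a, Ep)) \<eta> (\<Sum>\<alpha>\<in>M. c \<alpha> *\<^sub>C tpbw \<alpha>)"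
      by (simp add: zero tensor_eval_zero)
    also have "\<dots> = (\<Sum>\<beta>\<in>M'. c \<beta> * (\<Prod>a\<in>UNIV. \<eta> a ^ \<beta> (a, Hz)))"
      unfolding tensor_eval_sum tensor_eval_scaleC tensor_eval_tpbw M'_def
      by (rule sum.mono_neutral_cong_right[OF M]) auto
    also have "\<dots> = (\<Sum>\<gamma>\<in>h ` M'. c (k \<gamma>) * (\<Prod>a\<in>UNIV. \<eta> a ^ \<gamma> a))"
      unfolding sum.reindex[OF inj] by (rule sum.cong) (simp_all add: kh, simp add: h_def)
    finally show "(\<Sum>\<gamma>\<in>h ` M'. c (k \<gamma>) * (\<Prod>a\<in>UNIV. \<eta> a ^ \<gamma> a)) = 0" by simp
  qed
  moreover have "\<alpha> \<in> M'" using assms(3) by (simp add: M'_def)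
  ultimately show ?thesis by (simp add: kh)
qed

section \<open>Leading terms of products of generators\<close>

lemma uea_incl_coord:
  "uea_incl x = coordE x *\<^sub>C ugen Ep + coordH x *\<^sub>C ugen Hz + coordF x *\<^sub>C ugen Fm"
  by (subst sl2_gen_span) (simp add: uea_incl_add uea_incl_scaleC ugen_def)

definition ad_coeff :: "gen \<Rightarrow> gen \<Rightarrow> gen \<Rightarrow> complex"
  where "ad_coeff g h k = (case k of Ep \<Rightarrow> coordE (bracket (sl2_gen g) (sl2_gen h))
    | Hz \<Rightarrow> coordH (bracket (sl2_gen g) (sl2_gen h)) | Fm \<Rightarrow> coordF (bracket (sl2_gen g) (sl2_gen h)))"

lemma ad_coeff_simps:
  "ad_coeff g h Ep = (if g = Hz \<and> h = Ep then 1 else if g = Ep \<and> h = Hz then - 1 else 0)"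
  "ad_coeff g h Hz = (if g = Ep \<and> h = Fm then 2 else if g = Fm \<and> h = Ep then - 2 else 0)"
  "ad_coeff g h Fm = (if g = Fm \<and> h = Hz then 1 else if g = Hz \<and> h = Fm then - 1 else 0)"
  by (cases g; cases h; simp add: ad_coeff_def coord_bracket coord_gen)+

lemma ugen_commutator:
  "ugen g * ugen h - ugen h * ugen g = (\<Sum>k\<in>UNIV. ad_coeff g h k *\<^sub>C ugen k)"
  using uea_incl_coord[of "bracket (sl2_gen g) (sl2_gen h)"]
  by (simp add: ugen_def uea_incl_bracket sum_gen ad_coeff_def)

lemma ugen_commute:
  "ugen Ep * ugen Fm = ugen Fm * ugen Ep + 2 *\<^sub>C ugen Hz"
  "ugen Hz * ugen Ep = ugen Ep * ugen Hz + ugen Ep"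
  "ugen Hz * ugen Fm = ugen Fm * ugen Hz - ugen Fm"
  using ugen_commutator[of Ep Fm] ugen_commutator[of Hz Ep] ugen_commutator[of Hz Fm]
  by (simp_all add: sum_gen ad_coeff_simps scaleC_one algebra_simps)

lemma scaleC_zero_left [simp]: "0 *\<^sub>C x = (0 :: 'a::complex_vector)"
  by (rule cvec.scale_zero_left)

lemma Hz_Fm_power:
  "ugen Hz * ugen Fm ^ i = ugen Fm ^ i * ugen Hz - of_nat i *\<^sub>C ugen Fm ^ i"
proof (induction i)
  case (Suc i)
  have "ugen Hz * ugen Fm ^ Suc i = (ugen Fm * ugen Hz - ugen Fm) * ugen Fm ^ i"
    by (simp flip: mult.assoc add: ugen_commute)
  also have "\<dots> = ugen Fm * (ugen Hz * ugen Fm ^ i) - ugen Fm ^ Suc i"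
    by (simp add: left_diff_distrib mult.assoc)
  also have "\<dots> = ugen Fm ^ Suc i * ugen Hz - of_nat (Suc i) *\<^sub>C ugen Fm ^ Suc i"
    unfolding Suc.IH
    by (simp add: right_diff_distrib mult_scaleC_right scaleC_add_left scaleC_one mult.assoc)
  finally show ?case .
qed simp

lemma Ep_Fm_power:
  "ugen Ep * ugen Fm ^ i = ugen Fm ^ i * ugen Ep + (2 * of_nat i) *\<^sub>C (ugen Fm ^ (i - 1) * ugen Hz)
    - (of_nat i * of_nat (i - 1)) *\<^sub>C ugen Fm ^ (i - 1)"
proof (induction i)
  case (Suc i)
  have "ugen Ep * ugen Fm ^ Suc i = (ugen Fm * ugen Ep + 2 *\<^sub>C ugen Hz) * ugen Fm ^ i"
    by (simp flip: mult.assoc add: ugen_commute)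
  also have "\<dots> = ugen Fm * (ugen Ep * ugen Fm ^ i) + 2 *\<^sub>C (ugen Hz * ugen Fm ^ i)"
    by (simp add: distrib_right mult.assoc mult_scaleC_left)
  also have "\<dots> = ugen Fm ^ Suc i * ugen Ep + (2 *\<^sub>C (of_nat i *\<^sub>C (ugen Fm ^ i * ugen Hz)) + 2 *\<^sub>C (ugen Fm ^ i * ugen Hz))
      - (of_nat (i - 1) *\<^sub>C (of_nat i *\<^sub>C ugen Fm ^ i) + 2 *\<^sub>C (of_nat i *\<^sub>C ugen Fm ^ i))"
    unfolding Suc.IH Hz_Fm_power
    by (cases i) (simp_all add: distrib_left right_diff_distrib mult_scaleC_right mult.assoc
        cvec.scale_right_diff_distrib scaleC_scaleC mult.commute[of "of_nat _" "of_nat _"] del: of_nat_Suc)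
  also have "2 *\<^sub>C (of_nat i *\<^sub>C (ugen Fm ^ i * ugen Hz)) + 2 *\<^sub>C (ugen Fm ^ i * ugen Hz)
      = (2 * of_nat (Suc i)) *\<^sub>C (ugen Fm ^ i * ugen Hz)"
    by (simp add: scaleC_scaleC flip: scaleC_add_left)
  also have "of_nat (i - 1) *\<^sub>C (of_nat i *\<^sub>C ugen Fm ^ i) + 2 *\<^sub>C (of_nat i *\<^sub>C ugen Fm ^ i)
      = (of_nat (Suc i) * of_nat i) *\<^sub>C ugen Fm ^ i"
  proof -
    have "of_nat (i - 1) * of_nat i + 2 * of_nat i = (of_nat (Suc i) * of_nat i :: complex)"
      by (cases i) (simp_all add: algebra_simps)
    then show ?thesis by (simp only: scaleC_scaleC scaleC_add_left[symmetric])
  qed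
  finally show ?case by simp
qed simp

lemma cspan_mult:
  fixes x :: "'a::complex_algebra_1"
  assumes "x \<in> cspan S" "\<And>s. s \<in> S \<Longrightarrow> a * s * b \<in> cspan T"
  shows "a * x * b \<in> cspan T"
  using assms(1)
proof (induction rule: cvec.span_induct_alt)
  case base
  show ?case by (simp add: cvec.span_zero)
next
  case (step c s y)
  have "a * (c *\<^sub>C s + y) * b = c *\<^sub>C (a * s * b) + a * y * b"
    by (simp add: distrib_left distrib_right mult_scaleC_left mult_scaleC_right)
  then show ?case using step assms(2) by (simp add: cvec.span_add cvec.span_scale)
qed

text \<open>In fact \<open>e h^j = (h - 1)^j e\<close> with \<open>e = e_12\<close>,
  \<open>h = e_11\<close>; only the degree of the correction matters below.\<close>

lemma Ep_Hz_power:
  "ugen Ep * ugen Hz ^ j - ugen Hz ^ j * ugen Ep \<in> cspan ((\<lambda>l. ugen Hz ^ l * ugen Ep) ` {..<j})"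
proof (induction j)
  case 0
  show ?case by (simp add: cvec.span_zero)
next
  case (Suc j)
  let ?S = "\<lambda>j. cspan ((\<lambda>l. ugen Hz ^ l * ugen Ep) ` {..<j})"
  let ?R = "ugen Ep * ugen Hz ^ j - ugen Hz ^ j * ugen Ep"
  have "ugen Ep * ugen Hz = ugen Hz * ugen Ep - ugen Ep"
    using ugen_commute(2) by (simp add: algebra_simps)
  then have "ugen Ep * ugen Hz ^ Suc j = (ugen Hz * ugen Ep - ugen Ep) * ugen Hz ^ j"
    by (simp flip: mult.assoc)
  then have eq: "ugen Ep * ugen Hz ^ Suc j - ugen Hz ^ Suc j * ugen Ep =
      ugen Hz * ?R * 1 - ?R - ugen Hz ^ j * ugen Ep"
    by (simp add: algebra_simps)
  have A: "ugen Hz * ?R * 1 \<in> ?S (Suc j)"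
    using Suc.IH
  proof (rule cspan_mult)
    fix s assume "s \<in> (\<lambda>l. ugen Hz ^ l * ugen Ep) ` {..<j}"
    then obtain l where "l < j" "s = ugen Hz ^ l * ugen Ep" by blast
    then have "ugen Hz * s * 1 = ugen Hz ^ Suc l * ugen Ep" "Suc l < Suc j"
      by (simp_all add: mult.assoc)
    then show "ugen Hz * s * 1 \<in> ?S (Suc j)" by (metis cvec.span_base image_eqI lessThan_iff)
  qed
  have B: "?R \<in> ?S (Suc j)"
    using Suc.IH by (rule subsetD[OF cvec.span_mono, rotated]) auto
  have C: "ugen Hz ^ j * ugen Ep \<in> ?S (Suc j)"
    by (intro cvec.span_base) auto
  show ?case unfolding eq by (rule cvec.span_diff[OF cvec.span_diff[OF A B] C])
qed

definition pbw_le :: "nat \<Rightarrow> sl2 uea set"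
  where "pbw_le d = cspan (pbw ` {\<gamma>. sum \<gamma> UNIV \<le> d})"

lemma pbw_le_intro: "i + j + k \<le> d \<Longrightarrow> ugen Fm ^ i * ugen Hz ^ j * ugen Ep ^ k \<in> pbw_le d"
proof -
  assume "i + j + k \<le> d"
  moreover have "ugen Fm ^ i * ugen Hz ^ j * ugen Ep ^ k = pbw (\<lambda>g. case g of Ep \<Rightarrow> k | Hz \<Rightarrow> j | Fm \<Rightarrow> i)"
    by (simp add: pbw_def)
  ultimately show ?thesis unfolding pbw_le_def by (auto intro!: cvec.span_base imageI simp: sum_gen)
qed

text \<open>Moving the generator to its place in the order \<open>Fm\<close>, \<open>Hz\<close>,
  \<open>Ep\<close> creates commutator terms, each with fewer letters than the product.\<close>

lemma ugen_pbw:
  "ugen g * pbw \<beta> - pbw (\<lambda>h. \<beta> h + unit_at g h) \<in> pbw_le (sum \<beta> UNIV)"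
proof -
  define i j k where "i = \<beta> Fm" and "j = \<beta> Hz" and "k = \<beta> Ep"
  have d: "sum \<beta> UNIV = i + j + k" by (simp add: sum_gen i_def j_def k_def)
  have \<beta>: "pbw \<beta> = ugen Fm ^ i * ugen Hz ^ j * ugen Ep ^ k"
    by (simp add: pbw_def i_def j_def k_def)
  have zero: "0 \<in> pbw_le d" and scale: "x \<in> pbw_le d \<Longrightarrow> c *\<^sub>C x \<in> pbw_le d"
    and add: "x \<in> pbw_le d \<Longrightarrow> y \<in> pbw_le d \<Longrightarrow> x + y \<in> pbw_le d"
    and diff: "x \<in> pbw_le d \<Longrightarrow> y \<in> pbw_le d \<Longrightarrow> x - y \<in> pbw_le d"
    and neg: "x \<in> pbw_le d \<Longrightarrow> - x \<in> pbw_le d" for d x y c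
    by (simp_all add: pbw_le_def cvec.span_neg cvec.span_zero cvec.span_scale cvec.span_add cvec.span_diff)
  show ?thesis
  proof (cases g)
    case Fm
    then have "pbw (\<lambda>h. \<beta> h + unit_at g h) = ugen g * pbw \<beta>"
      by (simp add: pbw_def mult.assoc)
    then show ?thesis by (simp add: zero)
  next
    case Hz
    have "pbw (\<lambda>h. \<beta> h + unit_at g h) = ugen Fm ^ i * ugen Hz * ugen Hz ^ j * ugen Ep ^ k"
      by (simp add: Hz pbw_def i_def j_def k_def mult.assoc)
    moreover have "ugen g * pbw \<beta> = ugen Hz * ugen Fm ^ i * ugen Hz ^ j * ugen Ep ^ k"
      by (simp add: \<beta> Hz mult.assoc)
    ultimately have "ugen g * pbw \<beta> - pbw (\<lambda>h. \<beta> h + unit_at g h) =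
        - of_nat i *\<^sub>C (ugen Fm ^ i * ugen Hz ^ j * ugen Ep ^ k)"
      by (simp add: Hz_Fm_power left_diff_distrib mult_scaleC_left)
    then show ?thesis using pbw_le_intro[of i j k "i + j + k"] by (simp add: d scale neg)
  next
    case Ep
    let ?R = "ugen Ep * ugen Hz ^ j - ugen Hz ^ j * ugen Ep"
    have "pbw (\<lambda>h. \<beta> h + unit_at g h) = ugen Fm ^ i * (ugen Hz ^ j * ugen Ep) * ugen Ep ^ k"
      by (simp add: Ep pbw_def i_def j_def k_def mult.assoc)
    moreover have "ugen g * pbw \<beta> = (ugen Ep * ugen Fm ^ i) * ugen Hz ^ j * ugen Ep ^ k"
      by (simp add: \<beta> Ep mult.assoc)
    ultimately have eq: "ugen g * pbw \<beta> - pbw (\<lambda>h. \<beta> h + unit_at g h) =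
        ugen Fm ^ i * ?R * ugen Ep ^ k
        + (2 * of_nat i) *\<^sub>C (ugen Fm ^ (i - 1) * ugen Hz ^ Suc j * ugen Ep ^ k)
        - (of_nat i * of_nat (i - 1)) *\<^sub>C (ugen Fm ^ (i - 1) * ugen Hz ^ j * ugen Ep ^ k)"
      unfolding Ep_Fm_power
      by (simp add: distrib_right left_diff_distrib right_diff_distrib mult_scaleC_left mult.assoc)
    have "ugen Fm ^ i * ?R * ugen Ep ^ k \<in> pbw_le (i + j + k)"
      unfolding pbw_le_def using Ep_Hz_power
    proof (rule cspan_mult)
      fix s assume "s \<in> (\<lambda>l. ugen Hz ^ l * ugen Ep) ` {..<j}"
      then obtain l where l: "l < j" "s = ugen Hz ^ l * ugen Ep" by blast
      then have "ugen Fm ^ i * s * ugen Ep ^ k = ugen Fm ^ i * ugen Hz ^ l * ugen Ep ^ Suc k"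
        by (simp add: mult.assoc)
      then show "ugen Fm ^ i * s * ugen Ep ^ k \<in> cspan (pbw ` {\<gamma>. sum \<gamma> UNIV \<le> i + j + k})"
        using pbw_le_intro[of i l "Suc k" "i + j + k"] l(1) by (simp add: pbw_le_def)
    qed
    moreover have "(2 * of_nat i) *\<^sub>C (ugen Fm ^ (i - 1) * ugen Hz ^ Suc j * ugen Ep ^ k) \<in> pbw_le (i + j + k)"
      using pbw_le_intro[of "i - 1" "Suc j" k "i + j + k"] by (cases i) (simp_all add: zero scale)
    moreover have "(of_nat i * of_nat (i - 1)) *\<^sub>C (ugen Fm ^ (i - 1) * ugen Hz ^ j * ugen Ep ^ k) \<in> pbw_le (i + j + k)"
      using pbw_le_intro[of "i - 1" j k "i + j + k"] by (cases i) (simp_all add: zero scale)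
    ultimately show ?thesis unfolding eq d by (intro diff add)
  qed
qed

definition tgen :: "'n::finite \<Rightarrow> gen \<Rightarrow> 'n U_sl2"
  where "tgen a g = in_factor a (ugen g)"

text \<open>With the strict inequality, degree 0 leaves only the zero element, which is where the
  descent along the filtration ends.\<close>

definition tpbw_less :: "nat \<Rightarrow> 'n::finite U_sl2 set"
  where "tpbw_less d = cspan (tpbw ` {\<gamma>. sum \<gamma> UNIV < d})"

lemma in_factor_pure_tensor: "in_factor a x * pure_tensor f = pure_tensor (f(a := x * f a))"
  unfolding in_factor_def pure_tensor_mult by (rule arg_cong[of _ _ pure_tensor]) auto

lemma sum_pairs: "(\<Sum>p\<in>UNIV. \<alpha> p) = (\<Sum>a\<in>UNIV. \<Sum>g\<in>UNIV. \<alpha> (a, g))"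
  by (simp add: sum.cartesian_product)

lemma tpbw_upd:
  "pure_tensor ((\<lambda>b. pbw (\<lambda>g. \<alpha> (b, g)))(a := pbw \<gamma>)) = tpbw (\<lambda>(b, g). if b = a then \<gamma> g else \<alpha> (b, g))"
  unfolding tpbw_def by (rule arg_cong[of _ _ pure_tensor]) auto

lemma pure_tensor_cspan:
  assumes "u \<in> cspan (pbw ` G)"
    and "\<And>\<gamma>. \<gamma> \<in> G \<Longrightarrow> pure_tensor (f(a := pbw \<gamma>)) \<in> cspan T"
  shows "pure_tensor (f(a := u)) \<in> cspan T"
  using assms(1)
proof (induction rule: cvec.span_induct_alt)
  case base
  have "pure_tensor (f(a := 0)) = 0 *\<^sub>C pure_tensor (f(a := 0))"
    by (subst pure_tensor_scaleC[symmetric]) simp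
  then show ?case by (simp add: cvec.span_zero del: fun_upd_apply)
next
  case (step c s y)
  then show ?case using assms(2)
    by (auto simp: pure_tensor_add pure_tensor_scaleC simp del: fun_upd_apply
        intro!: cvec.span_add cvec.span_scale)
qed

lemma tgen_tpbw:
  "tgen a g * tpbw \<alpha> - tpbw (\<lambda>p. \<alpha> p + unit_at (a, g) p) \<in> tpbw_less (Suc (sum \<alpha> UNIV))"
proof -
  let ?f = "\<lambda>b. pbw (\<lambda>g. \<alpha> (b, g))" and ?\<beta> = "\<lambda>g. \<alpha> (a, g)"
  have 1: "tgen a g * tpbw \<alpha> = pure_tensor (?f(a := ugen g * pbw ?\<beta>))"
    by (simp add: tgen_def tpbw_def in_factor_pure_tensor)
  have 2: "tpbw (\<lambda>p. \<alpha> p + unit_at (a, g) p) = pure_tensor (?f(a := pbw (\<lambda>h. ?\<beta> h + unit_at g h)))"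
    unfolding tpbw_def by (rule arg_cong[of _ _ pure_tensor]) (auto simp: unit_at_def fun_eq_iff intro!: arg_cong[of _ _ pbw])
  have "pure_tensor (?f(a := ugen g * pbw ?\<beta>)) =
      pure_tensor (?f(a := ugen g * pbw ?\<beta> - pbw (\<lambda>h. ?\<beta> h + unit_at g h)))
      + pure_tensor (?f(a := pbw (\<lambda>h. ?\<beta> h + unit_at g h)))"
    by (subst pure_tensor_add[symmetric]) simp
  then have "tgen a g * tpbw \<alpha> - tpbw (\<lambda>p. \<alpha> p + unit_at (a, g) p) =
      pure_tensor (?f(a := ugen g * pbw ?\<beta> - pbw (\<lambda>h. ?\<beta> h + unit_at g h)))"
    unfolding 1 2 by simp
  also have "\<dots> \<in> tpbw_less (Suc (sum \<alpha> UNIV))"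
    unfolding tpbw_less_def
  proof (rule pure_tensor_cspan[OF ugen_pbw[unfolded pbw_le_def]])
    fix \<gamma> :: "gen \<Rightarrow> nat" assume "\<gamma> \<in> {\<gamma>. sum \<gamma> UNIV \<le> sum ?\<beta> UNIV}"
    then have le: "sum \<gamma> UNIV \<le> sum ?\<beta> UNIV" by simp
    have "sum (\<lambda>(b, g). if b = a then \<gamma> g else \<alpha> (b, g)) UNIV \<le> sum \<alpha> UNIV"
      unfolding sum_pairs
    proof (rule sum_mono)
      fix b show "(\<Sum>g\<in>UNIV. (case (b, g) of (b, g) \<Rightarrow> if b = a then \<gamma> g else \<alpha> (b, g))) \<le> (\<Sum>g\<in>UNIV. \<alpha> (b, g))"
        using le by (cases "b = a") simp_all
    qed
    then show "pure_tensor (?f(a := pbw \<gamma>)) \<in> cspan (tpbw ` {\<gamma>. sum \<gamma> UNIV < Suc (sum \<alpha> UNIV)})"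
      unfolding tpbw_upd by (intro cvec.span_base imageI) simp
  qed
  finally show ?thesis .
qed

lemma tpbw_less_mono: "X \<in> tpbw_less d \<Longrightarrow> d \<le> d' \<Longrightarrow> X \<in> tpbw_less d'"
  unfolding tpbw_less_def by (erule subsetD[OF cvec.span_mono, rotated]) auto

lemma tgen_tpbw_less:
  assumes "X \<in> tpbw_less d"
  shows "tgen a g * X \<in> tpbw_less (Suc d)"
proof -
  have "tgen a g * X * 1 \<in> tpbw_less (Suc d)"
    using assms unfolding tpbw_less_def
  proof (rule cspan_mult)
    fix s :: "'a U_sl2" assume "s \<in> tpbw ` {\<gamma>. sum \<gamma> UNIV < d}"
    then obtain \<gamma> where \<gamma>: "sum \<gamma> UNIV < d" "s = tpbw \<gamma>" by blast
    have "tpbw (\<lambda>p. \<gamma> p + unit_at (a, g) p) \<in> tpbw_less (Suc d)"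
      unfolding tpbw_less_def using \<gamma>(1)
      by (intro cvec.span_base imageI) (simp add: sum.distrib sum_unit_at)
    moreover have "tgen a g * tpbw \<gamma> - tpbw (\<lambda>p. \<gamma> p + unit_at (a, g) p) \<in> tpbw_less (Suc d)"
      using \<gamma>(1) by (intro tpbw_less_mono[OF tgen_tpbw]) simp
    ultimately have "tgen a g * tpbw \<gamma> \<in> tpbw_less (Suc d)"
      unfolding tpbw_less_def using cvec.span_add by fastforce
    then show "tgen a g * s * 1 \<in> cspan (tpbw ` {\<gamma>. sum \<gamma> UNIV < Suc d})"
      using \<gamma>(2) by (simp add: tpbw_less_def)
  qed
  then show ?thesis by simp
qed

section \<open>Symbols\<close>

text \<open>\<open>symb d X f\<close> says that \<open>X\<close> has filtration degree at most \<open>d\<close> and that \<open>f\<close> is its symbol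
  of degree \<open>d\<close>.\<close>

inductive symb :: "nat \<Rightarrow> 'n::finite U_sl2 \<Rightarrow> ('n sl2pt \<Rightarrow> complex) \<Rightarrow> bool" where
  const: "symb 0 (c *\<^sub>C 1) (\<lambda>_. c)"
| gen: "symb d X f \<Longrightarrow> symb (Suc d) (tgen a g * X) (\<lambda>v. v (a, g) * f v)"
| add: "symb d X f \<Longrightarrow> symb d Y h \<Longrightarrow> symb d (X + Y) (\<lambda>v. f v + h v)"
| lower: "symb d X f \<Longrightarrow> symb (Suc d) X (\<lambda>_. 0)"

lemma symb_scale: "symb d X f \<Longrightarrow> symb d (c *\<^sub>C X) (\<lambda>v. c * f v)"
proof (induction rule: symb.induct)
  case (const b)
  show ?case using symb.const[of "c * b"] by (simp add: scaleC_scaleC)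
next
  case (gen d X f a g)
  show ?case using symb.gen[OF gen.IH, of a g] by (simp add: mult_scaleC_right mult.left_commute)
next
  case (add d X f Y h)
  show ?case using symb.add[OF add.IH] by (simp add: scaleC_add_right distrib_left)
next
  case (lower d X f)
  show ?case using symb.lower[OF lower.IH] by simp
qed

lemma symb_zero: "symb d 0 (\<lambda>_. 0)"
proof (induction d)
  case 0
  show ?case using symb.const[of 0] by simp
qed (rule symb.lower)

lemma symb_uminus: "symb d X f \<Longrightarrow> symb d (- X) (\<lambda>v. - f v)"
  using symb_scale[of d X f "- 1"] by (simp add: cvec.scale_minus_left scaleC_one)

lemma symb_diff: "symb d X f \<Longrightarrow> symb d Y h \<Longrightarrow> symb d (X - Y) (\<lambda>v. f v - h v)"
  using symb.add[OF _ symb_uminus] by fastforce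

lemma symb_sum:
  "finite A \<Longrightarrow> (\<And>i. i \<in> A \<Longrightarrow> symb d (X i) (f i)) \<Longrightarrow> symb d (\<Sum>i\<in>A. X i) (\<lambda>v. \<Sum>i\<in>A. f i v)"
  by (induction A rule: finite_induct) (simp_all add: symb_zero symb.add)

lemma symb_mult: "symb d X f \<Longrightarrow> symb e Y h \<Longrightarrow> symb (d + e) (X * Y) (\<lambda>v. f v * h v)"
proof (induction rule: symb.induct)
  case (const c)
  then show ?case using symb_scale[of e Y h c] by (simp add: mult_scaleC_left)
next
  case (gen d X f a g)
  show ?case using symb.gen[OF gen.IH[OF gen.prems], of a g] by (simp add: mult.assoc)
next
  case (add d X f Y h)
  show ?case using symb.add[OF add.IH(1)[OF add.prems] add.IH(2)[OF add.prems]]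
    by (simp add: distrib_right)
next
  case (lower d X f)
  show ?case using symb.lower[OF lower.IH[OF lower.prems]] by simp
qed

lemma symb_one: "symb 0 1 (\<lambda>_. 1)"
  using symb.const[of 1] by (simp add: scaleC_one)

lemma symb_power: "symb d X f \<Longrightarrow> symb (k * d) (X ^ k) (\<lambda>v. f v ^ k)"
proof (induction k)
  case 0
  show ?case using symb_one by simp
next
  case (Suc k)
  then show ?case using symb_mult[of d X f "k * d" "X ^ k"] by simp
qed

lemma symb_tgen: "symb 1 (tgen a g) (\<lambda>v. v (a, g))"
  using symb.gen[OF symb_one, of a g] by simp

lemma symb_raise: "symb d X f \<Longrightarrow> d < e \<Longrightarrow> symb e X (\<lambda>_. 0)"
proof (induction e)
  case (Suc e)
  then show ?case by (cases "d = e") (auto intro: symb.lower)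
qed simp

section \<open>Symbols in terms of the ordered monomials\<close>

definition monf :: "('i::finite \<Rightarrow> nat) \<Rightarrow> ('i \<Rightarrow> complex) \<Rightarrow> complex"
  where "monf \<alpha> v = (\<Prod>p\<in>UNIV. v p ^ \<alpha> p)"

definition multiidx :: "nat \<Rightarrow> ('i::finite \<Rightarrow> nat) set"
  where "multiidx d = {\<alpha>. sum \<alpha> UNIV = d}"

lemma finite_multiidx [simp]: "finite (multiidx d :: ('i::finite \<Rightarrow> nat) set)"
proof (rule finite_subset)
  show "multiidx d \<subseteq> (\<Pi>\<^sub>E i\<in>(UNIV :: 'i set). {..d})"
    unfolding multiidx_def using member_le_sum[of _ "UNIV :: 'i set"] by (auto simp: PiE_UNIV_domain)
qed (auto intro: finite_PiE)

lemma monf_bump: "monf (\<lambda>p. \<alpha> p + unit_at q p) v = v q * monf \<alpha> v"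
  by (simp add: monf_def power_add prod.distrib prod_power_unit_at mult.commute)

lemma sum_bump: "sum (\<lambda>p. \<alpha> p + unit_at q p) UNIV = Suc (sum \<alpha> (UNIV :: 'i::finite set))"
  by (simp add: sum.distrib sum_unit_at)

text \<open>Raising the exponent at \<open>q\<close> by 1 is a bijection onto the exponents that are
  positive at \<open>q\<close>.\<close>

lemma sum_multiidx_bump:
  fixes q :: "'i::finite" and G :: "('i \<Rightarrow> nat) \<Rightarrow> ('i \<Rightarrow> nat) \<Rightarrow> 'b::comm_monoid_add"
  shows "(\<Sum>\<beta>\<in>multiidx (Suc d). if \<beta> q > 0 then G (\<lambda>p. \<beta> p - unit_at q p) \<beta> else 0) =
    (\<Sum>\<alpha>\<in>multiidx d. G \<alpha> (\<lambda>p. \<alpha> p + unit_at q p))"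
proof -
  let ?up = "\<lambda>\<alpha> p. \<alpha> p + unit_at q p :: nat" and ?dn = "\<lambda>\<beta> p. \<beta> p - unit_at q p :: nat"
  have ud: "?up (?dn \<beta>) = \<beta>" if "\<beta> q > 0" for \<beta>
    using that by (auto simp: unit_at_def fun_eq_iff)
  have du: "?dn (?up \<alpha>) = \<alpha>" for \<alpha> by auto
  have "(\<Sum>\<beta>\<in>multiidx (Suc d). if \<beta> q > 0 then G (?dn \<beta>) \<beta> else 0) =
      (\<Sum>\<beta>\<in>{\<beta> \<in> multiidx (Suc d). \<beta> q > 0}. G (?dn \<beta>) \<beta>)"
    by (simp add: sum.inter_filter)
  also have "\<dots> = (\<Sum>\<alpha>\<in>multiidx d. G \<alpha> (?up \<alpha>))"
  proof (rule sum.reindex_bij_witness[where i = ?up and j = ?dn])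
    fix \<beta> assume "\<beta> \<in> {\<beta> \<in> multiidx (Suc d). \<beta> q > 0}"
    then have \<beta>: "sum \<beta> UNIV = Suc d" "\<beta> q > 0" by (simp_all add: multiidx_def)
    show "?up (?dn \<beta>) = \<beta>" by (rule ud[of \<beta>, OF \<beta>(2)])
    have "Suc (sum (?dn \<beta>) UNIV) = sum (?up (?dn \<beta>)) UNIV" by (simp only: sum_bump)
    then have "Suc (sum (?dn \<beta>) UNIV) = Suc d" by (simp only: ud[of \<beta>, OF \<beta>(2)] \<beta>(1))
    then show "?dn \<beta> \<in> multiidx d" by (simp add: multiidx_def)
    show "G (?dn \<beta>) (?up (?dn \<beta>)) = G (?dn \<beta>) \<beta>" by (simp only: ud[of \<beta>, OF \<beta>(2)])
  next
    fix \<alpha> :: "'i \<Rightarrow> nat" assume "\<alpha> \<in> multiidx d"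
    then show "?up \<alpha> \<in> {\<beta> \<in> multiidx (Suc d). \<beta> q > 0}"
      by (simp add: multiidx_def sum_bump)
    show "?dn (?up \<alpha>) = \<alpha>" by (rule du)
  qed
  finally show ?thesis .
qed

text \<open>Ties the rules of \<open>symb\<close> to the basis: modulo lower degree,
  \<open>X\<close> has the same coefficients in the ordered monomials as \<open>f\<close> in the
  commutative ones. Independence of the ordered monomials then makes symbols unique.\<close>

lemma symb_rep:
  assumes "symb d X f"
  shows "\<exists>c. X - (\<Sum>\<alpha>\<in>multiidx d. c \<alpha> *\<^sub>C tpbw \<alpha>) \<in> tpbw_less d \<and>
    (\<forall>v. f v = (\<Sum>\<alpha>\<in>multiidx d. c \<alpha> * monf \<alpha> v))"
  using assms
proof (induction rule: symb.induct)
  case (const c)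
  have M: "multiidx 0 = {\<lambda>_ :: 'a \<times> gen. 0 :: nat}"
    by (auto simp: multiidx_def fun_eq_iff)
  have "tpbw (\<lambda>_. 0) = (1 :: 'a U_sl2)"
    by (simp add: tpbw_def pbw_def pure_tensor_one)
  then show ?case
    by (intro exI[of _ "\<lambda>_. c"]) (simp add: M monf_def tpbw_less_def cvec.span_zero)
next
  case (gen d X f a g)
  let ?q = "(a, g)" and ?up = "\<lambda>\<alpha> p. \<alpha> p + unit_at (a, g) p :: nat"
  obtain c where c: "X - (\<Sum>\<alpha>\<in>multiidx d. c \<alpha> *\<^sub>C tpbw \<alpha>) \<in> tpbw_less d"
    "\<And>v. f v = (\<Sum>\<alpha>\<in>multiidx d. c \<alpha> * monf \<alpha> v)" using gen.IH by blast
  define c' where "c' = (\<lambda>\<beta>. if \<beta> ?q > 0 then c (\<lambda>p. \<beta> p - unit_at ?q p) else 0)"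
  have f: "v ?q * f v = (\<Sum>\<beta>\<in>multiidx (Suc d). c' \<beta> * monf \<beta> v)" for v
  proof -
    have "(\<Sum>\<beta>\<in>multiidx (Suc d). c' \<beta> * monf \<beta> v) = (\<Sum>\<alpha>\<in>multiidx d. c \<alpha> * monf (?up \<alpha>) v)"
      using sum_multiidx_bump[where d = d and q = ?q and G = "\<lambda>\<alpha> \<beta>. c \<alpha> * monf \<beta> v"]
      by (simp add: c'_def if_distrib[of "\<lambda>x. x * _"] cong: if_cong)
    then show ?thesis unfolding c(2) monf_bump by (simp add: sum_distrib_left mult.left_commute)
  qed
  have "(\<Sum>\<beta>\<in>multiidx (Suc d). c' \<beta> *\<^sub>C tpbw \<beta>) = (\<Sum>\<alpha>\<in>multiidx d. c \<alpha> *\<^sub>C tpbw (?up \<alpha>))"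
    using sum_multiidx_bump[where d = d and q = ?q and G = "\<lambda>\<alpha> \<beta>. c \<alpha> *\<^sub>C tpbw \<beta>"]
    by (simp add: c'_def if_distrib[of "\<lambda>x. x *\<^sub>C _"] cong: if_cong)
  then have eq: "tgen a g * X - (\<Sum>\<beta>\<in>multiidx (Suc d). c' \<beta> *\<^sub>C tpbw \<beta>) =
      tgen a g * (X - (\<Sum>\<alpha>\<in>multiidx d. c \<alpha> *\<^sub>C tpbw \<alpha>)) +
      (\<Sum>\<alpha>\<in>multiidx d. c \<alpha> *\<^sub>C (tgen a g * tpbw \<alpha> - tpbw (?up \<alpha>)))"
    by (simp add: right_diff_distrib sum_distrib_left mult_scaleC_right
        cvec.scale_right_diff_distrib sum_subtractf)
  have "(\<Sum>\<alpha>\<in>multiidx d. c \<alpha> *\<^sub>C (tgen a g * tpbw \<alpha> - tpbw (?up \<alpha>))) \<in> tpbw_less (Suc d)"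
    unfolding tpbw_less_def
  proof (intro cvec.span_sum cvec.span_scale)
    fix \<alpha> :: "'a \<times> gen \<Rightarrow> nat" assume "\<alpha> \<in> multiidx d"
    then show "tgen a g * tpbw \<alpha> - tpbw (?up \<alpha>) \<in> cspan (tpbw ` {\<gamma>. sum \<gamma> UNIV < Suc d})"
      using tgen_tpbw[of a g \<alpha>] by (simp add: multiidx_def tpbw_less_def)
  qed
  with tgen_tpbw_less[OF c(1), of a g]
  have "tgen a g * X - (\<Sum>\<beta>\<in>multiidx (Suc d). c' \<beta> *\<^sub>C tpbw \<beta>) \<in> tpbw_less (Suc d)"
    unfolding eq unfolding tpbw_less_def by (rule cvec.span_add)
  with f show ?case by blast
next
  case (add d X f Y h)
  obtain c where c: "X - (\<Sum>\<alpha>\<in>multiidx d. c \<alpha> *\<^sub>C tpbw \<alpha>) \<in> tpbw_less d"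
    "\<And>v. f v = (\<Sum>\<alpha>\<in>multiidx d. c \<alpha> * monf \<alpha> v)" using add.IH(1) by blast
  obtain b where b: "Y - (\<Sum>\<alpha>\<in>multiidx d. b \<alpha> *\<^sub>C tpbw \<alpha>) \<in> tpbw_less d"
    "\<And>v. h v = (\<Sum>\<alpha>\<in>multiidx d. b \<alpha> * monf \<alpha> v)" using add.IH(2) by blast
  have "X + Y - (\<Sum>\<alpha>\<in>multiidx d. (c \<alpha> + b \<alpha>) *\<^sub>C tpbw \<alpha>) =
      (X - (\<Sum>\<alpha>\<in>multiidx d. c \<alpha> *\<^sub>C tpbw \<alpha>)) + (Y - (\<Sum>\<alpha>\<in>multiidx d. b \<alpha> *\<^sub>C tpbw \<alpha>))"
    by (simp add: scaleC_add_left sum.distrib)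
  also have "\<dots> \<in> tpbw_less d"
    using c(1) b(1) unfolding tpbw_less_def by (rule cvec.span_add)
  finally show ?case
    by (intro exI[of _ "\<lambda>\<alpha>. c \<alpha> + b \<alpha>"]) (simp add: c(2) b(2) distrib_right sum.distrib)
next
  case (lower d X f)
  then obtain c where c: "X - (\<Sum>\<alpha>\<in>multiidx d. c \<alpha> *\<^sub>C tpbw \<alpha>) \<in> tpbw_less d" by blast
  have "(\<Sum>\<alpha>\<in>multiidx d. c \<alpha> *\<^sub>C tpbw \<alpha>) \<in> tpbw_less (Suc d)"
    unfolding tpbw_less_def
    by (intro cvec.span_sum cvec.span_scale cvec.span_base imageI) (simp add: multiidx_def)
  moreover have "X - (\<Sum>\<alpha>\<in>multiidx d. c \<alpha> *\<^sub>C tpbw \<alpha>) \<in> tpbw_less (Suc d)"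
    using c by (rule tpbw_less_mono) simp
  ultimately have "X - (\<Sum>\<alpha>\<in>multiidx d. c \<alpha> *\<^sub>C tpbw \<alpha>) + (\<Sum>\<alpha>\<in>multiidx d. c \<alpha> *\<^sub>C tpbw \<alpha>) \<in> tpbw_less (Suc d)"
    unfolding tpbw_less_def by (intro cvec.span_add)
  then show ?case by (intro exI[of _ "\<lambda>_. 0"]) simp
qed

lemma cspan_image_sum:
  assumes "x \<in> cspan (f ` N)" "finite N"
  shows "\<exists>u. x = (\<Sum>i\<in>N. u i *\<^sub>C f i)"
  using assms(1)
proof (induction rule: cvec.span_induct_alt)
  case base
  show ?case by (rule exI[of _ "\<lambda>_. 0"]) simp
next
  case (step c s y)
  then obtain u i where u: "y = (\<Sum>i\<in>N. u i *\<^sub>C f i)" "i \<in> N" "s = f i" by blast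
  have "(\<Sum>j\<in>N. (u j + (if j = i then c else 0)) *\<^sub>C f j) = y + (\<Sum>j\<in>N. if j = i then c *\<^sub>C f j else 0)"
    unfolding u(1) by (simp add: scaleC_add_left sum.distrib if_distrib[of "\<lambda>x. x *\<^sub>C _"] cong: if_cong)
  also have "\<dots> = c *\<^sub>C s + y" using u assms(2) by simp
  finally show ?case by metis
qed

lemma tpbw_less_coeff:
  fixes c :: "('n::finite \<times> gen \<Rightarrow> nat) \<Rightarrow> complex"
  assumes "(\<Sum>\<alpha>\<in>multiidx d. c \<alpha> *\<^sub>C tpbw \<alpha>) \<in> tpbw_less d" "\<alpha> \<in> multiidx d"
  shows "c \<alpha> = 0"
proof -
  define N where "N = {\<gamma> :: 'n \<times> gen \<Rightarrow> nat. sum \<gamma> UNIV < d}"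
  have "N = (\<Union>e<d. multiidx e)" by (auto simp: N_def multiidx_def)
  then have N: "finite N" by simp
  obtain u where u: "(\<Sum>\<alpha>\<in>multiidx d. c \<alpha> *\<^sub>C tpbw \<alpha>) = (\<Sum>\<gamma>\<in>N. u \<gamma> *\<^sub>C tpbw \<gamma>)"
    using cspan_image_sum[OF _ N] assms(1) unfolding tpbw_less_def N_def by blast
  have disj: "multiidx d \<inter> N = {}" by (auto simp: N_def multiidx_def)
  define b where "b = (\<lambda>\<gamma>. if \<gamma> \<in> N then - u \<gamma> else c \<gamma>)"
  have "(\<Sum>\<gamma>\<in>multiidx d \<union> N. b \<gamma> *\<^sub>C tpbw \<gamma>) =
      (\<Sum>\<gamma>\<in>multiidx d. b \<gamma> *\<^sub>C tpbw \<gamma>) + (\<Sum>\<gamma>\<in>N. b \<gamma> *\<^sub>C tpbw \<gamma>)"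
    by (rule sum.union_disjoint[OF finite_multiidx N disj])
  also have "(\<Sum>\<gamma>\<in>multiidx d. b \<gamma> *\<^sub>C tpbw \<gamma>) = (\<Sum>\<gamma>\<in>multiidx d. c \<gamma> *\<^sub>C tpbw \<gamma>)"
    using disj by (intro sum.cong) (auto simp: b_def)
  also have "(\<Sum>\<gamma>\<in>N. b \<gamma> *\<^sub>C tpbw \<gamma>) = - (\<Sum>\<gamma>\<in>N. u \<gamma> *\<^sub>C tpbw \<gamma>)"
    by (simp add: b_def sum_negf cvec.scale_minus_left)
  finally have "(\<Sum>\<gamma>\<in>multiidx d \<union> N. b \<gamma> *\<^sub>C tpbw \<gamma>) = 0" by (simp add: u)
  then have "b \<alpha> = 0"
    using tpbw_independent[of "multiidx d \<union> N" b \<alpha>] N assms(2) by simp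
  then show ?thesis using assms(2) disj by (auto simp: b_def split: if_splits)
qed

lemma symb_unique:
  assumes "symb d X f" "symb d X h"
  shows "f v = h v"
proof -
  have "symb d 0 (\<lambda>v. f v - h v)" using symb_diff[OF assms] by simp
  from symb_rep[OF this] obtain c where c: "0 - (\<Sum>\<alpha>\<in>multiidx d. c \<alpha> *\<^sub>C tpbw \<alpha>) \<in> tpbw_less d"
    "\<And>v. f v - h v = (\<Sum>\<alpha>\<in>multiidx d. c \<alpha> * monf \<alpha> v)"
    by blast
  have "(\<Sum>\<alpha>\<in>multiidx d. c \<alpha> *\<^sub>C tpbw \<alpha>) \<in> tpbw_less d"
    using c(1) cvec.span_neg unfolding tpbw_less_def by fastforce
  then have "c \<alpha> = 0" if "\<alpha> \<in> multiidx d" for \<alpha> using that by (rule tpbw_less_coeff)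
  then have "f v - h v = 0" unfolding c(2) by (intro sum.neutral) simp
  then show ?thesis by simp
qed

lemma pbw_unbump:
  assumes "\<beta> \<noteq> (\<lambda>_. 0)"
  shows "\<exists>g. \<beta> g > 0 \<and> pbw \<beta> = ugen g * pbw (\<lambda>h. \<beta> h - unit_at g h)"
proof (cases "\<beta> Fm")
  case (Suc i)
  then show ?thesis by (intro exI[of _ Fm]) (simp add: pbw_def mult.assoc)
next
  case F: 0
  show ?thesis
  proof (cases "\<beta> Hz")
    case (Suc j)
    then show ?thesis using F by (intro exI[of _ Hz]) (simp add: pbw_def mult.assoc)
  next
    case 0
    have "\<beta> Ep \<noteq> 0"
    proof
      assume "\<beta> Ep = 0"
      then have "\<beta> h = 0" for h using F 0 by (cases h) simp_all
      then show False using assms by auto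
    qed
    then obtain k where "\<beta> Ep = Suc k" by (cases "\<beta> Ep") simp_all
    then show ?thesis using F 0 by (intro exI[of _ Ep]) (simp add: pbw_def)
  qed
qed

lemma symb_tpbw: "symb (sum \<alpha> UNIV) (tpbw \<alpha>) (monf \<alpha>)"
proof (induction "sum \<alpha> UNIV" arbitrary: \<alpha>)
  case 0
  then have \<alpha>: "\<alpha> = (\<lambda>_. 0)" by (auto simp: fun_eq_iff)
  have "tpbw (\<lambda>_. 0) = (1 :: 'a U_sl2)" "monf (\<lambda>_. 0) = (\<lambda>_ :: 'a sl2pt. 1)"
    by (simp_all add: tpbw_def pbw_def pure_tensor_one monf_def[abs_def])
  then show ?case using symb_one by (simp add: \<alpha>)
next
  case (Suc d)
  then obtain p where "\<alpha> p > 0" by (metis sum.neutral gr0I nat.distinct(1))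
  then obtain a where "(\<lambda>g. \<alpha> (a, g)) \<noteq> (\<lambda>_. 0)"
    by (cases p) (metis less_numeral_extra(3))
  from pbw_unbump[OF this] obtain g where g: "\<alpha> (a, g) > 0"
    "pbw (\<lambda>g. \<alpha> (a, g)) = ugen g * pbw (\<lambda>h. \<alpha> (a, h) - unit_at g h)" by blast
  define \<beta> where "\<beta> = (\<lambda>p. \<alpha> p - unit_at (a, g) p)"
  have \<alpha>: "\<alpha> = (\<lambda>p. \<beta> p + unit_at (a, g) p)"
    using g(1) by (auto simp: \<beta>_def fun_eq_iff unit_at_def)
  have "sum \<alpha> UNIV = Suc (sum \<beta> UNIV)" by (subst \<alpha>) (rule sum_bump)
  then have d: "d = sum \<beta> UNIV" using Suc.hyps(2) by simp
  have "tgen a g * tpbw \<beta> = tpbw \<alpha>"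
  proof -
    have *: "(\<lambda>h. \<beta> (a, h)) = (\<lambda>h. \<alpha> (a, h) - unit_at g h)"
      by (auto simp: \<beta>_def unit_at_def)
    have **: "(\<lambda>h. \<beta> (b, h)) = (\<lambda>h. \<alpha> (b, h))" if "b \<noteq> a" for b
      using that by (auto simp: \<beta>_def unit_at_def)
    show ?thesis
      unfolding tgen_def tpbw_def in_factor_pure_tensor
    proof (rule arg_cong[of _ _ pure_tensor], rule ext)
      fix b
      show "((\<lambda>b. pbw (\<lambda>g. \<beta> (b, g)))(a := ugen g * pbw (\<lambda>g. \<beta> (a, g)))) b = pbw (\<lambda>g. \<alpha> (b, g))"
        by (cases "b = a") (simp_all add: * ** g(2))
    qed
  qed
  moreover have "(\<lambda>v. v (a, g) * monf \<beta> v) = monf \<alpha>"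
    by (subst \<alpha>) (simp add: monf_bump fun_eq_iff)
  ultimately show ?case using symb.gen[OF Suc.hyps(1)[OF d], of a g] d Suc.hyps(2) by simp
qed

lemma tpbw_less_symb: "X \<in> tpbw_less (Suc d) \<Longrightarrow> \<exists>f. symb d X f"
  unfolding tpbw_less_def
proof (induction rule: cvec.span_induct_alt)
  case base
  show ?case using symb_zero by blast
next
  case (step c s y)
  obtain \<gamma> where \<gamma>: "sum \<gamma> UNIV \<le> d" "s = tpbw \<gamma>" using step.hyps(1) by (auto simp: less_Suc_eq_le)
  obtain f where f: "symb d y f" using step.IH by blast
  obtain h where "symb d s h"
    using symb_tpbw[of \<gamma>] symb_raise[OF symb_tpbw[of \<gamma>], of d] \<gamma>
    by (cases "sum \<gamma> UNIV = d") auto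
  then show ?case using symb.add[OF symb_scale f] by blast
qed

text \<open>A polynomial function determines its coefficients, so a zero symbol means that the
  leading part of \<open>X\<close> is zero.\<close>

lemma symb_null:
  assumes "symb d X f" "\<And>v. f v = 0"
  shows "X \<in> tpbw_less d"
proof -
  obtain c where c: "X - (\<Sum>\<alpha>\<in>multiidx d. c \<alpha> *\<^sub>C tpbw \<alpha>) \<in> tpbw_less d"
    "\<And>v. f v = (\<Sum>\<alpha>\<in>multiidx d. c \<alpha> * monf \<alpha> v)" using symb_rep[OF assms(1)] by blast
  have "c \<alpha> = 0" if "\<alpha> \<in> multiidx d" for \<alpha>
  proof (rule monomials_indep[OF finite_multiidx _ that])
    show "(\<Sum>\<alpha>\<in>multiidx d. c \<alpha> * (\<Prod>p\<in>UNIV. s p ^ \<alpha> p)) = 0" for s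
      using c(2)[of s] assms(2)[of s] by (simp add: monf_def)
  qed
  then show ?thesis using c(1) by simp
qed

lemma symb_zero_deg: "symb 0 X f \<Longrightarrow> (\<And>v. f v = 0) \<Longrightarrow> X = 0"
  using symb_null[of 0 X f] by (simp add: tpbw_less_def)

lemma uea_induct [case_names incl one add scale mult]:
  assumes "\<And>x. P (uea_incl x)" "P 1" "\<And>u v. P u \<Longrightarrow> P v \<Longrightarrow> P (u + v)"
    "\<And>c u. P u \<Longrightarrow> P (c *\<^sub>C u)" "\<And>u v. P u \<Longrightarrow> P v \<Longrightarrow> P (u * v)"
  shows "P (u :: 'g::complex_lie_algebra uea)"
proof (induction u rule: uea.abs_induct)
  case (1 p)
  show ?case
  proof (induction p rule: pm_induct)
    case zero
    have "abs_uea 0 = 0 *\<^sub>C (1 :: 'g uea)" by (simp add: zero_uea_def)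
    then show ?case using assms(2,4) by metis
  next
    case (single m c)
    have "P (abs_uea (Poly_Mapping.single (Word xs) c))" for xs
    proof (induction xs)
      case Nil
      have "abs_uea (Poly_Mapping.single (Word []) c) = c *\<^sub>C (1 :: 'g uea)"
        by (simp add: one_uea_def scaleC_uea.abs_eq flip: zero_free_monoid_def)
      then show ?case using assms(2,4) by metis
    next
      case (Cons x xs)
      have "Poly_Mapping.single (Word (x # xs)) c = letter x * Poly_Mapping.single (Word xs) c"
        by (simp add: mult_single plus_free_monoid_def)
      then have "abs_uea (Poly_Mapping.single (Word (x # xs)) c) =
          uea_incl x * abs_uea (Poly_Mapping.single (Word xs) c)"
        by (simp add: times_uea.abs_eq uea_incl.abs_eq)
      then show ?case using Cons assms(1,5) by metis
    qed
    then show ?case by (cases m) simp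
  next
    case (add p q)
    then show ?case using assms(3) by (simp flip: plus_uea.abs_eq)
  qed
qed

text \<open>The elements that have a symbol in some degree form a subalgebra containing the
  generators: the filtration is exhaustive.\<close>

lemma ex_symb: "\<exists>d f. symb d (X :: 'n::finite U_sl2) f"
proof -
  define S where "S = {X :: 'n U_sl2. \<exists>d f. symb d X f}"
  have mult: "X * Y \<in> S" if "X \<in> S" "Y \<in> S" for X Y
    using that symb_mult unfolding S_def by blast
  have scale: "c *\<^sub>C X \<in> S" if "X \<in> S" for X c
    using that symb_scale unfolding S_def by blast
  have S_add: "X + Y \<in> S" if XY: "X \<in> S" "Y \<in> S" for X Y
  proof -
    obtain d f e h where "symb d X f" "symb e Y h" using XY by (auto simp: S_def)
    \<comment> \<open>Both summands are raised to a common degree above their own, where their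
      symbols are 0.\<close>
    then have "symb (Suc (max d e)) X (\<lambda>_. 0)" "symb (Suc (max d e)) Y (\<lambda>_. 0)"
      by (auto intro: symb_raise)
    then show ?thesis using symb.add unfolding S_def by blast
  qed
  have S_zero: "0 \<in> S" using symb_zero by (auto simp: S_def)
  have one: "1 \<in> S" using symb_one by (auto simp: S_def)
  have tgen: "tgen a g \<in> S" for a g using symb_tgen by (auto simp: S_def)
  have incl: "in_factor a (uea_incl x) \<in> S" for a x
    unfolding uea_incl_coord in_factor_add in_factor_scaleC tgen_def[symmetric]
    by (intro S_add scale tgen)
  have "in_factor a 1 = (1 :: 'n U_sl2)" for a
    by (simp add: in_factor_def pure_tensor_one[symmetric] fun_upd_def)
  then have factor: "in_factor a u \<in> S" for a u
    by (induction u rule: uea_induct)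
       (simp_all add: incl one in_factor_add in_factor_scaleC in_factor_mult S_add scale mult)
  have pure: "pure_tensor f \<in> S" for f :: "'n \<Rightarrow> sl2 uea"
  proof -
    have "pure_tensor (\<lambda>a. if a \<in> A then f a else 1) \<in> S" if "finite A" for A
      using that
    proof (induction A rule: finite_induct)
      case empty
      show ?case by (simp add: pure_tensor_one one)
    next
      case (insert a A)
      have "pure_tensor (\<lambda>b. if b \<in> insert a A then f b else 1) =
          in_factor a (f a) * pure_tensor (\<lambda>b. if b \<in> A then f b else 1)"
        unfolding in_factor_pure_tensor using insert.hyps
        by (intro arg_cong[of _ _ pure_tensor]) auto
      then show ?case using insert.IH by (simp add: mult factor)
    qed
    from this[of UNIV] show ?thesis by simp
  qed
  have "X \<in> S"
  proof (induction X rule: tensor_power.abs_induct)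
    case (1 p)
    show ?case
    proof (induction p rule: pm_induct)
      case zero
      show ?case using S_zero by (simp add: zero_tensor_power_def)
    next
      case (single t c)
      have "Poly_Mapping.single t c = cst c * mon (Tuple (entry t))"
        by (simp add: mult_single)
      then have "abs_tensor_power (Poly_Mapping.single t c) = c *\<^sub>C pure_tensor (entry t)"
        by (simp add: scaleC_tensor_power.abs_eq pure_tensor.abs_eq)
      then show ?case by (simp add: scale pure)
    next
      case (add p q)
      then show ?case
        by (simp add: S_add flip: plus_tensor_power.abs_eq)
    qed
  qed
  then show ?thesis by (simp add: S_def)
qed

section \<open>The symbol of a commutator with the diagonal\<close>

definition dgen :: "gen \<Rightarrow> 'n::finite U_sl2"
  where "dgen g = diag (ugen g)"

lemma dgen_sum: "dgen g = (\<Sum>a\<in>UNIV. tgen a g)"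
  by (simp add: dgen_def ugen_def diag_uea_incl tgen_def)

lemma dgen_tgen: "dgen g * tgen a h - tgen a h * dgen g = (\<Sum>k\<in>UNIV. ad_coeff g h k *\<^sub>C tgen a k)"
proof -
  have "dgen g * tgen a h - tgen a h * dgen g = (\<Sum>b\<in>UNIV. tgen b g * tgen a h - tgen a h * tgen b g)"
    by (simp add: dgen_sum sum_distrib_left sum_distrib_right sum_subtractf)
  also have "\<dots> = (\<Sum>b\<in>UNIV. if b = a then in_factor a (ugen g * ugen h - ugen h * ugen g) else 0)"
    by (rule sum.cong) (auto simp: tgen_def in_factor_commute in_factor_mult in_factor_diff)
  also have "\<dots> = in_factor a (\<Sum>k\<in>UNIV. ad_coeff g h k *\<^sub>C ugen k)"
    by (simp add: ugen_commutator)
  also have "\<dots> = (\<Sum>k\<in>UNIV. ad_coeff g h k *\<^sub>C tgen a k)"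
    by (simp add: sum_gen in_factor_add in_factor_scaleC tgen_def)
  finally show ?thesis .
qed

lemma flow_deriv:
  assumes "g \<noteq> Hz"
  shows "((\<lambda>t. flow g t v (a, h)) has_field_derivative
    (\<Sum>k\<in>UNIV. ad_coeff g h k * flow g t v (a, k))) (at t)"
  using assms
  by (cases g; cases h; simp add: flow_def sum_gen ad_coeff_simps)
     (auto intro!: derivative_eq_intros simp: algebra_simps)

text \<open>The commutator with \<open>dgen g\<close> is a derivation that acts on the generators of
  each factor through \<open>ad_coeff\<close>. It therefore does not raise the degree, and on
  symbols it is the derivative along the flow. For \<open>Hz\<close> the flow was chosen trivial,
  hence the restriction.\<close>

lemma symb_commutator:
  assumes "symb d X f" "g \<noteq> Hz"
  shows "\<exists>f'. symb d (dgen g * X - X * dgen g) f' \<and>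
    (\<forall>v t. ((\<lambda>t. f (flow g t v)) has_field_derivative f' (flow g t v)) (at t))"
  using assms(1)
proof (induction rule: symb.induct)
  case (const c)
  show ?case using symb_zero[of 0]
    by (intro exI[of _ "\<lambda>_. 0"]) (simp add: mult_scaleC_left mult_scaleC_right)
next
  case (gen d X f a h)
  then obtain f' where f': "symb d (dgen g * X - X * dgen g) f'"
    "\<And>v t. ((\<lambda>t. f (flow g t v)) has_field_derivative f' (flow g t v)) (at t)" by blast
  have eq: "dgen g * (tgen a h * X) - tgen a h * X * dgen g =
      (\<Sum>k\<in>UNIV. ad_coeff g h k *\<^sub>C (tgen a k * X)) + tgen a h * (dgen g * X - X * dgen g)"
  proof -
    have "dgen g * (tgen a h * X) - tgen a h * X * dgen g =
        (dgen g * tgen a h - tgen a h * dgen g) * X + tgen a h * (dgen g * X - X * dgen g)"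
      by (simp add: algebra_simps)
    then show ?thesis by (simp add: dgen_tgen sum_distrib_right mult_scaleC_left)
  qed
  have "symb (Suc d) (dgen g * (tgen a h * X) - tgen a h * X * dgen g)
      (\<lambda>v. (\<Sum>k\<in>UNIV. ad_coeff g h k * (v (a, k) * f v)) + v (a, h) * f' v)"
    unfolding eq by (intro symb.add symb_sum symb_scale symb.gen gen.hyps f'(1)) simp
  moreover have "((\<lambda>t. flow g t v (a, h) * f (flow g t v)) has_field_derivative
      (\<Sum>k\<in>UNIV. ad_coeff g h k * (flow g t v (a, k) * f (flow g t v))) + flow g t v (a, h) * f' (flow g t v)) (at t)" for v t
    using DERIV_mult'[OF flow_deriv[OF assms(2)] f'(2)]
    by (simp add: sum_distrib_right mult.assoc add.commute)
  ultimately show ?case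
    by (intro exI[of _ "\<lambda>v. (\<Sum>k\<in>UNIV. ad_coeff g h k * (v (a, k) * f v)) + v (a, h) * f' v"]) simp
next
  case (add d X f Y h)
  obtain f' where f': "symb d (dgen g * X - X * dgen g) f'"
    "\<And>v t. ((\<lambda>t. f (flow g t v)) has_field_derivative f' (flow g t v)) (at t)" using add.IH(1) by blast
  obtain h' where h': "symb d (dgen g * Y - Y * dgen g) h'"
    "\<And>v t. ((\<lambda>t. h (flow g t v)) has_field_derivative h' (flow g t v)) (at t)" using add.IH(2) by blast
  have "dgen g * (X + Y) - (X + Y) * dgen g = (dgen g * X - X * dgen g) + (dgen g * Y - Y * dgen g)"
    by (simp add: algebra_simps)
  then show ?case using symb.add[OF f'(1) h'(1)] DERIV_add[OF f'(2) h'(2)]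
    by (intro exI[of _ "\<lambda>v. f' v + h' v"]) simp
next
  case (lower d X f)
  then obtain f' where "symb d (dgen g * X - X * dgen g) f'" by blast
  from symb.lower[OF this] show ?case by (intro exI[of _ "\<lambda>_. 0"]) simp
qed

text \<open>The commutator is 0, so by uniqueness of symbols the derivative of \<open>f\<close>
  along the flow is 0 everywhere.\<close>

lemma centralizer_symb_flow:
  assumes X: "X \<in> centralizer" and f: "symb d X f"
  shows "f (flow g t v) = f v"
proof (cases "g = Hz")
  case True
  then have "flow g t v = v" by (auto simp: flow_def)
  then show ?thesis by simp
next
  case False
  obtain f' where f': "symb d (dgen g * X - X * dgen g) f'"
    "\<And>v t. ((\<lambda>t. f (flow g t v)) has_field_derivative f' (flow g t v)) (at t)"
    using symb_commutator[OF f False] by blast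
  have "dgen g * X - X * dgen g = 0" using X by (simp add: centralizer_def dgen_def)
  with f'(1) have "f' v = 0" for v using symb_unique[OF _ symb_zero] by metis
  with f'(2) have "((\<lambda>t. f (flow g t v)) has_field_derivative 0) (at t within UNIV)" for t by metis
  then obtain c where "\<And>t. f (flow g t v) = c"
    using has_field_derivative_zero_constant[of UNIV "\<lambda>t. f (flow g t v)"] by auto
  moreover have "flow g 0 v = v" by (cases g) (auto simp: flow_def fun_eq_iff split: gen.split)
  ultimately show ?thesis by metis
qed

section \<open>From invariants to the centralizer\<close>

definition ext_pt :: "('n \<Rightarrow> ix) \<Rightarrow> 'n sl2pt \<Rightarrow> ix sl2pt"
  where "ext_pt \<iota> w = (\<lambda>(b, g). if b \<in> range \<iota> then w (inv \<iota> b, g) else 0)"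

definition res_pt :: "('n \<Rightarrow> ix) \<Rightarrow> ix sl2pt \<Rightarrow> 'n sl2pt"
  where "res_pt \<iota> v = (\<lambda>(a, g). v (\<iota> a, g))"

lemma res_ext: "inj \<iota> \<Longrightarrow> res_pt \<iota> (ext_pt \<iota> w) = w"
  by (auto simp: res_pt_def ext_pt_def)

lemma ext_res:
  "inj \<iota> \<Longrightarrow> ext_pt \<iota> (res_pt \<iota> v) = rescale (\<lambda>b. if b \<in> range \<iota> then 1 else 0) v"
  by (auto simp: res_pt_def ext_pt_def rescale_def fun_eq_iff)

definition supported :: "ix set \<Rightarrow> ix option \<times> (ix \<times> ix \<Rightarrow> nat) \<Rightarrow> bool"
  where "supported R i \<longleftrightarrow> (\<forall>a b. snd i (a, b) \<noteq> 0 \<longrightarrow> a \<in> R \<and> b \<in> R) \<and>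
    (\<forall>s. fst i = Some s \<longrightarrow> - {s} \<subseteq> R)"

text \<open>Each factor is multiplied by the scalars 0 or 1 at its indices. This singles out the
  standard monomials that remain visible when there are fewer than four tensor factors.\<close>

lemma invmon_cut:
  assumes "i \<in> standard"
  shows "invmon i (rescale (\<lambda>b. if b \<in> R then 1 else 0) v) = (if supported R i then invmon i v else 0)"
proof -
  let ?u = "rescale (\<lambda>b. if b \<in> R then 1 else 0) v"
  let ?P = "\<forall>a b. snd i (a, b) \<noteq> 0 \<longrightarrow> a \<in> R \<and> b \<in> R"
  have P: "pmon (snd i) ?u = (if ?P then pmon (snd i) v else 0)"
  proof (cases ?P)
    case True
    then have "pmon (snd i) ?u = pmon (snd i) v"
      unfolding pmon_def pairing_rescale
    proof (intro prod.cong refl)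
      fix p
      show "((if fst p \<in> R then 1 else 0) * (if snd p \<in> R then 1 else 0) * pairing (fst p) (snd p) v) ^ snd i p =
          pairing (fst p) (snd p) v ^ snd i p"
        using True by (cases "snd i p = 0"; cases p) auto
    qed
    with True show ?thesis by simp
  next
    case False
    then obtain a b where ab: "snd i (a, b) \<noteq> 0" "\<not> (a \<in> R \<and> b \<in> R)" by blast
    have "\<forall>p. p \<notin> upper \<longrightarrow> snd i p = 0" using assms by (simp add: standard_def)
    with ab(1) have "(a, b) \<in> upper" by metis
    then have "pmon (snd i) ?u = 0"
      unfolding pmon_def pairing_rescale using ab
      by (intro prod_zero finite_upper bexI[of _ "(a, b)"]) (auto simp: zero_power)
    with False show ?thesis by (simp only: if_False)
  qed
  have Q: "omit_opt t ?u = (if \<forall>s. t = Some s \<longrightarrow> - {s} \<subseteq> R then omit_opt t v else 0)" for t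
  proof (cases t)
    case (Some s)
    have o: "omit_opt t w = omit s w" for w by (simp add: Some omit_opt_def)
    have cond: "(\<forall>s. t = Some s \<longrightarrow> - {s} \<subseteq> R) = (- {s} \<subseteq> R)" by (simp only: Some option.inject) blast
    show ?thesis
    proof (cases "- {s} \<subseteq> R")
      case True
      then have "(\<Prod>c\<in>UNIV. (if c \<in> R then 1 else 0) ^ (if c = s then 0 else 1)) = (1 :: complex)"
        by (intro prod.neutral) auto
      with True show ?thesis unfolding o cond by (simp only: omit_rescale if_True if_False mult_1_left mult_zero_left)
    next
      case False
      then obtain c where c: "c \<noteq> s" "c \<notin> R" by auto
      then have "(\<Prod>c\<in>UNIV. (if c \<in> R then 1 else 0) ^ (if c = s then 0 else 1)) = (0 :: complex)"
        by (intro prod_zero finite bexI[of _ c]) auto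
      with False show ?thesis unfolding o cond by (simp only: omit_rescale if_True if_False mult_1_left mult_zero_left)
    qed
  qed (simp add: omit_opt_def)
  show ?thesis unfolding invmon_def P Q supported_def
    by (simp only: if_distrib[of "\<lambda>x. x * _"] mult_zero_left mult_zero_right split: if_split) auto
qed

lemma flow_rescale: "flow g t (rescale s v) = rescale s (flow g t v)"
  by (cases g) (auto simp: flow_def rescale_def fun_eq_iff algebra_simps split: gen.split)

lemma flow_res: "res_pt \<iota> (flow g t v) = flow g t (res_pt \<iota> v)"
  by (cases g) (auto simp: flow_def res_pt_def fun_eq_iff split: gen.split)

lemma rescale_res: "res_pt \<iota> (rescale s v) = rescale (\<lambda>a. s (\<iota> a)) (res_pt \<iota> v)"
  by (auto simp: rescale_def res_pt_def)

definition multideg :: "('n \<times> gen \<Rightarrow> nat) \<Rightarrow> 'n \<Rightarrow> nat"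
  where "multideg \<alpha> a = (\<Sum>g\<in>UNIV. \<alpha> (a, g))"

lemma monf_rescale: "monf \<alpha> (rescale s v) = (\<Prod>a\<in>UNIV. s a ^ multideg \<alpha> a) * monf \<alpha> (v :: 'n::finite sl2pt)"
proof -
  have "(\<Prod>p\<in>UNIV. s (fst p) ^ \<alpha> p) = (\<Prod>a\<in>UNIV. \<Prod>g\<in>UNIV. s a ^ \<alpha> (a, g))"
    by (simp add: prod.cartesian_product case_prod_unfold)
  also have "\<dots> = (\<Prod>a\<in>UNIV. s a ^ multideg \<alpha> a)"
    by (simp add: multideg_def power_sum)
  finally show ?thesis by (simp add: monf_def rescale_def power_mult_distrib prod.distrib)
qed

lemma polyf_monf: "polyf (monf \<alpha>)"
  unfolding monf_def[abs_def] by (intro polyf_prod polyf_power polyf_coord)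

lemma std_span_sum: "finite A \<Longrightarrow> (\<And>i. i \<in> A \<Longrightarrow> std_span d (f i)) \<Longrightarrow> std_span d (\<lambda>v. \<Sum>i\<in>A. f i v)"
  by (induction A rule: finite_induct) (simp_all add: std_span.zero std_span.add)

text \<open>The symbol of a central element is split into its multihomogeneous components, each of which is
  again invariant.\<close>

lemma std_span_symb:
  fixes \<iota> :: "'n::finite \<Rightarrow> ix"
  assumes X: "X \<in> centralizer" and f: "symb d X f"
  shows "std_span d (\<lambda>v. f (res_pt \<iota> v))"
proof -
  obtain c where c: "\<And>v. f v = (\<Sum>\<alpha>\<in>multiidx d. c \<alpha> * monf \<alpha> v)"
    using symb_rep[OF f] by blast
  define F where "F = (\<lambda>D v. \<Sum>\<alpha>\<in>{\<alpha> \<in> multiidx d. multideg \<alpha> = D}. c \<alpha> * monf \<alpha> (v :: 'n sl2pt))"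
  let ?D = "multideg ` (multiidx d :: ('n \<times> gen \<Rightarrow> nat) set)"
  have fF: "f v = (\<Sum>D\<in>?D. F D v)" for v
    unfolding c F_def by (rule sum.image_gen) simp
  have Fscale: "F D (rescale s v) = (\<Prod>a\<in>UNIV. s a ^ D a) * F D v" for D s v
    unfolding F_def sum_distrib_left
    by (rule sum.cong) (simp_all add: monf_rescale mult_ac)
  have Fpoly: "polyf (F D)" for D
    unfolding F_def by (intro polyf_sum polyf_mult polyf.const polyf_monf)
  \<comment> \<open>The flow commutes with rescaling, so the invariance of \<open>f\<close> is a
    relation between distinct characters of the scaling torus and splits into its
    components.\<close>
  have Finv: "F D (flow g t v) = F D v" if "D \<in> ?D" for D g t v
  proof -
    have "F D (flow g t v) - F D v = 0"
    proof (rule monomials_indep[of ?D "\<lambda>D. F D (flow g t v) - F D v"])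
      fix s :: "'n \<Rightarrow> complex"
      have "0 = f (flow g t (rescale s v)) - f (rescale s v)"
        using centralizer_symb_flow[OF X f] by simp
      also have "\<dots> = (\<Sum>D\<in>?D. (F D (flow g t v) - F D v) * (\<Prod>a\<in>UNIV. s a ^ D a))"
        unfolding flow_rescale fF Fscale sum_subtractf[symmetric]
        by (rule sum.cong) (simp_all add: algebra_simps)
      finally show "(\<Sum>D\<in>?D. (F D (flow g t v) - F D v) * (\<Prod>a\<in>UNIV. s a ^ D a)) = 0" by simp
    qed (use that in simp_all)
    then show ?thesis by simp
  qed
  have "std_span d (\<lambda>v. F D (res_pt \<iota> v))" if D: "D \<in> ?D" for D
  proof -
    define D' where "D' = (\<lambda>b. \<Sum>a\<in>UNIV. if \<iota> a = b then D a else 0)"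
    have "homog D' (\<lambda>v. F D (res_pt \<iota> v))"
      unfolding homog_def rescale_res Fscale
    proof (intro allI)
      fix s :: "ix \<Rightarrow> complex" and v :: "ix sl2pt"
      have "(\<Prod>b\<in>UNIV. s b ^ D' b) = (\<Prod>b\<in>UNIV. \<Prod>a\<in>UNIV. if \<iota> a = b then s b ^ D a else 1)"
        unfolding D'_def power_sum by (intro prod.cong refl) simp
      also have "\<dots> = (\<Prod>a\<in>UNIV. \<Prod>b\<in>UNIV. if \<iota> a = b then s b ^ D a else 1)"
        by (rule prod.swap)
      also have "\<dots> = (\<Prod>a\<in>UNIV. s (\<iota> a) ^ D a)" by simp
      finally show "(\<Prod>a\<in>UNIV. s (\<iota> a) ^ D a) * F D (res_pt \<iota> v) =
        (\<Prod>b\<in>UNIV. s b ^ D' b) * F D (res_pt \<iota> v)" by simp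
    qed
    moreover have "polyf (\<lambda>v. F D (res_pt \<iota> v))"
    proof (rule polyf_subst[where \<sigma> = "res_pt \<iota>", OF Fpoly])
      show "polyf (\<lambda>v. res_pt \<iota> v p)" for p
        by (cases p) (simp add: res_pt_def polyf_coord)
    qed
    moreover have "F D (res_pt \<iota> (flow g t v)) = F D (res_pt \<iota> v)" for g t v
      unfolding flow_res using D by (rule Finv)
    ultimately have "std_span (\<Sum>b\<in>UNIV. D' b) (\<lambda>v. F D (res_pt \<iota> v))"
      by (intro std_span_invariants)
    moreover have "(\<Sum>b\<in>UNIV. D' b) = d"
    proof -
      have "(\<Sum>b\<in>UNIV. D' b) = (\<Sum>a\<in>UNIV. D a)"
        unfolding D'_def by (subst sum.swap) simp
      also have "\<dots> = d" using D by (auto simp: multiidx_def multideg_def sum_pairs)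
      finally show ?thesis .
    qed
    ultimately show ?thesis by simp
  qed
  then show ?thesis unfolding fF by (intro std_span_sum) simp_all
qed

lemma std_span_explicit:
  assumes "std_span d f"
  shows "\<exists>J c. finite J \<and> J \<subseteq> {i \<in> standard. invdeg i = d} \<and> (\<forall>v. f v = (\<Sum>i\<in>J. c i * invmon i v))"
  using assms
proof (induction rule: std_span.induct)
  case (zero d)
  show ?case by (rule exI[of _ "{}"]) simp
next
  case (add d f g)
  obtain J c where J: "finite J" "J \<subseteq> {i \<in> standard. invdeg i = d}"
    "\<And>v. f v = (\<Sum>i\<in>J. c i * invmon i v)" using add.IH(1) by blast
  obtain K b where K: "finite K" "K \<subseteq> {i \<in> standard. invdeg i = d}"
    "\<And>v. g v = (\<Sum>i\<in>K. b i * invmon i v)" using add.IH(2) by blast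
  have "f v + g v = (\<Sum>i\<in>J \<union> K. ((if i \<in> J then c i else 0) + (if i \<in> K then b i else 0)) * invmon i v)" for v
  proof -
    have "(\<Sum>i\<in>J \<union> K. (if i \<in> J then c i else 0) * invmon i v) = f v"
      unfolding J(3) by (rule sum.mono_neutral_cong_right) (use J(1) K(1) in auto)
    moreover have "(\<Sum>i\<in>J \<union> K. (if i \<in> K then b i else 0) * invmon i v) = g v"
      unfolding K(3) by (rule sum.mono_neutral_cong_right) (use J(1) K(1) in auto)
    ultimately show ?thesis by (simp only: distrib_right sum.distrib)
  qed
  then show ?case using J(1,2) K(1,2)
    by (intro exI[of _ "J \<union> K"] exI[of _ "\<lambda>i. (if i \<in> J then c i else 0) + (if i \<in> K then b i else 0)"]) simp
next
  case (mon i d c)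
  then show ?case by (intro exI[of _ "{i}"] exI[of _ "\<lambda>_. c"]) simp
qed

lemma is_basis_familyI:
  fixes M :: "'i \<Rightarrow> 'v::complex_vector"
  assumes indep: "\<And>J c i. finite J \<Longrightarrow> J \<subseteq> I \<Longrightarrow> (\<Sum>i\<in>J. c i *\<^sub>C M i) = 0 \<Longrightarrow> i \<in> J \<Longrightarrow> c i = 0"
    and span: "cspan (M ` I) = V"
  shows "is_basis_family M I V"
  unfolding is_basis_family_def
proof (intro conjI span)
  show inj: "inj_on M I"
  proof (rule inj_onI, rule ccontr)
    fix i j assume ij: "i \<in> I" "j \<in> I" "M i = M j" "i \<noteq> j"
    \<comment> \<open>Two indices with the same vector would give the relation with coefficients 1
      and - 1.\<close>
    have "(\<Sum>k\<in>{i, j}. (if k = i then 1 else - 1) *\<^sub>C M k) = 0"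
      using ij by (simp add: scaleC_one cvec.scale_minus_left)
    then have "(if i = i then 1 else - 1 :: complex) = 0"
      using ij by (intro indep[of "{i, j}" "\<lambda>k. if k = i then 1 else - 1" i]) auto
    then show False by simp
  qed
  show "\<not> cdependent (M ` I)"
  proof
    assume "cdependent (M ` I)"
    then obtain t u where t: "finite t" "t \<subseteq> M ` I" "(\<Sum>v\<in>t. u v *\<^sub>C v) = 0" "\<exists>v\<in>t. u v \<noteq> 0"
      unfolding cvec.dependent_explicit by blast
    obtain J where J: "J \<subseteq> I" "t = M ` J" using t(2) by (metis subset_imageE)
    have injJ: "inj_on M J" using inj J(1) by (rule inj_on_subset)
    have "finite J" using t(1) injJ J(2) finite_imageD by blast
    moreover have "(\<Sum>i\<in>J. u (M i) *\<^sub>C M i) = 0"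
      using t(3) unfolding J(2) sum.reindex[OF injJ] by simp
    ultimately have "u (M i) = 0" if "i \<in> J" for i using indep[of J "\<lambda>i. u (M i)" i] J(1) that by blast
    then show False using t(4) J(2) by blast
  qed
qed

lemma csubspace_centralizer: "csubspace (centralizer :: ('g::complex_lie_algebra uea, 'n::finite) tensor_power set)"
  unfolding cvec.subspace_def centralizer_def
  by (simp add: distrib_left distrib_right mult_scaleC_left mult_scaleC_right)

text \<open>It suffices to know the symbols of the elements of a family: they have to be the standard
  monomials that only involve the indices in the range of \<open>\<iota>\<close>.\<close>

theorem centralizer_basis:
  fixes \<iota> :: "'n::finite \<Rightarrow> ix" and M :: "'i \<Rightarrow> 'n U_sl2"
  assumes \<iota>: "inj \<iota>" and \<kappa>: "bij_betw \<kappa> I {i \<in> standard. supported (range \<iota>) i}"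
    and M: "\<And>i. i \<in> I \<Longrightarrow> M i \<in> centralizer"
    and symb: "\<And>i. i \<in> I \<Longrightarrow> symb (invdeg (\<kappa> i)) (M i) (\<lambda>w. invmon (\<kappa> i) (ext_pt \<iota> w))"
  shows "is_basis_family M I centralizer"
proof (rule is_basis_familyI)
  have \<kappa>I: "\<kappa> i \<in> standard" "supported (range \<iota>) (\<kappa> i)" if "i \<in> I" for i
    using bij_betwE[OF \<kappa>] that by blast+
  fix J c i assume J: "finite J" "J \<subseteq> I" "(\<Sum>i\<in>J. c i *\<^sub>C M i) = 0" "i \<in> J"
  show "c i = 0"
  proof (rule ccontr)
    assume ci: "c i \<noteq> 0"
    define J' where "J' = {i \<in> J. c i \<noteq> 0}"
    have J': "finite J'" "J' \<subseteq> I" "i \<in> J'" using J ci by (auto simp: J'_def)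
    \<comment> \<open>In degree \<open>d\<close>, the top filtration degree that occurs, all terms
      of smaller degree have symbol 0.\<close>
    define d where "d = Max ((\<lambda>i. invdeg (\<kappa> i)) ` J')"
    have le: "invdeg (\<kappa> j) \<le> d" if "j \<in> J'" for j
      unfolding d_def using J'(1) that by (intro Max_ge) auto
    have "d \<in> (\<lambda>i. invdeg (\<kappa> i)) ` J'"
      unfolding d_def using J'(1,3) by (intro Max_in) auto
    then obtain i0 where i0: "i0 \<in> J'" "invdeg (\<kappa> i0) = d" by blast
    have "(\<Sum>j\<in>J'. c j *\<^sub>C M j) = (\<Sum>j\<in>J. c j *\<^sub>C M j)"
      by (rule sum.mono_neutral_left) (use J(1) in \<open>auto simp: J'_def\<close>)
    then have zero: "(\<Sum>j\<in>J'. c j *\<^sub>C M j) = 0" using J(3) by simp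
    define T where "T = {j \<in> J'. invdeg (\<kappa> j) = d}"
    have "symb d (\<Sum>j\<in>J'. c j *\<^sub>C M j)
        (\<lambda>w. \<Sum>j\<in>J'. c j * (if invdeg (\<kappa> j) = d then invmon (\<kappa> j) (ext_pt \<iota> w) else 0))"
    proof (intro symb_sum J'(1) symb_scale)
      fix j assume j: "j \<in> J'"
      show "symb d (M j) (\<lambda>w. if invdeg (\<kappa> j) = d then invmon (\<kappa> j) (ext_pt \<iota> w) else 0)"
        using symb[of j] symb_raise[OF symb[of j], of d] le[OF j] j J'(2)
        by (cases "invdeg (\<kappa> j) = d") auto
    qed
    then have "(\<Sum>j\<in>J'. c j * (if invdeg (\<kappa> j) = d then invmon (\<kappa> j) (ext_pt \<iota> w) else 0)) = 0" for w
      unfolding zero using symb_unique[OF _ symb_zero] by fastforce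
    moreover have "(\<Sum>j\<in>J'. c j * (if invdeg (\<kappa> j) = d then invmon (\<kappa> j) (ext_pt \<iota> w) else 0)) =
        (\<Sum>j\<in>T. c j * invmon (\<kappa> j) (ext_pt \<iota> w))" for w
      by (rule sum.mono_neutral_cong_right) (use J'(1) in \<open>auto simp: T_def\<close>)
    ultimately have T0: "(\<Sum>j\<in>T. c j * invmon (\<kappa> j) (ext_pt \<iota> w)) = 0" for w by simp
    have TI: "T \<subseteq> I" using J'(2) by (auto simp: T_def)
    have inj: "inj_on \<kappa> T" using \<kappa> TI by (meson bij_betw_def inj_on_subset)
    have "c (the_inv_into T \<kappa> (\<kappa> i0)) = 0"
    proof (rule invmon_independent)
      show "finite (\<kappa> ` T)" using J'(1) by (simp add: T_def)
      show "\<kappa> ` T \<subseteq> standard" using \<kappa>I TI by blast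
      show "\<kappa> i0 \<in> \<kappa> ` T" using i0 by (simp add: T_def)
      fix v
      have "(\<Sum>j\<in>\<kappa> ` T. c (the_inv_into T \<kappa> j) * invmon j v) = (\<Sum>j\<in>T. c j * invmon (\<kappa> j) v)"
        by (simp add: sum.reindex[OF inj] the_inv_into_f_f[OF inj])
      \<comment> \<open>The monomials are supported on the range of \<open>\<iota>\<close>, so the
        relation at padded points holds at all points with four matrices, where independence is
        known.\<close>
      also have "\<dots> = (\<Sum>j\<in>T. c j * invmon (\<kappa> j) (ext_pt \<iota> (res_pt \<iota> v)))"
        using TI \<kappa>I by (intro sum.cong refl) (simp add: ext_res[OF \<iota>] invmon_cut subsetD)
      also have "\<dots> = 0" by (rule T0)
      finally show "(\<Sum>j\<in>\<kappa> ` T. c (the_inv_into T \<kappa> j) * invmon j v) = 0" .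
    qed
    moreover have "i0 \<in> T" using i0 by (simp add: T_def)
    ultimately have "c i0 = 0" by (simp add: the_inv_into_f_f[OF inj])
    then show False using i0 by (simp add: J'_def)
  qed
next
  \<comment> \<open>Descent along the filtration: the combination of the \<open>M i\<close> with the
    same symbol as \<open>X\<close> is subtracted, which leaves an element of the centralizer of
    smaller degree, or 0.\<close>
  have "X \<in> cspan (M ` I)" if "X \<in> centralizer" "symb d X f" for d X f
    using that
  proof (induction d arbitrary: X f rule: less_induct)
    case (less d)
    obtain J c where J: "finite J" "J \<subseteq> {i \<in> standard. invdeg i = d}"
      "\<And>v. f (res_pt \<iota> v) = (\<Sum>i\<in>J. c i * invmon i v)"
      using std_span_explicit[OF std_span_symb[OF less.prems, of \<iota>]] by blast
    define K where "K = {i \<in> I. \<kappa> i \<in> J}"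
    have inj: "inj_on \<kappa> I" using \<kappa> by (rule bij_betw_imp_inj_on)
    have injK: "inj_on \<kappa> K" using inj by (rule inj_on_subset) (auto simp: K_def)
    have \<kappa>K: "\<kappa> ` K = {i \<in> J. supported (range \<iota>) i}"
    proof -
      have "\<kappa> ` I = {i \<in> standard. supported (range \<iota>) i}" using \<kappa> by (rule bij_betw_imp_surj_on)
      moreover have "\<kappa> ` K = \<kappa> ` I \<inter> J" by (auto simp: K_def)
      ultimately show ?thesis using J(2) by auto
    qed
    have K: "finite K" by (rule finite_imageD[OF _ injK]) (simp add: \<kappa>K J(1))
    have f: "f w = (\<Sum>i\<in>K. c (\<kappa> i) * invmon (\<kappa> i) (ext_pt \<iota> w))" for w
    proof -
      have cut: "invmon i (ext_pt \<iota> w) = (if supported (range \<iota>) i then invmon i (ext_pt \<iota> w) else 0)" if "i \<in> J" for i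
      proof -
        have "ext_pt \<iota> w = rescale (\<lambda>b. if b \<in> range \<iota> then 1 else 0) (ext_pt \<iota> w)"
          by (auto simp: ext_pt_def rescale_def)
        then show ?thesis using invmon_cut[of i "range \<iota>" "ext_pt \<iota> w"] J(2) that by auto
      qed
      have "f w = (\<Sum>i\<in>J. c i * invmon i (ext_pt \<iota> w))"
        using J(3)[of "ext_pt \<iota> w"] by (simp add: res_ext[OF \<iota>])
      also have "\<dots> = (\<Sum>i\<in>\<kappa> ` K. c i * invmon i (ext_pt \<iota> w))"
        unfolding \<kappa>K using J(1)
        by (intro sum.mono_neutral_right) (auto simp: cut[THEN trans])
      finally show ?thesis by (simp add: sum.reindex[OF injK])
    qed
    define Y where "Y = X - (\<Sum>i\<in>K. c (\<kappa> i) *\<^sub>C M i)"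
    have sM: "(\<Sum>i\<in>K. c (\<kappa> i) *\<^sub>C M i) \<in> cspan (M ` I)"
      by (intro cvec.span_sum cvec.span_scale cvec.span_base) (auto simp: K_def)
    have KI: "i \<in> I" "invdeg (\<kappa> i) = d" if "i \<in> K" for i
      using that J(2) by (auto simp: K_def)
    have "(\<Sum>i\<in>K. c (\<kappa> i) *\<^sub>C M i) \<in> centralizer"
      using KI M by (intro cvec.subspace_sum csubspace_centralizer cvec.subspace_scale) auto
    then have Y: "Y \<in> centralizer"
      unfolding Y_def by (intro cvec.subspace_diff csubspace_centralizer less.prems(1))
    have "symb d (\<Sum>i\<in>K. c (\<kappa> i) *\<^sub>C M i) f"
    proof -
      have "symb d (\<Sum>i\<in>K. c (\<kappa> i) *\<^sub>C M i) (\<lambda>w. \<Sum>i\<in>K. c (\<kappa> i) * invmon (\<kappa> i) (ext_pt \<iota> w))"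
        using symb KI by (intro symb_sum K symb_scale) metis
      then show ?thesis by (simp flip: f)
    qed
    from symb_diff[OF less.prems(2) this] have Y0: "symb d Y (\<lambda>_. 0)" by (simp add: Y_def)
    have "Y \<in> cspan (M ` I)"
    proof (cases d)
      case 0
      then have "Y = 0" using symb_zero_deg Y0 by blast
      then show ?thesis by (simp add: cvec.span_zero)
    next
      case (Suc e)
      then obtain h where "symb e Y h" using tpbw_less_symb symb_null[OF Y0] by blast
      with Y show ?thesis using less.IH Suc by blast
    qed
    then have "Y + (\<Sum>i\<in>K. c (\<kappa> i) *\<^sub>C M i) \<in> cspan (M ` I)" using sM by (rule cvec.span_add)
    then show ?case by (simp add: Y_def)
  qed
  then have "centralizer \<subseteq> cspan (M ` I)" using ex_symb by blast
  moreover have "cspan (M ` I) \<subseteq> centralizer"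
    using M by (intro cvec.span_minimal csubspace_centralizer) auto
  ultimately show "cspan (M ` I) = centralizer" by simp
qed

section \<open>Polarized traces\<close>

lemma e_at_tgen:
  "e_at 1 2 a = tgen a Ep" "e_at 1 1 a = tgen a Hz" "e_at 2 1 a = tgen a Fm"
  "e_at 2 2 a = - tgen a Hz"
proof -
  have "sl2_e 2 2 = (- 1) *\<^sub>C sl2_e 1 1"
    using sl2_e_trace by (simp add: cvec.scale_minus_left scaleC_one eq_neg_iff_add_eq_0 add.commute)
  then have "e_at 2 2 a = (- 1) *\<^sub>C tgen a Hz"
    by (simp only: e_at_def tgen_def ugen_def sl2_gen_def gen.case uea_incl_scaleC in_factor_scaleC)
  then show "e_at 2 2 a = - tgen a Hz"
    by (simp add: cvec.scale_minus_left scaleC_one)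
qed (simp_all add: e_at_def tgen_def ugen_def sl2_gen_def)

lemma trP_tgen:
  "trP a b = tgen a Hz * tgen b Hz + tgen a Fm * tgen b Ep + tgen a Ep * tgen b Fm + tgen a Hz * tgen b Hz"
  by (simp add: trP_def sum_2 e_at_tgen)

lemma trF_tgen:
  "trF a b c = - (tgen a Hz * tgen b Hz * tgen c Hz + tgen a Hz * tgen b Fm * tgen c Ep
    + tgen a Fm * tgen b Ep * tgen c Hz - tgen a Fm * tgen b Hz * tgen c Ep
    + tgen a Ep * tgen b Hz * tgen c Fm - tgen a Ep * tgen b Fm * tgen c Hz
    - tgen a Hz * tgen b Ep * tgen c Fm - tgen a Hz * tgen b Hz * tgen c Hz)"
  by (simp add: trF_def sum_2 e_at_tgen algebra_simps)

lemma symb_cong: "symb d X f \<Longrightarrow> d = d' \<Longrightarrow> (\<And>v. f v = h v) \<Longrightarrow> symb d' X h"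
  by (metis ext)

lemma symb_trP: "symb 2 (trP a b) (pairing a b)"
proof -
  have t: "symb 2 (tgen a g * tgen b h) (\<lambda>v. v (a, g) * v (b, h))" for g h
    using symb_mult[OF symb_tgen symb_tgen, of a g b h] by (rule symb_cong) simp_all
  show ?thesis unfolding trP_tgen
    by (rule symb_cong[OF symb.add[OF symb.add[OF symb.add[OF t t] t] t]])
       (simp_all add: pairing_def algebra_simps)
qed

lemma symb_trF: "symb 3 (trF a b c) (triple a b c)"
proof -
  have t: "symb 3 (tgen a g * tgen b h * tgen c k) (\<lambda>v. v (a, g) * v (b, h) * v (c, k))" for g h k
    using symb_mult[OF symb_mult[OF symb_tgen symb_tgen] symb_tgen, of a g b h c k]
    by (rule symb_cong) simp_all
  show ?thesis unfolding trF_tgen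
    by (rule symb_cong[OF symb_uminus[OF symb_diff[OF symb_diff[OF symb_diff[OF symb.add[OF symb_diff[OF
          symb.add[OF symb.add[OF t t] t] t] t] t] t] t]]])
       (simp_all add: triple_def algebra_simps)
qed

text \<open>Oriented as rewrite rules that move \<open>dgen\<close> to the right through a product;
  what they leave behind for the traces cancels.\<close>

lemma dgen_tgen_simps:
  "dgen Ep * tgen a Ep = tgen a Ep * dgen Ep"
  "dgen Ep * tgen a Hz = tgen a Hz * dgen Ep - tgen a Ep"
  "dgen Ep * tgen a Fm = tgen a Fm * dgen Ep + tgen a Hz + tgen a Hz"
  "dgen Hz * tgen a Ep = tgen a Ep * dgen Hz + tgen a Ep"
  "dgen Hz * tgen a Hz = tgen a Hz * dgen Hz"
  "dgen Hz * tgen a Fm = tgen a Fm * dgen Hz - tgen a Fm"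
  "dgen Fm * tgen a Ep = tgen a Ep * dgen Fm - tgen a Hz - tgen a Hz"
  "dgen Fm * tgen a Hz = tgen a Hz * dgen Fm + tgen a Fm"
  "dgen Fm * tgen a Fm = tgen a Fm * dgen Fm"
proof -
  have two: "2 *\<^sub>C x = x + x" "(- 2) *\<^sub>C x = - x - x" for x :: "'a U_sl2"
    using scaleC_add_left[of 1 1 x] by (simp_all add: scaleC_one cvec.scale_minus_left)
  have "dgen g * tgen a h = tgen a h * dgen g + (\<Sum>k\<in>UNIV. ad_coeff g h k *\<^sub>C tgen a k)" for g h
    using dgen_tgen[of g a h] by (simp add: algebra_simps)
  then show
    "dgen Ep * tgen a Ep = tgen a Ep * dgen Ep"
    "dgen Ep * tgen a Hz = tgen a Hz * dgen Ep - tgen a Ep"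
    "dgen Ep * tgen a Fm = tgen a Fm * dgen Ep + tgen a Hz + tgen a Hz"
    "dgen Hz * tgen a Ep = tgen a Ep * dgen Hz + tgen a Ep"
    "dgen Hz * tgen a Hz = tgen a Hz * dgen Hz"
    "dgen Hz * tgen a Fm = tgen a Fm * dgen Hz - tgen a Fm"
    "dgen Fm * tgen a Ep = tgen a Ep * dgen Fm - tgen a Hz - tgen a Hz"
    "dgen Fm * tgen a Hz = tgen a Hz * dgen Fm + tgen a Fm"
    "dgen Fm * tgen a Fm = tgen a Fm * dgen Fm"
    by (simp_all add: sum_gen ad_coeff_simps scaleC_one two cvec.scale_minus_left)
qed

lemma dgen_tgen_mult:
  "dgen Ep * (tgen a Ep * x) = tgen a Ep * (dgen Ep * x)"
  "dgen Ep * (tgen a Hz * x) = tgen a Hz * (dgen Ep * x) - tgen a Ep * x"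
  "dgen Ep * (tgen a Fm * x) = tgen a Fm * (dgen Ep * x) + tgen a Hz * x + tgen a Hz * x"
  "dgen Hz * (tgen a Ep * x) = tgen a Ep * (dgen Hz * x) + tgen a Ep * x"
  "dgen Hz * (tgen a Hz * x) = tgen a Hz * (dgen Hz * x)"
  "dgen Hz * (tgen a Fm * x) = tgen a Fm * (dgen Hz * x) - tgen a Fm * x"
  "dgen Fm * (tgen a Ep * x) = tgen a Ep * (dgen Fm * x) - tgen a Hz * x - tgen a Hz * x"
  "dgen Fm * (tgen a Hz * x) = tgen a Hz * (dgen Fm * x) + tgen a Fm * x"
  "dgen Fm * (tgen a Fm * x) = tgen a Fm * (dgen Fm * x)"
  by (simp_all add: dgen_tgen_simps algebra_simps flip: mult.assoc)

lemma dgen_trP: "dgen g * trP a b = trP a b * dgen g"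
  by (cases g) (simp_all add: trP_tgen dgen_tgen_simps dgen_tgen_mult algebra_simps)

lemma dgen_trF: "dgen g * trF a b c = trF a b c * dgen g"
  by (cases g) (simp_all add: trF_tgen dgen_tgen_simps dgen_tgen_mult algebra_simps)

text \<open>The three basis elements generate the enveloping algebra, and the elements whose
  diagonal image commutes with \<open>X\<close> form a subalgebra.\<close>

lemma centralizerI:
  assumes "\<And>g. dgen g * X = X * dgen g"
  shows "X \<in> centralizer"
proof -
  have "diag u * X = X * diag u" for u
  proof (induction u rule: uea_induct)
    case (incl x)
    have "diag (uea_incl x) = coordE x *\<^sub>C dgen Ep + coordH x *\<^sub>C dgen Hz + coordF x *\<^sub>C (dgen Fm :: 'a U_sl2)"
      by (simp add: uea_incl_coord diag_add diag_scaleC dgen_def)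
    then show ?case
      by (simp add: distrib_left distrib_right mult_scaleC_left mult_scaleC_right assms)
  next
    case (mult u v)
    then show ?case by (metis diag_mult mult.assoc)
  qed (simp_all add: diag_one diag_add diag_scaleC distrib_left distrib_right mult_scaleC_left mult_scaleC_right)
  then show ?thesis by (simp add: centralizer_def)
qed

lemma centralizer_mult: "X \<in> centralizer \<Longrightarrow> Y \<in> centralizer \<Longrightarrow> X * Y \<in> centralizer"
  by (simp add: centralizer_def) (metis mult.assoc)

lemma centralizer_power: "X \<in> centralizer \<Longrightarrow> X ^ k \<in> centralizer"
  by (induction k) (simp_all add: centralizer_mult, simp add: centralizer_def)

lemma trP_centralizer: "trP a b \<in> centralizer"
  by (rule centralizerI) (rule dgen_trP)

lemma trF_centralizer: "trF a b c \<in> centralizer"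
  by (rule centralizerI) (rule dgen_trF)

lemmas trace_centralizer = centralizer_mult centralizer_power trP_centralizer trF_centralizer

section \<open>Reading the families of the theorem as standard monomials\<close>

lemma pairing_ext: "inj \<iota> \<Longrightarrow> pairing (\<iota> a) (\<iota> b) (ext_pt \<iota> w) = pairing a b w"
  by (simp add: pairing_def ext_pt_def)

lemma triple_ext: "inj \<iota> \<Longrightarrow> triple (\<iota> a) (\<iota> b) (\<iota> c) (ext_pt \<iota> w) = triple a b c w"
  by (simp add: triple_def ext_pt_def)

text \<open>The exponents are listed row by row, as in the theorem; the entries below the diagonal
  are 0, as \<open>standard\<close> requires.\<close>

definition expt :: "nat \<Rightarrow> nat \<Rightarrow> nat \<Rightarrow> nat \<Rightarrow> nat \<Rightarrow> nat \<Rightarrow> nat \<Rightarrow> nat \<Rightarrow> nat \<Rightarrow> nat \<Rightarrow> ix \<times> ix \<Rightarrow> nat"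
  where "expt e11 e12 e13 e14 e22 e23 e24 e33 e34 e44 = (\<lambda>(a, b). case a of
      I1 \<Rightarrow> (case b of I1 \<Rightarrow> e11 | I2 \<Rightarrow> e12 | I3 \<Rightarrow> e13 | I4 \<Rightarrow> e14)
    | I2 \<Rightarrow> (case b of I1 \<Rightarrow> 0 | I2 \<Rightarrow> e22 | I3 \<Rightarrow> e23 | I4 \<Rightarrow> e24)
    | I3 \<Rightarrow> (case b of I1 \<Rightarrow> 0 | I2 \<Rightarrow> 0 | I3 \<Rightarrow> e33 | I4 \<Rightarrow> e34)
    | I4 \<Rightarrow> (case b of I1 \<Rightarrow> 0 | I2 \<Rightarrow> 0 | I3 \<Rightarrow> 0 | I4 \<Rightarrow> e44))"

lemma expt_eta:
  assumes "\<And>p. p \<notin> upper \<Longrightarrow> \<alpha> p = 0"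
  shows "expt (\<alpha> (I1, I1)) (\<alpha> (I1, I2)) (\<alpha> (I1, I3)) (\<alpha> (I1, I4)) (\<alpha> (I2, I2)) (\<alpha> (I2, I3))
    (\<alpha> (I2, I4)) (\<alpha> (I3, I3)) (\<alpha> (I3, I4)) (\<alpha> (I4, I4)) = \<alpha>"
proof
  fix p
  have "\<alpha> (I2, I1) = 0" "\<alpha> (I3, I1) = 0" "\<alpha> (I3, I2) = 0" "\<alpha> (I4, I1) = 0" "\<alpha> (I4, I2) = 0" "\<alpha> (I4, I3) = 0"
    by (simp_all add: assms upper_def)
  then show "expt (\<alpha> (I1, I1)) (\<alpha> (I1, I2)) (\<alpha> (I1, I3)) (\<alpha> (I1, I4)) (\<alpha> (I2, I2)) (\<alpha> (I2, I3))
    (\<alpha> (I2, I4)) (\<alpha> (I3, I3)) (\<alpha> (I3, I4)) (\<alpha> (I4, I4)) p = \<alpha> p"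
    by (cases p; cases "fst p"; cases "snd p") (simp_all add: expt_def)
qed

lemma expt_upper: "p \<notin> upper \<Longrightarrow> expt e11 e12 e13 e14 e22 e23 e24 e33 e34 e44 p = 0"
  by (cases p; cases "fst p"; cases "snd p") (simp_all add: expt_def upper_def)

lemma pmon_expt: "pmon (expt e11 e12 e13 e14 e22 e23 e24 e33 e34 e44) v =
    pairing I1 I1 v ^ e11 * pairing I1 I2 v ^ e12 * pairing I1 I3 v ^ e13 * pairing I1 I4 v ^ e14 *
    pairing I2 I2 v ^ e22 * pairing I2 I3 v ^ e23 * pairing I2 I4 v ^ e24 *
    pairing I3 I3 v ^ e33 * pairing I3 I4 v ^ e34 * pairing I4 I4 v ^ e44"
  by (simp add: pmon_def upper_def expt_def mult.assoc)

lemma sum_expt: "(\<Sum>p\<in>upper. expt e11 e12 e13 e14 e22 e23 e24 e33 e34 e44 p) =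
    e11 + e12 + e13 + e14 + e22 + e23 + e24 + e33 + e34 + e44"
  by (simp add: upper_def expt_def)

lemma ex_ix: "(\<exists>s. P s) \<longleftrightarrow> P I1 \<or> P I2 \<or> P I3 \<or> P I4"
  by (metis ix.exhaust)

lemma standard_expt:
  "(None, expt e11 e12 e13 e14 e22 e23 e24 e33 e34 e44) \<in> standard \<longleftrightarrow> e11 * e22 * e33 * e44 = 0"
  "(Some I1, expt e11 e12 e13 e14 e22 e23 e24 e33 e34 e44) \<in> standard \<longleftrightarrow> e11 = 0"
  "(Some I2, expt e11 e12 e13 e14 e22 e23 e24 e33 e34 e44) \<in> standard \<longleftrightarrow> e22 = 0"
  "(Some I3, expt e11 e12 e13 e14 e22 e23 e24 e33 e34 e44) \<in> standard \<longleftrightarrow> e33 = 0"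
  "(Some I4, expt e11 e12 e13 e14 e22 e23 e24 e33 e34 e44) \<in> standard \<longleftrightarrow> e44 = 0"
  by (simp_all add: standard_def expt_upper ex_ix) (simp_all add: expt_def)

lemma expt_eq_iff:
  "expt e11 e12 e13 e14 e22 e23 e24 e33 e34 e44 = expt d11 d12 d13 d14 d22 d23 d24 d33 d34 d44 \<longleftrightarrow>
    e11 = d11 \<and> e12 = d12 \<and> e13 = d13 \<and> e14 = d14 \<and> e22 = d22 \<and> e23 = d23 \<and> e24 = d24 \<and>
    e33 = d33 \<and> e34 = d34 \<and> e44 = d44"
proof
  assume eq: "expt e11 e12 e13 e14 e22 e23 e24 e33 e34 e44 = expt d11 d12 d13 d14 d22 d23 d24 d33 d34 d44"
  have "expt e11 e12 e13 e14 e22 e23 e24 e33 e34 e44 p = expt d11 d12 d13 d14 d22 d23 d24 d33 d34 d44 p" for p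
    by (simp only: eq)
  from this[of "(I1, I1)"] this[of "(I1, I2)"] this[of "(I1, I3)"] this[of "(I1, I4)"]
    this[of "(I2, I2)"] this[of "(I2, I3)"] this[of "(I2, I4)"] this[of "(I3, I3)"]
    this[of "(I3, I4)"] this[of "(I4, I4)"]
  show "e11 = d11 \<and> e12 = d12 \<and> e13 = d13 \<and> e14 = d14 \<and> e22 = d22 \<and> e23 = d23 \<and> e24 = d24 \<and>
    e33 = d33 \<and> e34 = d34 \<and> e44 = d44"
    by (simp add: expt_def)
qed simp

lemma standard_cases:
  assumes "i \<in> standard"
  obtains t e11 e12 e13 e14 e22 e23 e24 e33 e34 e44
  where "i = (t, expt e11 e12 e13 e14 e22 e23 e24 e33 e34 e44)"
proof -
  have all: "\<forall>p. p \<notin> upper \<longrightarrow> snd i p = 0" using assms by (simp add: standard_def)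
  show ?thesis using that[of "fst i"] expt_eta[of "snd i"] all by (metis prod.collapse)
qed

subsection \<open>Two factors\<close>

definition emb2 :: "2 \<Rightarrow> ix"
  where "emb2 a = (if a = 1 then I1 else I2)"

lemma emb2_simps [simp]: "emb2 1 = I1" "emb2 2 = I2"
  by (simp_all add: emb2_def)

lemma inj_emb2: "inj emb2"
proof (rule injI)
  fix x y assume "emb2 x = emb2 y"
  then show "x = y" using exhaust_2[of x] exhaust_2[of y] by (elim disjE) simp_all
qed

lemma range_emb2: "range emb2 = {I1, I2}"
  by (simp add: UNIV_2)

lemma supported_emb2: "supported (range emb2) (t, expt e11 e12 e13 e14 e22 e23 e24 e33 e34 e44) \<longleftrightarrow>
    t = None \<and> e13 = 0 \<and> e14 = 0 \<and> e23 = 0 \<and> e24 = 0 \<and> e33 = 0 \<and> e34 = 0 \<and> e44 = 0"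
proof -
  have all: "(\<forall>s. P s) \<longleftrightarrow> P I1 \<and> P I2 \<and> P I3 \<and> P I4" for P by (metis ix.exhaust)
  have t: "(\<forall>s. t = Some s \<longrightarrow> - {s} \<subseteq> {I1, I2}) \<longleftrightarrow> t = None"
    by (cases t) (auto simp: subset_iff all)
  show ?thesis
    unfolding supported_def range_emb2 fst_conv snd_conv t by (auto simp: all expt_def)
qed

definition index2 :: "nat \<times> nat \<times> nat \<Rightarrow> ix option \<times> (ix \<times> ix \<Rightarrow> nat)"
  where "index2 = (\<lambda>(a, b, c). (None, expt a b 0 0 c 0 0 0 0 0))"

text \<open>A triple product needs three indices, and \<open>e33 = e44 = 0\<close> makes the
  remaining condition of \<open>standard\<close> automatic, so the exponents are
  unrestricted.\<close>

lemma bij_index2: "bij_betw index2 UNIV {i \<in> standard. supported (range emb2) i}"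
  unfolding bij_betw_def
proof
  show "inj index2" by (auto simp: inj_def index2_def expt_eq_iff)
  show "range index2 = {i \<in> standard. supported (range emb2) i}"
  proof
    show "range index2 \<subseteq> {i \<in> standard. supported (range emb2) i}"
      by (auto simp: index2_def standard_expt supported_emb2)
    show "{i \<in> standard. supported (range emb2) i} \<subseteq> range index2"
    proof
      fix i assume i: "i \<in> {i \<in> standard. supported (range emb2) i}"
      then obtain t e11 e12 e13 e14 e22 e23 e24 e33 e34 e44
        where e: "i = (t, expt e11 e12 e13 e14 e22 e23 e24 e33 e34 e44)" by (auto elim: standard_cases)
      with i have "i = index2 (e11, e12, e22)" by (simp add: supported_emb2 index2_def)
      then show "i \<in> range index2" by blast
    qed
  qed
qed

lemma trace_emb2:
  "pairing I1 I1 (ext_pt emb2 w) = pairing 1 1 w" "pairing I1 I2 (ext_pt emb2 w) = pairing 1 2 w"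
  "pairing I2 I2 (ext_pt emb2 w) = pairing 2 2 w"
  using pairing_ext[OF inj_emb2, of 1 1 w] pairing_ext[OF inj_emb2, of 1 2 w]
    pairing_ext[OF inj_emb2, of 2 2 w] by simp_all

subsection \<open>Three factors\<close>

definition emb3 :: "3 \<Rightarrow> ix"
  where "emb3 a = (if a = 1 then I1 else if a = 2 then I2 else I3)"

lemma emb3_simps [simp]: "emb3 1 = I1" "emb3 2 = I2" "emb3 3 = I3"
  by (simp_all add: emb3_def)

lemma inj_emb3: "inj emb3"
proof (rule injI)
  fix x y assume "emb3 x = emb3 y"
  then show "x = y" using exhaust_3[of x] exhaust_3[of y] by (elim disjE) simp_all
qed

lemma range_emb3: "range emb3 = {I1, I2, I3}"
  by (simp add: UNIV_3)

lemma supported_emb3: "supported (range emb3) (t, expt e11 e12 e13 e14 e22 e23 e24 e33 e34 e44) \<longleftrightarrow>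
    t \<in> {None, Some I4} \<and> e14 = 0 \<and> e24 = 0 \<and> e34 = 0 \<and> e44 = 0"
proof -
  have all: "(\<forall>s. P s) \<longleftrightarrow> P I1 \<and> P I2 \<and> P I3 \<and> P I4" for P by (metis ix.exhaust)
  have t: "(\<forall>s. t = Some s \<longrightarrow> - {s} \<subseteq> {I1, I2, I3}) \<longleftrightarrow> t \<in> {None, Some I4}"
    by (cases t) (auto simp: subset_iff all)
  show ?thesis
    unfolding supported_def range_emb3 fst_conv snd_conv t by (auto simp: all expt_def)
qed

text \<open>\<open>F_123\<close> is the triple product that omits \<open>I4\<close>. As all
  exponents at \<open>I4\<close> are 0, the conditions of \<open>standard\<close> hold automatically
  for both values of \<open>\<epsilon>\<close>.\<close>

definition index3 :: "nat \<times> nat \<times> nat \<times> nat \<times> nat \<times> nat \<times> nat \<Rightarrow> ix option \<times> (ix \<times> ix \<Rightarrow> nat)"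
  where "index3 = (\<lambda>(a, b, c, d, e, f, \<epsilon>). (if \<epsilon> = 0 then None else Some I4, expt a b c 0 d e 0 f 0 0))"

lemma bij_index3: "bij_betw index3 {(a, b, c, d, e, f, \<epsilon>). \<epsilon> \<in> {0, 1}}
    {i \<in> standard. supported (range emb3) i}"
  unfolding bij_betw_def
proof
  show "inj_on index3 {(a, b, c, d, e, f, \<epsilon>). \<epsilon> \<in> {0, 1}}"
    by (auto simp: inj_on_def index3_def expt_eq_iff split: if_splits)
  show "index3 ` {(a, b, c, d, e, f, \<epsilon>). \<epsilon> \<in> {0, 1}} = {i \<in> standard. supported (range emb3) i}"
  proof
    show "index3 ` {(a, b, c, d, e, f, \<epsilon>). \<epsilon> \<in> {0, 1}} \<subseteq> {i \<in> standard. supported (range emb3) i}"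
      by (auto simp: index3_def standard_expt supported_emb3)
    show "{i \<in> standard. supported (range emb3) i} \<subseteq> index3 ` {(a, b, c, d, e, f, \<epsilon>). \<epsilon> \<in> {0, 1}}"
    proof
      fix i assume i: "i \<in> {i \<in> standard. supported (range emb3) i}"
      then obtain t e11 e12 e13 e14 e22 e23 e24 e33 e34 e44
        where e: "i = (t, expt e11 e12 e13 e14 e22 e23 e24 e33 e34 e44)" by (auto elim: standard_cases)
      with i have "i = index3 (e11, e12, e13, e22, e23, e33, if t = None then 0 else 1)"
        by (auto simp: supported_emb3 index3_def)
      then show "i \<in> index3 ` {(a, b, c, d, e, f, \<epsilon>). \<epsilon> \<in> {0, 1}}" by (rule image_eqI) auto
    qed
  qed
qed

lemma trace_emb3:
  "pairing I1 I1 (ext_pt emb3 w) = pairing 1 1 w" "pairing I1 I2 (ext_pt emb3 w) = pairing 1 2 w"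
  "pairing I1 I3 (ext_pt emb3 w) = pairing 1 3 w" "pairing I2 I2 (ext_pt emb3 w) = pairing 2 2 w"
  "pairing I2 I3 (ext_pt emb3 w) = pairing 2 3 w" "pairing I3 I3 (ext_pt emb3 w) = pairing 3 3 w"
  "triple I1 I2 I3 (ext_pt emb3 w) = triple 1 2 3 w"
  using pairing_ext[OF inj_emb3, of 1 1 w] pairing_ext[OF inj_emb3, of 1 2 w]
    pairing_ext[OF inj_emb3, of 1 3 w] pairing_ext[OF inj_emb3, of 2 2 w]
    pairing_ext[OF inj_emb3, of 2 3 w] pairing_ext[OF inj_emb3, of 3 3 w]
    triple_ext[OF inj_emb3, of 1 2 3 w] by simp_all

subsection \<open>Four factors\<close>

definition emb4 :: "4 \<Rightarrow> ix"
  where "emb4 a = (if a = 1 then I1 else if a = 2 then I2 else if a = 3 then I3 else I4)"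

lemma emb4_simps [simp]: "emb4 1 = I1" "emb4 2 = I2" "emb4 3 = I3" "emb4 4 = I4"
  by (simp_all add: emb4_def)

lemma inj_emb4: "inj emb4"
proof (rule injI)
  fix x y assume "emb4 x = emb4 y"
  then show "x = y" using exhaust_4[of x] exhaust_4[of y] by (elim disjE) simp_all
qed

lemma supported_emb4: "supported (range emb4) i"
proof -
  have "b \<in> range emb4" for b
    by (cases b) (metis emb4_simps rangeI)+
  then have "range emb4 = UNIV" by blast
  then show ?thesis by (simp add: supported_def)
qed

text \<open>The exponent that a family lacks is filled with 0: that of \<open>P_44\<close> next to
  \<open>F_123\<close>, and so on up to that of \<open>P_11\<close> next to
  \<open>F_234\<close>.\<close>

definition index4 where
  "index4 = case_sum (\<lambda>(a, b, c, d, e, f, g, h, i). (Some I4, expt a b c d e f g h i 0))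
    (case_sum (\<lambda>(a, b, c, d, e, f, g, h, i). (Some I3, expt a b c d e f g 0 h i))
    (case_sum (\<lambda>(a, b, c, d, e, f, g, h, i). (Some I2, expt a b c d 0 e f g h i))
    (case_sum (\<lambda>(a, b, c, d, e, f, g, h, i). (Some I1, expt 0 a b c d e f g h i))
      (\<lambda>(a, b, c, d, e, f, g, h, i, j). (None, expt a b c d e f g h i j)))))"

lemma bij_index4: "bij_betw index4
    ((UNIV :: (nat \<times> nat \<times> nat \<times> nat \<times> nat \<times> nat \<times> nat \<times> nat \<times> nat) set)
      <+> (UNIV :: (nat \<times> nat \<times> nat \<times> nat \<times> nat \<times> nat \<times> nat \<times> nat \<times> nat) set)
      <+> (UNIV :: (nat \<times> nat \<times> nat \<times> nat \<times> nat \<times> nat \<times> nat \<times> nat \<times> nat) set)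
      <+> (UNIV :: (nat \<times> nat \<times> nat \<times> nat \<times> nat \<times> nat \<times> nat \<times> nat \<times> nat) set)
      <+> {(a :: nat, b :: nat, c :: nat, d :: nat, e :: nat, f :: nat, g :: nat, h :: nat,
            i :: nat, j :: nat). a * e * h * j = 0})
    {i \<in> standard. supported (range emb4) i}"
    (is "bij_betw index4 ?I _")
  unfolding bij_betw_def
proof
  show "inj_on index4 ?I"
    unfolding inj_on_def index4_def Plus_def by (auto simp: expt_eq_iff)
  show "index4 ` ?I = {i \<in> standard. supported (range emb4) i}"
  proof
    show "index4 ` ?I \<subseteq> {i \<in> standard. supported (range emb4) i}"
      unfolding Plus_def by (auto simp: index4_def standard_expt supported_emb4)
    show "{i \<in> standard. supported (range emb4) i} \<subseteq> index4 ` ?I"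
    proof
      fix i assume "i \<in> {i \<in> standard. supported (range emb4) i}"
      then have i: "i \<in> standard" by simp
      then obtain t a b c d e f g h k j
        where eq: "i = (t, expt a b c d e f g h k j)" by (rule standard_cases)
      have t: "t = None \<or> t = Some I1 \<or> t = Some I2 \<or> t = Some I3 \<or> t = Some I4"
        by (cases t) (auto intro: ix.exhaust)
      from t show "i \<in> index4 ` ?I"
      proof (elim disjE)
        assume "t = None"
        with i eq have "a * e * h * j = 0" "i = index4 (Inr (Inr (Inr (Inr (a, b, c, d, e, f, g, h, k, j)))))"
          by (simp_all add: standard_expt index4_def)
        then show ?thesis by (intro image_eqI[of i index4]) auto
      next
        assume "t = Some I1"
        with i eq have "i = index4 (Inr (Inr (Inr (Inl (b, c, d, e, f, g, h, k, j)))))"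
          by (simp add: standard_expt index4_def)
        then show ?thesis by (intro image_eqI[of i index4]) auto
      next
        assume "t = Some I2"
        with i eq have "i = index4 (Inr (Inr (Inl (a, b, c, d, f, g, h, k, j))))"
          by (simp add: standard_expt index4_def)
        then show ?thesis by (intro image_eqI[of i index4]) auto
      next
        assume "t = Some I3"
        with i eq have "i = index4 (Inr (Inl (a, b, c, d, e, f, g, k, j)))"
          by (simp add: standard_expt index4_def)
        then show ?thesis by (intro image_eqI[of i index4]) auto
      next
        assume "t = Some I4"
        with i eq have "i = index4 (Inl (a, b, c, d, e, f, g, h, k))"
          by (simp add: standard_expt index4_def)
        then show ?thesis by (intro image_eqI[of i index4]) auto
      qed
    qed
  qed
qed

lemma trace_emb4:
  "pairing I1 I1 (ext_pt emb4 w) = pairing 1 1 w" "pairing I1 I2 (ext_pt emb4 w) = pairing 1 2 w"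
  "pairing I1 I3 (ext_pt emb4 w) = pairing 1 3 w" "pairing I1 I4 (ext_pt emb4 w) = pairing 1 4 w"
  "pairing I2 I2 (ext_pt emb4 w) = pairing 2 2 w" "pairing I2 I3 (ext_pt emb4 w) = pairing 2 3 w"
  "pairing I2 I4 (ext_pt emb4 w) = pairing 2 4 w" "pairing I3 I3 (ext_pt emb4 w) = pairing 3 3 w"
  "pairing I3 I4 (ext_pt emb4 w) = pairing 3 4 w" "pairing I4 I4 (ext_pt emb4 w) = pairing 4 4 w"
  "triple I1 I2 I3 (ext_pt emb4 w) = triple 1 2 3 w" "triple I1 I2 I4 (ext_pt emb4 w) = triple 1 2 4 w"
  "triple I1 I3 I4 (ext_pt emb4 w) = triple 1 3 4 w" "triple I2 I3 I4 (ext_pt emb4 w) = triple 2 3 4 w"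
  using pairing_ext[OF inj_emb4, of 1 1 w] pairing_ext[OF inj_emb4, of 1 2 w]
    pairing_ext[OF inj_emb4, of 1 3 w] pairing_ext[OF inj_emb4, of 1 4 w]
    pairing_ext[OF inj_emb4, of 2 2 w] pairing_ext[OF inj_emb4, of 2 3 w]
    pairing_ext[OF inj_emb4, of 2 4 w] pairing_ext[OF inj_emb4, of 3 3 w]
    pairing_ext[OF inj_emb4, of 3 4 w] pairing_ext[OF inj_emb4, of 4 4 w]
    triple_ext[OF inj_emb4, of 1 2 3 w] triple_ext[OF inj_emb4, of 1 2 4 w]
    triple_ext[OF inj_emb4, of 1 3 4 w] triple_ext[OF inj_emb4, of 2 3 4 w]
  by (simp_all only: emb4_simps)

lemma tuple9:
  obtains a b c d e f g h i where "y = (a, b, c, d, e, f, g, h, i)"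
proof -
  obtain a b c d e f z where "y = (a, b, c, d, e, f, z)" by (rule prod_cases7)
  moreover obtain g h i where "z = (g, h, i)" by (rule prod_cases3)
  ultimately show ?thesis using that by blast
qed

lemma tuple10:
  obtains a b c d e f g h i j where "y = (a, b, c, d, e, f, g, h, i, j)"
proof -
  obtain a b c d e f z where "y = (a, b, c, d, e, f, z)" by (rule prod_cases7)
  moreover obtain g h i j where "z = (g, h, i, j)" by (rule prod_cases4)
  ultimately show ?thesis using that by blast
qed

lemma sum5_tuple_cases:
  obtains a b c d e f g h k where "x = Inl (a, b, c, d, e, f, g, h, k)"
    | a b c d e f g h k where "x = Inr (Inl (a, b, c, d, e, f, g, h, k))"
    | a b c d e f g h k where "x = Inr (Inr (Inl (a, b, c, d, e, f, g, h, k)))"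
    | a b c d e f g h k where "x = Inr (Inr (Inr (Inl (a, b, c, d, e, f, g, h, k))))"
    | a b c d e f g h k j where "x = Inr (Inr (Inr (Inr (a, b, c, d, e, f, g, h, k, j))))"
proof -
  consider y where "x = Inl y" | y where "x = Inr (Inl y)" | y where "x = Inr (Inr (Inl y))"
    | y where "x = Inr (Inr (Inr (Inl y)))" | y where "x = Inr (Inr (Inr (Inr y)))"
    by (metis sum.exhaust)
  then show thesis
  proof cases
    case (1 y)
    then show ?thesis by (cases y rule: tuple9) (simp add: that(1))
  next
    case (2 y)
    then show ?thesis by (cases y rule: tuple9) (simp add: that(2))
  next
    case (3 y)
    then show ?thesis by (cases y rule: tuple9) (simp add: that(3))
  next
    case (4 y)
    then show ?thesis by (cases y rule: tuple9) (simp add: that(4))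
  next
    case (5 y)
    then show ?thesis by (cases y rule: tuple10) (simp add: that(5))
  qed
qed

theorem mainTheorem4:
  shows "is_basis_family
      (\<lambda>(a, b, c). trP 1 1 ^ a * trP 1 2 ^ b * trP 2 2 ^ c)
      (UNIV :: (nat \<times> nat \<times> nat) set)
      (Z_sl2 :: 2 U_sl2 set)
    \<and> is_basis_family
      (\<lambda>(a, b, c, d, e, f, \<epsilon>).
        trP 1 1 ^ a * trP 1 2 ^ b * trP 1 3 ^ c * trP 2 2 ^ d * trP 2 3 ^ e * trP 3 3 ^ f
          * trF 1 2 3 ^ \<epsilon>)
      {(a :: nat, b :: nat, c :: nat, d :: nat, e :: nat, f :: nat, \<epsilon> :: nat). \<epsilon> \<in> {0, 1}}
      (Z_sl2 :: 3 U_sl2 set)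
    \<and> is_basis_family
      (case_sum
        (\<lambda>(a, b, c, d, e, f, g, h, i).
          trF 1 2 3 * trP 1 1 ^ a * trP 1 2 ^ b * trP 1 3 ^ c * trP 1 4 ^ d * trP 2 2 ^ e
            * trP 2 3 ^ f * trP 2 4 ^ g * trP 3 3 ^ h * trP 3 4 ^ i)
      (case_sum
        (\<lambda>(a, b, c, d, e, f, g, h, i).
          trF 1 2 4 * trP 1 1 ^ a * trP 1 2 ^ b * trP 1 3 ^ c * trP 1 4 ^ d * trP 2 2 ^ e
            * trP 2 3 ^ f * trP 2 4 ^ g * trP 3 4 ^ h * trP 4 4 ^ i)
      (case_sum
        (\<lambda>(a, b, c, d, e, f, g, h, i).
          trF 1 3 4 * trP 1 1 ^ a * trP 1 2 ^ b * trP 1 3 ^ c * trP 1 4 ^ d * trP 2 3 ^ e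
            * trP 2 4 ^ f * trP 3 3 ^ g * trP 3 4 ^ h * trP 4 4 ^ i)
      (case_sum
        (\<lambda>(a, b, c, d, e, f, g, h, i).
          trF 2 3 4 * trP 1 2 ^ a * trP 1 3 ^ b * trP 1 4 ^ c * trP 2 2 ^ d * trP 2 3 ^ e
            * trP 2 4 ^ f * trP 3 3 ^ g * trP 3 4 ^ h * trP 4 4 ^ i)
        (\<lambda>(a, b, c, d, e, f, g, h, i, j).
          trP 1 1 ^ a * trP 1 2 ^ b * trP 1 3 ^ c * trP 1 4 ^ d * trP 2 2 ^ e
            * trP 2 3 ^ f * trP 2 4 ^ g * trP 3 3 ^ h * trP 3 4 ^ i * trP 4 4 ^ j)))))
      ((UNIV :: (nat \<times> nat \<times> nat \<times> nat \<times> nat \<times> nat \<times> nat \<times> nat \<times> nat) set)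
        <+> (UNIV :: (nat \<times> nat \<times> nat \<times> nat \<times> nat \<times> nat \<times> nat \<times> nat \<times> nat) set)
        <+> (UNIV :: (nat \<times> nat \<times> nat \<times> nat \<times> nat \<times> nat \<times> nat \<times> nat \<times> nat) set)
        <+> (UNIV :: (nat \<times> nat \<times> nat \<times> nat \<times> nat \<times> nat \<times> nat \<times> nat \<times> nat) set)
        <+> {(a :: nat, b :: nat, c :: nat, d :: nat, e :: nat, f :: nat, g :: nat, h :: nat,
              i :: nat, j :: nat). a * e * h * j = 0})
      (Z_sl2 :: 4 U_sl2 set)"
proof (intro conjI, goal_cases)
  case 1
  show ?case
  proof (rule centralizer_basis[OF inj_emb2 bij_index2], goal_cases)
    case (1 i)
    show ?case by (cases i) (simp only: prod.case, intro trace_centralizer)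
  next
    case (2 i)
    show ?case
      by (cases i; simp only: prod.case; rule symb_cong, (rule symb_mult symb_power symb_trP)+)
         (simp_all add: index2_def invdeg_def sum_expt invmon_def omit_opt_def pmon_expt trace_emb2)
  qed
next
  case 2
  show ?case
  proof (rule centralizer_basis[OF inj_emb3 bij_index3], goal_cases)
    case (1 i)
    show ?case by (cases i rule: prod_cases7) (simp only: prod.case, intro trace_centralizer)
  next
    case (2 i)
    obtain a b c d e f \<epsilon> where i: "i = (a, b, c, d, e, f, \<epsilon>)" by (rule prod_cases7)
    from 2 i have \<epsilon>: "\<epsilon> = 0 \<or> \<epsilon> = 1" by simp
    show ?case
      unfolding i prod.case
      by (rule symb_cong, (rule symb_mult symb_power symb_trP symb_trF)+)
         (use \<epsilon> in \<open>auto simp: index3_def invdeg_def sum_expt invmon_def omit_opt_def omit_def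
            pmon_expt trace_emb3\<close>)
  qed
next
  case 3
  show ?case
  proof (rule centralizer_basis[OF inj_emb4 bij_index4], goal_cases)
    case (1 x)
    show ?case
      by (cases x rule: sum5_tuple_cases) (simp_all only: sum.case prod.case, (intro trace_centralizer)+)
  next
    case (2 x)
    \<comment> \<open>Symbols commute, so the order in which the factors are written does not affect
      the symbol.\<close>
    show ?case
      by (cases x rule: sum5_tuple_cases; simp only: sum.case prod.case;
          rule symb_cong, (rule symb_mult symb_power symb_trP symb_trF)+)
         (simp_all add: index4_def invdeg_def sum_expt invmon_def omit_opt_def omit_def pmon_expt trace_emb4 mult_ac)
  qed
qed

end
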